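(* Let $m$ be a positive integer and let $(\mathcal{A},\mathcal{G},m)$ be a $\Gamma$-representable family of systems of degree $m$. For every $\varepsilon>0$ there exists $\delta=\delta(m,\varepsilon)>0$, universal for all the members of the family, such that the following holds. Let $(A,G)$ be an element of the family, associated to $\gamma=(\gamma_1,\ldots,\gamma_m)\in\Gamma$. Let $X_1,\ldots,X_m$ be subsets of $G$ and let $X=X_1\times\cdots\times X_m$. If $$|S(A,G,X)|<\delta\,|S(A,G)|,$$ then there are sets $X_i'\subset X_i$, $i\in[1,m]$, with $|X_i'|<\varepsilon|G|/\gamma_i$, for which $$S(A,G,X\setminus X')=\emptyset,$$ where $X\setminus X'=(X_1\setminus X_1')\times\cdots\times(X_m\setminus X_m')$.
   Context: $[a,b]$ denotes the set of integers between $a$ and $b$, both included; $(\mathbf{x})_i$ is the $i$-th component of a tuple $\mathbf{x}$. Systems. A system of degree $m$ is a pair $(A,G)$ where $G$ is a finite set and $A:G^m\to\{0,1\}$ is a property. Its solution set is $S(A,G)=\{\mathbf{x}\in G^m: A(\mathbf{x})=1\}$, and for $X\subset G^m$, $S(A,G,X)=S(A,G)\cap X$. A family $(\mathcal{A},\mathcal{G},m)=\{(A_i,G_i)\}_{i\in I}$ of systems of degree $m$ comes with a collection $\Gamma=\{\gamma(i)\}_{i\in I}$ of $m$-tuples of positive real numbers, $\gamma(i)=(\gamma_1(i),\ldots,\gamma_m(i))$ being the tuple associated with $(A_i,G_i)$. Hypergraphs. For a hypergraph $K$, $V(K)$ and $E(K)$ are its vertex and edge sets and $|K|=|V(K)|$.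 It is $s$-uniform if each edge consists of exactly $s$ vertices, and $m$-coloured if each edge bears a colour in $[1,m]$. A copy of $H$ in $K$ is an injective map $V(H)\to V(K)$ sending each edge of $H$ coloured $i$ to an edge of $K$ coloured $i$. $C(H,K)$ denotes the set of copies of $H$ in $K$. If $H$ has $m$ edges, the $i$-th being coloured $i$, a copy of $H$ is identified with the tuple $(e_1,\ldots,e_m)$ of its edges in $K$, $e_i$ being coloured $i$. Representability. The family $(\mathcal{A},\mathcal{G},m)$ is $\Gamma$-representable if there are positive real numbers $\chi_1,\chi_2$, depending only on the family, such that for each $(A,G)$ in the family with associated $\gamma=(\gamma_1,\ldots,\gamma_m)$ there is a pair of coloured hypergraphs $(K,H)$ satisfying: RP1: $K$ and $H$ are $s$-uniform $m$-coloured hypergraphs; $H$ has $m$ different edges $e_1,\ldots,e_m$, with $e_i$ coloured $i$; $\chi_1\ge |V(H)|=h>s\ge 2$; each edge of $K$ bears a label in $G$ given by a map $l:E(K)\to G$. RP2: There exist a positive integer $p$, a set $Q$ and a surjective map $r:C(H,K)\to S(A,G)\times Q$, $r=(r_0,r_q)$, such that $r_0(H_0)=(l(e_1),\ldots,l(e_m))$ for each copy $H_0=\{e_1,\ldots,e_m\}$, and for every $\mathbf{x}\in S(A,G)$ and $q\in Q$, $$|r^{-1}(\mathbf{x},q)|=p\,\lambda\prod_{i=1}^m\gamma_i\quad\text{with }\lambda=c\,\frac{|K|^s}{|G|},$$ for some $c\ge\chi_2$. RP3: If $e_i$ is an edge coloured $i$ in a copy $H_0\in r^{-1}(\mathbf{x},q)$,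 then exactly $p\,\frac{\prod_{j=1}^m\gamma_j}{\gamma_i}$ copies of $H$ in $r^{-1}(\mathbf{x},q)$ contain $e_i$. *)

theory Defs
  imports Complex_Main "HOL-Library.FuncSet"
begin

text \<open>
  An \<open>m\<close>-tuple is an extensional function on \<open>{1..m}\<close>; the power \<open>G\<^sup>m\<close> is
  \<open>{1..m} \<rightarrow>\<^sub>E G\<close>, and a product of sets is a \<open>Pi\<^sub>E\<close> over \<open>{1..m}\<close>.
  Properties with values in \<open>{0, 1}\<close> are Boolean predicates on tuples.
\<close>

definition solutions :: "nat \<Rightarrow> ((nat \<Rightarrow> 'g) \<Rightarrow> bool) \<Rightarrow> 'g set \<Rightarrow> (nat \<Rightarrow> 'g) set" where
  "solutions m A G = {x \<in> {1..m} \<rightarrow>\<^sub>E G. A x}"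

definition solutions_in ::
  "nat \<Rightarrow> ((nat \<Rightarrow> 'g) \<Rightarrow> bool) \<Rightarrow> 'g set \<Rightarrow> (nat \<Rightarrow> 'g) set \<Rightarrow> (nat \<Rightarrow> 'g) set" where
  "solutions_in m A G X = solutions m A G \<inter> X"

definition system_family ::
  "nat \<Rightarrow> 'i set \<Rightarrow> ('i \<Rightarrow> (nat \<Rightarrow> 'g) \<Rightarrow> bool) \<Rightarrow> ('i \<Rightarrow> 'g set) \<Rightarrow> ('i \<Rightarrow> nat \<Rightarrow> real) \<Rightarrow> bool" where
  "system_family m I A G \<gamma> \<longleftrightarrow>
     (\<forall>i\<in>I. finite (G i) \<and> (\<forall>j\<in>{1..m}. \<gamma> i j > 0))"

text \<open>Each edge is a set of vertices and bears exactly one colour.\<close>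

record 'v coloured_hypergraph =
  verts :: "'v set"
  edges :: "'v set set"
  colour :: "'v set \<Rightarrow> nat"

definition uniform_coloured_hypergraph :: "nat \<Rightarrow> nat \<Rightarrow> 'v coloured_hypergraph \<Rightarrow> bool" where
  "uniform_coloured_hypergraph s m K \<longleftrightarrow>
     finite (verts K) \<and>
     (\<forall>e\<in>edges K. e \<subseteq> verts K \<and> card e = s \<and> colour K e \<in> {1..m})"

text \<open>
  Copies are maps, not subhypergraphs; they are taken extensional on the vertex
  set so that they can be counted.
\<close>

definition copies :: "'v coloured_hypergraph \<Rightarrow> 'w coloured_hypergraph \<Rightarrow> ('v \<Rightarrow> 'w) set" where
  "copies H K = {f \<in> verts H \<rightarrow>\<^sub>E verts K. inj_on f (verts H) \<and>
     (\<forall>e\<in>edges H. f ` e \<in> edges K \<and> colour K (f ` e) = colour H e)}"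

definition copy_edges :: "'v coloured_hypergraph \<Rightarrow> ('v \<Rightarrow> 'w) \<Rightarrow> 'w set set" where
  "copy_edges H f = (\<lambda>e. f ` e) ` edges H"

definition RP1 ::
  "nat \<Rightarrow> 'g set \<Rightarrow> real \<Rightarrow> nat \<Rightarrow> 'w coloured_hypergraph \<Rightarrow> 'v coloured_hypergraph \<Rightarrow>
   (nat \<Rightarrow> 'v set) \<Rightarrow> ('w set \<Rightarrow> 'g) \<Rightarrow> bool" where
  "RP1 m G \<chi>\<^sub>1 s K H e l \<longleftrightarrow>
     uniform_coloured_hypergraph s m K \<and> uniform_coloured_hypergraph s m H \<and>
     bij_betw e {1..m} (edges H) \<and> (\<forall>j\<in>{1..m}. colour H (e j) = j) \<and>
     \<chi>\<^sub>1 \<ge> real (card (verts H)) \<and> card (verts H) > s \<and> s \<ge> 2 \<and>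
     l \<in> edges K \<rightarrow> G"

definition fibre ::
  "'v coloured_hypergraph \<Rightarrow> 'w coloured_hypergraph \<Rightarrow>
   (('v \<Rightarrow> 'w) \<Rightarrow> (nat \<Rightarrow> 'g) \<times> 'q) \<Rightarrow> (nat \<Rightarrow> 'g) \<Rightarrow> 'q \<Rightarrow> ('v \<Rightarrow> 'w) set" where
  "fibre H K r x q = {f \<in> copies H K. r f = (x, q)}"

text \<open>
  The set \<open>Q\<close> is required to be nonempty: with \<open>Q = {}\<close> the map \<open>r\<close> would carry no
  information about the solution set and every system would be representable.
  The constant \<open>c\<close>, hence \<open>\<lambda>\<close>, is the same for all \<open>x\<close> and \<open>q\<close>.
\<close>

definition RP2 ::
  "nat \<Rightarrow> ((nat \<Rightarrow> 'g) \<Rightarrow> bool) \<Rightarrow> 'g set \<Rightarrow> (nat \<Rightarrow> real) \<Rightarrow> real \<Rightarrow> nat \<Rightarrow>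
   'w coloured_hypergraph \<Rightarrow> 'v coloured_hypergraph \<Rightarrow> (nat \<Rightarrow> 'v set) \<Rightarrow> ('w set \<Rightarrow> 'g) \<Rightarrow>
   nat \<Rightarrow> 'q set \<Rightarrow> (('v \<Rightarrow> 'w) \<Rightarrow> (nat \<Rightarrow> 'g) \<times> 'q) \<Rightarrow> bool" where
  "RP2 m A G \<gamma> \<chi>\<^sub>2 s K H e l p Q r \<longleftrightarrow>
     p > 0 \<and> Q \<noteq> {} \<and>
     r ` copies H K = solutions m A G \<times> Q \<and>
     (\<forall>f\<in>copies H K. fst (r f) = (\<lambda>j\<in>{1..m}. l (f ` e j))) \<and>
     (\<exists>c \<ge> \<chi>\<^sub>2. \<forall>x\<in>solutions m A G. \<forall>q\<in>Q.
        real (card (fibre H K r x q)) =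
          real p * (c * real (card (verts K)) ^ s / real (card G)) * (\<Prod>j=1..m. \<gamma> j))"

definition RP3 ::
  "nat \<Rightarrow> ((nat \<Rightarrow> 'g) \<Rightarrow> bool) \<Rightarrow> 'g set \<Rightarrow> (nat \<Rightarrow> real) \<Rightarrow>
   'w coloured_hypergraph \<Rightarrow> 'v coloured_hypergraph \<Rightarrow>
   nat \<Rightarrow> 'q set \<Rightarrow> (('v \<Rightarrow> 'w) \<Rightarrow> (nat \<Rightarrow> 'g) \<times> 'q) \<Rightarrow> bool" where
  "RP3 m A G \<gamma> K H p Q r \<longleftrightarrow>
     (\<forall>x\<in>solutions m A G. \<forall>q\<in>Q. \<forall>f\<in>fibre H K r x q. \<forall>i\<in>{1..m}. \<forall>d\<in>copy_edges H f.
        colour K d = i \<longrightarrow>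
        real (card {f' \<in> fibre H K r x q. d \<in> copy_edges H f'}) =
          real p * ((\<Prod>j=1..m. \<gamma> j) / \<gamma> i))"

text \<open>
  Taking the vertices and the elements of \<open>Q\<close> to be natural numbers loses no
  generality: hypergraphs are finite, and \<open>Q\<close> is finite by surjectivity of \<open>r\<close>
  unless there are no solutions, in which case any nonempty \<open>Q\<close> can be replaced by
  a singleton.
\<close>

definition representable ::
  "nat \<Rightarrow> 'i set \<Rightarrow> ('i \<Rightarrow> (nat \<Rightarrow> 'g) \<Rightarrow> bool) \<Rightarrow> ('i \<Rightarrow> 'g set) \<Rightarrow> ('i \<Rightarrow> nat \<Rightarrow> real) \<Rightarrow> bool" where
  "representable m I A G \<gamma> \<longleftrightarrow>
     (\<exists>\<chi>\<^sub>1 > 0. \<exists>\<chi>\<^sub>2 > 0. \<forall>i\<in>I.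
        \<exists>s. \<exists>(K :: nat coloured_hypergraph) (H :: nat coloured_hypergraph) e l.
          RP1 m (G i) \<chi>\<^sub>1 s K H e l \<and>
          (\<exists>p (Q :: nat set) r.
             RP2 m (A i) (G i) (\<gamma> i) \<chi>\<^sub>2 s K H e l p Q r \<and>
             RP3 m (A i) (G i) (\<gamma> i) K H p Q r))"

end

theory Submission
  imports Defs "HOL-Probability.Conditional_Expectation"
begin

text \<open>
  The theorem is the hypergraph removal lemma, read through a representation of the system.
  Let \<open>\<lambda>\<close> be the constant of RP2. By RP2 all pairs \<open>(x, q)\<close> have equally many copies of \<open>H\<close>
  above them, so a small proportion of solutions in \<open>X\<close> means a small proportion of copies of \<open>H\<close>
  whose edges are labelled in the sets \<open>X j\<close>, and there are at most \<open>|K|^h\<close> copies altogether.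
  The removal lemma (\<open>hypergraph_removal\<close>) destroys all these copies by deleting
  \<open>\<epsilon>' |K|^s\<close> edges of each colour. Let \<open>X' j\<close> consist of the labels borne by at least
  \<open>\<lambda> \<gamma> j / m\<close> deleted edges of colour \<open>j\<close>; these are few. A solution \<open>x\<close> with entries in the sets
  \<open>X j - X' j\<close> cannot exist: each of the \<open>p \<lambda> \<Prod>\<gamma>\<close> copies above \<open>(x, q)\<close> contains, for some \<open>j\<close>, a
  deleted edge of colour \<open>j\<close> with label \<open>x j\<close>; there are fewer than \<open>\<lambda> \<gamma> j / m\<close> such edges for
  each \<open>j\<close>, and by RP3 each of them lies in at most \<open>p \<Prod>\<gamma> / \<gamma> j\<close> of the copies. Summing over \<open>j\<close>
  gives fewer than \<open>p \<lambda> \<Prod>\<gamma>\<close> copies (\<open>representable_system_removal\<close>).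

  The removal lemma is proved by compactness. Counterexamples for \<open>\<delta> = 1, 1/2, 1/3, \<dots>\<close> are put
  together in an ultraproduct, whose internal sets carry a probability measure, the Loeb measure.
  For a set \<open>e\<close> of coordinates let \<open>A e\<close> be the algebra of internal sets that depend only on the
  coordinates in \<open>e\<close>. In the limit the counterexamples become sets \<open>E e\<close> in \<open>A e\<close> whose
  intersection is null, and it is enough to make the sets slightly smaller, within \<open>A e\<close>, so that the
  intersection becomes empty: emptiness and smallness of internal sets pass back to the
  finite structures.

  This limit statement (\<open>infinitary_removal\<close>) holds more generally for sets \<open>E e\<close> in the
  \<open>\<sigma>\<close>-algebra generated by the \<open>A g\<close> with \<open>g \<subseteq> e\<close> and \<open>g\<close> in a family \<open>F\<close> closed under subsets,
  and in this form it is proved by eliminating one face at a time. If \<open>f\<close> is a maximal member of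
  \<open>F\<close>, then, given its proper subfaces, \<open>f\<close> is independent of all other members of \<open>F\<close>
  (\<open>Face_independent\<close>; the reason is that, once the coordinates outside \<open>f\<close> are frozen, each other
  face sees only a proper part of \<open>f\<close>). Up to a small error, \<open>E e\<close> is glued from
  sets not involving \<open>f\<close> along a finite partition into sets \<open>a\<close> in \<open>A f\<close>. On each piece \<open>a\<close> one
  replaces \<open>E e\<close> by the set of points at which the conditional probability of \<open>a - E e\<close> is tiny
  compared with that of \<open>a\<close>. This set does not involve \<open>f\<close>, it contains most of \<open>a \<inter> E e\<close>, and the
  new intersection \<open>Y\<close> is still null: on \<open>a \<inter> Y\<close> the sets \<open>E e\<close> together miss at most half of the
  mass, yet their intersection is null, so \<open>a \<inter> Y\<close> is null, while \<open>a\<close> has positive conditional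
  probability almost
  everywhere on \<open>Y\<close>.
\<close>

section \<open>Ultrafilters and limits along them\<close>

definition ultrafilter :: "'a filter \<Rightarrow> bool" where
  "ultrafilter U \<longleftrightarrow> U \<noteq> bot \<and> (\<forall>P. eventually P U \<or> eventually (\<lambda>x. \<not> P x) U)"

text \<open>
  Zorn's lemma yields a minimal proper filter below \<open>F\<close>; adding a set to a minimal filter either
  changes nothing or destroys properness, which is the dichotomy defining ultrafilters.
\<close>
lemma ultrafilter_exists:
  assumes "F \<noteq> bot"
  shows "\<exists>U\<le>F. ultrafilter U"
proof -
  define Fs where "Fs = {G. G \<noteq> bot \<and> G \<le> F}"
  have "\<exists>U\<in>Fs. \<forall>G\<in>Fs. G \<le> U \<longrightarrow> G = U"
  proof (rule predicate_Zorn[where P = "\<lambda>a b. b \<le> a"])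
    show "partial_order_on Fs (relation_of (\<lambda>a b. b \<le> a) Fs)"
      by (rule partial_order_on_relation_ofI) auto
    fix C assume C: "C \<in> Chains (relation_of (\<lambda>a b. b \<le> a) Fs)"
    show "\<exists>u\<in>Fs. \<forall>a\<in>C. u \<le> a"
    proof (cases "C = {}")
      case True
      then show ?thesis using assms by (auto simp: Fs_def)
    next
      case False
      have chain: "G \<le> H \<or> H \<le> G" "G \<in> Fs" if "G \<in> C" "H \<in> C" for G H
        using C that by (auto simp: Chains_def relation_of_def)
      have ev: "eventually P (Inf C) \<longleftrightarrow> (\<exists>b\<in>C. eventually P b)" for P
      proof (rule eventually_Inf_base[OF False])
        show "\<exists>x\<in>C. x \<le> inf G H" if "G \<in> C" "H \<in> C" for G H
          using chain[OF that] that by (metis inf.absorb_iff2 inf.orderE order_refl)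
      qed
      then have "Inf C \<noteq> bot"
        using chain(2) unfolding trivial_limit_def ev by (auto simp: Fs_def trivial_limit_def)
      moreover have "Inf C \<le> F"
        using False chain(2) by (auto simp: Fs_def intro: Inf_lower2)
      ultimately show ?thesis
        by (auto simp: Fs_def intro: Inf_lower)
    qed
  qed
  then obtain U where U: "U \<noteq> bot" "U \<le> F" and min: "\<And>G. G \<noteq> bot \<Longrightarrow> G \<le> U \<Longrightarrow> G = U"
    by (auto simp: Fs_def)
  have "eventually P U \<or> eventually (\<lambda>x. \<not> P x) U" for P
  proof (cases "inf U (principal {x. P x}) = bot")
    case True
    then have "eventually (\<lambda>x. \<not> P x) U"
      by (simp add: trivial_limit_def eventually_inf_principal)
    then show ?thesis ..
  next
    case False
    then have "inf U (principal {x. P x}) = U"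
      by (intro min) auto
    moreover have "eventually P (inf U (principal {x. P x}))"
      by (simp add: eventually_inf_principal)
    ultimately show ?thesis by simp
  qed
  then show ?thesis
    using U by (auto simp: ultrafilter_def)
qed

lemma ultrafilter_not_eventually:
  "ultrafilter U \<Longrightarrow> (\<not> eventually P U) \<longleftrightarrow> eventually (\<lambda>x. \<not> P x) U"
proof -
  assume U: "ultrafilter U"
  have False if "eventually P U" "eventually (\<lambda>x. \<not> P x) U"
    using eventually_conj[OF that] U by (simp add: ultrafilter_def)
  then show ?thesis
    using U unfolding ultrafilter_def by blast
qed

lemma ultrafilter_tendsto_compact:
  fixes x :: "'a \<Rightarrow> 'b::topological_space"
  assumes U: "ultrafilter U" and K: "compact K" and x: "\<And>n. x n \<in> K"
  shows "\<exists>L. (x \<longlongrightarrow> L) U"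
proof (rule ccontr)
  assume "\<not> ?thesis"
  then have "\<exists>S. open S \<and> L \<in> S \<and> eventually (\<lambda>n. x n \<notin> S) U" for L
    using ultrafilter_not_eventually[OF U] by (fastforce simp: tendsto_def)
  then obtain S where S: "\<And>L. open (S L)" "\<And>L. L \<in> S L" "\<And>L. eventually (\<lambda>n. x n \<notin> S L) U"
    by metis
  obtain C where C: "finite C" "K \<subseteq> (\<Union>L\<in>C. S L)"
  proof (rule compactE_image[OF K, of UNIV S])
    show "K \<subseteq> (\<Union>L\<in>UNIV. S L)" using S(2) by blast
  qed (use S(1) in auto)
  have "eventually (\<lambda>n. \<forall>L\<in>C. x n \<notin> S L) U"
    using C(1) S(3) by (simp add: eventually_ball_finite)
  then have "eventually (\<lambda>n. False) U"
    by (rule eventually_mono) (use C(2) x in blast)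
  then show False
    using U by (simp add: ultrafilter_def)
qed

section \<open>The Loeb measure of an ultraproduct of finite sets\<close>

text \<open>
  A point of the ultraproduct is represented by a sequence of points of the finite sets \<open>X n\<close>.
  Sequences that agree \<open>U\<close>-almost everywhere are not identified: internal sets cannot tell them
  apart, so events and probabilities are the same with and without the quotient.
\<close>
locale ultraproduct =
  fixes U :: "nat filter" and X :: "nat \<Rightarrow> 'a set"
  assumes ultra: "ultrafilter U" and free: "U \<le> sequentially"
    and fin: "\<And>n. finite (X n)" and ne: "\<And>n. X n \<noteq> {}"
begin

definition points :: "(nat \<Rightarrow> 'a) set" where
  "points = {\<omega>. \<forall>n. \<omega> n \<in> X n}"

definition internal :: "(nat \<Rightarrow> 'a set) \<Rightarrow> (nat \<Rightarrow> 'a) set" where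
  "internal D = {\<omega>\<in>points. \<forall>\<^sub>F n in U. \<omega> n \<in> D n}"

definition rel_size :: "(nat \<Rightarrow> 'a set) \<Rightarrow> nat \<Rightarrow> real" where
  "rel_size D n = card (D n \<inter> X n) / card (X n)"

definition dens :: "(nat \<Rightarrow> 'a set) \<Rightarrow> real" where
  "dens D = Lim U (rel_size D)"

lemma U_ne: "U \<noteq> bot" using ultra by (simp add: ultrafilter_def)

lemmas not_eventually_U = ultrafilter_not_eventually[OF ultra]

lemma card_X: "card (X n) > 0"
  using fin ne by (simp add: card_gt_0_iff)

lemma rel_size_bounds: "0 \<le> rel_size D n" "rel_size D n \<le> 1"
proof -
  show "0 \<le> rel_size D n" by (simp add: rel_size_def)
  have "card (D n \<inter> X n) \<le> card (X n)" by (intro card_mono fin) auto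
  then show "rel_size D n \<le> 1" using card_X[of n] by (simp add: rel_size_def)
qed

lemma rel_size_tendsto: "(rel_size D \<longlongrightarrow> dens D) U"
proof -
  obtain L where "(rel_size D \<longlongrightarrow> L) U"
    using ultrafilter_tendsto_compact[OF ultra, of "{0..1::real}" "rel_size D"] rel_size_bounds by auto
  then show ?thesis
    using tendsto_Lim[OF U_ne] unfolding dens_def by blast
qed

lemma densI: "(rel_size D \<longlongrightarrow> L) U \<Longrightarrow> dens D = L"
  unfolding dens_def by (rule tendsto_Lim[OF U_ne])

lemma dens_bounds: "0 \<le> dens D" "dens D \<le> 1"
  using tendsto_lowerbound[OF rel_size_tendsto _ U_ne] tendsto_upperbound[OF rel_size_tendsto _ U_ne] rel_size_bounds
  by (auto simp: eventually_True)

lemma internal_subset: "internal D \<subseteq> points" by (auto simp: internal_def)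

lemma internal_Int: "internal (\<lambda>n. D n \<inter> E n) = internal D \<inter> internal E"
  by (auto simp: internal_def eventually_conj_iff)

lemma internal_diff: "internal (\<lambda>n. D n - E n) = internal D - internal E"
  using not_eventually_U by (auto simp: internal_def eventually_conj_iff)

lemma internal_UNIV: "internal (\<lambda>n. UNIV) = points"
  by (auto simp: internal_def)

lemma internal_empty: "internal (\<lambda>n. {}) = {}"
  using U_ne by (auto simp: internal_def trivial_limit_def)

lemma internal_Compl: "internal (\<lambda>n. - D n) = points - internal D"
  using internal_diff[of "\<lambda>n. UNIV" D] by (simp add: internal_UNIV Compl_eq_Diff_UNIV)

lemma internal_Un: "internal (\<lambda>n. D n \<union> E n) = internal D \<union> internal E"
proof -
  have "internal (\<lambda>n. D n \<union> E n) = internal (\<lambda>n. - (- D n \<inter> - E n))" by simp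
  also have "\<dots> = internal D \<union> internal E"
    unfolding internal_Compl internal_Int using internal_subset by blast
  finally show ?thesis .
qed

lemma internal_INT:
  assumes "finite I"
  shows "internal (\<lambda>n. {x. \<forall>i\<in>I. x \<in> D i n}) = {\<omega>\<in>points. \<forall>i\<in>I. \<omega> \<in> internal (D i)}"
  by (auto simp: internal_def eventually_ball_finite_distrib[OF assms])

text \<open>
  An inclusion of internal sets is witnessed coordinatewise: if it failed for almost all \<open>n\<close>,
  the points at which it fails would assemble to a point of the ultraproduct.
  This is what carries statements about internal sets back to the finite sets \<open>X n\<close>.
\<close>
lemma internal_subset_iff: "internal D \<subseteq> internal E \<longleftrightarrow> (\<forall>\<^sub>F n in U. D n \<inter> X n \<subseteq> E n)"
proof
  assume ev: "\<forall>\<^sub>F n in U. D n \<inter> X n \<subseteq> E n"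
  show "internal D \<subseteq> internal E"
  proof
    fix \<omega> assume "\<omega> \<in> internal D"
    then have w: "\<And>n. \<omega> n \<in> X n" "\<forall>\<^sub>F n in U. \<omega> n \<in> D n"
      by (auto simp: internal_def points_def)
    from ev w(2) have "\<forall>\<^sub>F n in U. \<omega> n \<in> E n"
      by eventually_elim (use w(1) in auto)
    then show "\<omega> \<in> internal E" using w(1) by (simp add: internal_def points_def)
  qed
next
  assume sub: "internal D \<subseteq> internal E"
  show "\<forall>\<^sub>F n in U. D n \<inter> X n \<subseteq> E n"
  proof (rule ccontr)
    assume "\<not> ?thesis"
    then have ev: "\<forall>\<^sub>F n in U. \<not> D n \<inter> X n \<subseteq> E n" by (simp add: not_eventually_U)
    have "\<forall>n. \<exists>x. x \<in> X n \<and> (\<not> D n \<inter> X n \<subseteq> E n \<longrightarrow> x \<in> D n \<and> x \<notin> E n)"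
      using ne by blast
    then obtain \<omega> where w: "\<And>n. \<omega> n \<in> X n" "\<And>n. \<not> D n \<inter> X n \<subseteq> E n \<Longrightarrow> \<omega> n \<in> D n \<and> \<omega> n \<notin> E n"
      by metis
    have "\<forall>\<^sub>F n in U. \<omega> n \<in> D n - E n"
      using ev by (rule eventually_mono) (use w in auto)
    then have "\<omega> \<in> internal D - internal E"
      unfolding internal_diff[symmetric] by (auto simp: internal_def points_def w)
    then show False using sub by auto
  qed
qed

lemma internal_empty_iff: "internal D = {} \<longleftrightarrow> (\<forall>\<^sub>F n in U. D n \<inter> X n = {})"
  using internal_subset_iff[of D "\<lambda>n. {}"] by (simp add: internal_empty)

lemma dens_mono: "internal D \<subseteq> internal E \<Longrightarrow> dens D \<le> dens E"
proof (rule tendsto_le[OF U_ne rel_size_tendsto rel_size_tendsto])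
  assume "internal D \<subseteq> internal E"
  then have "\<forall>\<^sub>F n in U. D n \<inter> X n \<subseteq> E n" by (simp add: internal_subset_iff)
  then show "\<forall>\<^sub>F n in U. rel_size D n \<le> rel_size E n"
  proof (rule eventually_mono)
    fix n assume "D n \<inter> X n \<subseteq> E n"
    then have "card (D n \<inter> X n) \<le> card (E n \<inter> X n)" by (intro card_mono) (use fin in auto)
    then show "rel_size D n \<le> rel_size E n" by (simp add: rel_size_def divide_right_mono)
  qed
qed

lemma dens_cong: "internal D = internal E \<Longrightarrow> dens D = dens E"
  by (intro antisym dens_mono) auto

lemma dens_disjoint_Un:
  assumes "internal D \<inter> internal E = {}"
  shows "dens (\<lambda>n. D n \<union> E n) = dens D + dens E"
proof (rule densI)
  have "\<forall>\<^sub>F n in U. (D n \<inter> E n) \<inter> X n = {}"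
    using assms unfolding internal_Int[symmetric] internal_empty_iff .
  then have "\<forall>\<^sub>F n in U. rel_size D n + rel_size E n = rel_size (\<lambda>n. D n \<union> E n) n"
  proof (rule eventually_mono)
    fix n assume "(D n \<inter> E n) \<inter> X n = {}"
    then have "card ((D n \<inter> X n) \<union> (E n \<inter> X n)) = card (D n \<inter> X n) + card (E n \<inter> X n)"
      by (intro card_Un_disjoint) (use fin in auto)
    then show "rel_size D n + rel_size E n = rel_size (\<lambda>n. D n \<union> E n) n"
      by (simp add: rel_size_def Int_Un_distrib2 add_divide_distrib)
  qed
  with tendsto_add[OF rel_size_tendsto rel_size_tendsto]
  show "(rel_size (\<lambda>n. D n \<union> E n) \<longlongrightarrow> dens D + dens E) U"
    by (rule Lim_transform_eventually)
qed

text \<open>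
  Countable saturation, the source of countable additivity. The point in the intersection is
  diagonal: its \<open>n\<close>-th entry is taken from as many of the first \<open>n\<close> sets as possible
  simultaneously, and for each fixed \<open>i\<close> this number exceeds \<open>i\<close> for \<open>U\<close>-almost all \<open>n\<close>.
\<close>
lemma internal_saturated:
  assumes dec: "decseq (\<lambda>i. internal (D i))" and empty: "(\<Inter>i. internal (D i)) = {}"
  shows "\<exists>i. internal (D i) = {}"
proof (rule ccontr)
  assume "\<not> ?thesis"
  then have nonempty: "internal (D i) \<noteq> {}" for i by auto
  \<comment> \<open>The sets \<open>D i n\<close> need not decrease in \<open>i\<close> for every \<open>n\<close>; the sets \<open>C i n\<close> do, and define the same internal sets.\<close>
  define C where "C i n = {x. \<forall>j\<in>{..i}. x \<in> D j n}" for i n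
  have "internal (C i) = internal (D i)" for i
  proof -
    have "internal (C i) = {\<omega>\<in>points. \<forall>j\<in>{..i}. \<omega> \<in> internal (D j)}"
      unfolding C_def by (rule internal_INT) simp
    also have "\<dots> = internal (D i)"
      using decseqD[OF dec] internal_subset by fastforce
    finally show ?thesis .
  qed
  then have "\<not> (\<forall>\<^sub>F n in U. C i n \<inter> X n = {})" for i
    using nonempty[of i] internal_empty_iff[of "C i"] by auto
  then have ev: "\<forall>\<^sub>F n in U. C i n \<inter> X n \<noteq> {}" for i
    by (simp add: not_eventually_U)
  have "\<exists>x. x \<in> X n \<and> (\<forall>i\<le>n. C i n \<inter> X n \<noteq> {} \<longrightarrow> x \<in> C i n)" for n
  proof (cases "\<exists>i\<le>n. C i n \<inter> X n \<noteq> {}")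
    case True
    define k where "k = Max {i. i \<le> n \<and> C i n \<inter> X n \<noteq> {}}"
    have "k \<in> {i. i \<le> n \<and> C i n \<inter> X n \<noteq> {}}"
      unfolding k_def using True by (intro Max_in) auto
    then obtain x where x: "x \<in> C k n \<inter> X n" by auto
    have "x \<in> C i n" if "i \<le> n" "C i n \<inter> X n \<noteq> {}" for i
    proof -
      have "i \<le> k" unfolding k_def using that by (intro Max_ge) auto
      then show ?thesis using x by (auto simp: C_def)
    qed
    then show ?thesis using x by blast
  next
    case False
    then show ?thesis using ne[of n] by blast
  qed
  then obtain \<omega> where w: "\<And>n. \<omega> n \<in> X n" "\<And>n i. i \<le> n \<Longrightarrow> C i n \<inter> X n \<noteq> {} \<Longrightarrow> \<omega> n \<in> C i n"
    by metis
  have "\<omega> \<in> internal (D i)" for i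
  proof -
    have "\<forall>\<^sub>F n in U. i \<le> n" using free by (rule filter_leD) (rule eventually_ge_at_top)
    with ev[of i] have "\<forall>\<^sub>F n in U. \<omega> n \<in> D i n"
    proof eventually_elim
      case (elim n)
      then have "\<omega> n \<in> C i n" by (intro w)
      then show ?case by (simp add: C_def)
    qed
    then show ?thesis using w by (simp add: internal_def points_def)
  qed
  then show False using empty by blast
qed

lemma internal_algebra: "algebra points (range internal)"
  unfolding algebra_iff_Int
proof (intro conjI ballI)
  show "range internal \<subseteq> Pow points" using internal_subset by auto
  show "{} \<in> range internal" by (auto simp: internal_empty[symmetric])
  show "points - a \<in> range internal" if "a \<in> range internal" for a
    using that by (auto simp: internal_Compl[symmetric])
  show "a \<inter> b \<in> range internal" if "a \<in> range internal" "b \<in> range internal" for a b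
    using that by (auto simp: internal_Int[symmetric])
qed

text \<open>
  By saturation, a decreasing sequence of internal sets with empty intersection is eventually
  empty, so the limit density is continuous at the empty set for a trivial reason, and
  Caratheodory's theorem extends it to a measure.
\<close>
lemma Loeb_measure_exists:
  "\<exists>M. prob_space M \<and> space M = points \<and> sets M = sigma_sets points (range internal) \<and>
     (\<forall>D. measure M (internal D) = dens D)"
proof -
  define rep where "rep A = (SOME D. internal D = A)" for A
  have rep: "internal (rep (internal D)) = internal D" for D
    unfolding rep_def by (rule someI[where P = "\<lambda>D'. internal D' = internal D", OF refl])
  define f where "f A = ennreal (dens (rep A))" for A
  have f: "f (internal D) = ennreal (dens D)" for D
    unfolding f_def by (subst dens_cong[OF rep]) simp
  have dens_empty: "dens (\<lambda>n. {}) = 0"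
    by (rule densI) (simp add: rel_size_def[abs_def])
  interpret algebra points "range internal" by (rule internal_algebra)
  have "\<exists>\<mu>. (\<forall>s\<in>range internal. \<mu> s = f s) \<and> measure_space points (sigma_sets points (range internal)) \<mu>"
  proof (rule caratheodory_empty_continuous)
    show "positive (range internal) f"
      using f[of "\<lambda>n. {}"] by (simp add: positive_def internal_empty dens_empty)
    show "additive (range internal) f"
    proof (unfold additive_def, safe)
      fix D E assume "internal D \<inter> internal E = {}"
      then show "f (internal D \<union> internal E) = f (internal D) + f (internal E)"
        unfolding internal_Un[symmetric] f dens_disjoint_Un[OF \<open>internal D \<inter> internal E = {}\<close>]
        by (simp add: dens_bounds)
    qed
    show "f A \<noteq> \<infinity>" for A by (simp add: f_def)
    fix B :: "nat \<Rightarrow> (nat \<Rightarrow> 'a) set"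
    assume B: "range B \<subseteq> range internal" "decseq B" "(\<Inter>i. B i) = {}"
    then have "\<forall>i. \<exists>D. B i = internal D" by blast
    then obtain D where D: "\<And>i. B i = internal (D i)" by metis
    have "\<exists>i. internal (D i) = {}"
      using B unfolding D by (intro internal_saturated) (auto simp: D[symmetric])
    then obtain i where i: "B i = {}" using D by auto
    have "f (B j) = 0" if "i \<le> j" for j
    proof -
      have "B j = internal (\<lambda>n. {})"
        using decseqD[OF B(2) that] i by (auto simp: internal_empty)
      then show ?thesis by (simp add: f dens_empty)
    qed
    then show "(\<lambda>j. f (B j)) \<longlonglongrightarrow> 0"
      by (intro tendsto_eventually) (auto simp: eventually_sequentially)
  qed
  then obtain \<mu> where mu: "\<And>D. \<mu> (internal D) = ennreal (dens D)"
    and ms: "measure_space points (sigma_sets points (range internal)) \<mu>"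
    by (auto simp: f)
  define M where "M = measure_of points (range internal) \<mu>"
  have sub: "range internal \<subseteq> Pow points" using internal_subset by auto
  have sp: "space M = points" and se: "sets M = sigma_sets points (range internal)"
    unfolding M_def using sub by simp_all
  have em: "emeasure M (internal D) = ennreal (dens D)" for D
    unfolding mu[symmetric] M_def
    by (rule emeasure_measure_of[OF refl]) (use sub ms in \<open>auto simp: measure_space_def\<close>)
  have "dens (\<lambda>n. UNIV) = 1"
    by (rule densI) (use card_X in \<open>simp add: rel_size_def[abs_def] less_imp_neq[symmetric]\<close>)
  then have "prob_space M"
    by (intro prob_spaceI) (use em[of "\<lambda>n. UNIV"] in \<open>simp add: sp internal_UNIV\<close>)
  moreover have "measure M (internal D) = dens D" for D
    using em by (simp add: measure_def dens_bounds)
  ultimately show ?thesis using sp se by blast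
qed

end

section \<open>Approximation of events by a generating algebra\<close>

text \<open>
  The set that agrees with \<open>L x\<close> on the atom labelled by \<open>x\<close> of the finite algebra generated by \<open>S\<close>.
  Labelling an atom by the members of \<open>S\<close> that contain it makes refinement of \<open>S\<close> trivial: the label
  for a subset of \<open>S\<close> is obtained by intersection.
\<close>
definition glue :: "'a set \<Rightarrow> 'a set set \<Rightarrow> ('a set set \<Rightarrow> 'a set) \<Rightarrow> 'a set" where
  "glue \<Omega> S L = {\<omega>\<in>\<Omega>. \<omega> \<in> L {s\<in>S. \<omega> \<in> s}}"

definition atom :: "'a set \<Rightarrow> 'a set set \<Rightarrow> 'a set set \<Rightarrow> 'a set" where
  "atom \<Omega> S x = {\<omega>\<in>\<Omega>. {s\<in>S. \<omega> \<in> s} = x}"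

lemma (in algebra) atom_in_algebra:
  assumes "finite S" "S \<subseteq> M"
  shows "atom \<Omega> S x \<in> M"
  using assms
proof (induction S arbitrary: x)
  case empty
  then show ?case by (cases "x = {}") (auto simp: atom_def)
next
  case (insert s S)
  then have IH: "atom \<Omega> S y \<in> M" for y by auto
  have s: "s \<in> M" using insert.prems by auto
  have "atom \<Omega> (insert s S) x =
      (if s \<in> x then s \<inter> atom \<Omega> S (x - {s}) else atom \<Omega> S x - s)"
    using sets_into_space[OF s] insert.hyps by (auto simp: atom_def)
  then show ?case using IH s by auto
qed

lemma glue_eq_UN_atom: "glue \<Omega> S L = (\<Union>x\<in>Pow S. atom \<Omega> S x \<inter> L x)"
proof (intro set_eqI iffI)
  fix \<omega> assume "\<omega> \<in> glue \<Omega> S L"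
  then have "\<omega> \<in> atom \<Omega> S {s\<in>S. \<omega> \<in> s} \<inter> L {s\<in>S. \<omega> \<in> s}" "{s\<in>S. \<omega> \<in> s} \<in> Pow S"
    by (auto simp: glue_def atom_def)
  then show "\<omega> \<in> (\<Union>x\<in>Pow S. atom \<Omega> S x \<inter> L x)" by blast
next
  fix \<omega> assume "\<omega> \<in> (\<Union>x\<in>Pow S. atom \<Omega> S x \<inter> L x)"
  then obtain x where "\<omega> \<in> \<Omega>" "{s\<in>S. \<omega> \<in> s} = x" "\<omega> \<in> L x" by (auto simp: atom_def)
  then show "\<omega> \<in> glue \<Omega> S L" by (simp add: glue_def)
qed

text \<open>
  The sets that can be approximated in this way contain both generating families, and they form
  a \<open>\<sigma>\<close>-algebra: complements are glued from complements, and a countable union is, up to a small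
  error, a finite one, for which the finite sets \<open>S\<close> are united.
\<close>
lemma (in prob_space) approx_by_glue:
  assumes A: "A \<subseteq> events" and N: "subalgebra M N"
    and D: "D \<in> sigma_sets (space M) (A \<union> sets N)" and \<epsilon>: "\<epsilon> > 0"
  shows "\<exists>S L. finite S \<and> S \<subseteq> A \<and> (\<forall>x. L x \<in> sets N) \<and> prob (sym_diff D (glue (space M) S L)) < \<epsilon>"
  using D \<epsilon>
proof (induction arbitrary: \<epsilon>)
  case (Basic D)
  have sp: "space N = space M" and sub: "sets N \<subseteq> events" using N by (auto simp: subalgebra_def)
  show ?case
  proof (cases "D \<in> A")
    case True
    then have "D \<subseteq> space M" using A sets.sets_into_space by blast
    then have glue: "glue (space M) {D} (\<lambda>x. if x = {} then {} else space M) = D"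
      by (auto simp: glue_def)
    have "space M \<in> sets N" using sets.top[of N] by (simp add: sp)
    then show ?thesis
      using True Basic.prems glue
      by (intro exI[of _ "{D}"] exI[of _ "\<lambda>x. if x = {} then {} else space M"]) simp
  next
    case False
    then have D: "D \<in> sets N" using Basic by auto
    then have "D \<subseteq> space M" using sub sets.sets_into_space by blast
    then have "glue (space M) {} (\<lambda>_. D) = D" by (auto simp: glue_def)
    then show ?thesis
      using Basic.prems D by (intro exI[of _ "{}"] exI[of _ "\<lambda>x. D"]) simp
  qed
next
  case Empty
  then show ?case
    by (intro exI[of _ "{}"] exI[of _ "\<lambda>x. {}"]) (auto simp: glue_def)
next
  case (Compl D)
  have sp: "space N = space M" using N by (auto simp: subalgebra_def)
  obtain S L where *: "finite S" "S \<subseteq> A" "\<And>x. L x \<in> sets N"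
    "prob (sym_diff D (glue (space M) S L)) < \<epsilon>"
    using Compl.IH[OF Compl.prems] by blast
  have "A \<union> sets N \<subseteq> Pow (space M)"
    using A N sets.space_closed[of M] by (auto simp: subalgebra_def)
  then have D: "D \<subseteq> space M"
    by (rule sigma_sets_into_sp[OF _ Compl.hyps])
  have "sym_diff (space M - D) (glue (space M) S (\<lambda>x. space M - L x)) = sym_diff D (glue (space M) S L)"
    using D by (auto simp: glue_def)
  then show ?case
    using *(1,2,4) sets.compl_sets[OF *(3)] sp
    by (intro exI[of _ S] exI[of _ "\<lambda>x. space M - L x"]) simp
next
  case (Union D)
  have sub: "sets N \<subseteq> events" using N by (auto simp: subalgebra_def)
  have "sigma_sets (space M) (A \<union> sets N) \<subseteq> events"
    by (rule sets.sigma_sets_subset) (use A sub in auto)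
  then have Dev: "D i \<in> events" for i using Union.hyps by blast
  have "(\<lambda>k. prob ((\<Union>i. D i) - (\<Union>i<k. D i))) \<longlonglongrightarrow> prob (\<Inter>k. (\<Union>i. D i) - (\<Union>i<k. D i))"
    by (intro finite_Lim_measure_decseq)
      (use Dev in \<open>auto simp: decseq_def\<close>)
  moreover have "(\<Inter>k. (\<Union>i. D i) - (\<Union>i<k. D i)) = {}" by auto
  then have "prob (\<Inter>k. (\<Union>i. D i) - (\<Union>i<k. D i)) = 0" by (metis measure_empty)
  ultimately have "(\<lambda>k. prob ((\<Union>i. D i) - (\<Union>i<k. D i))) \<longlonglongrightarrow> 0" by metis
  then have "\<forall>\<^sub>F k in sequentially. prob ((\<Union>i. D i) - (\<Union>i<k. D i)) < \<epsilon> / 2"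
    using Union.prems by (intro order_tendstoD(2)) auto
  then obtain k where k: "prob ((\<Union>i. D i) - (\<Union>i<k. D i)) < \<epsilon> / 2"
    using eventually_happens by force
  define \<eta> where "\<eta> = \<epsilon> / (2 * (k + 1))"
  have \<eta>: "\<eta> > 0" using Union.prems by (simp add: \<eta>_def)
  have "\<forall>i. \<exists>S L. finite S \<and> S \<subseteq> A \<and> (\<forall>x. L x \<in> sets N) \<and> prob (sym_diff (D i) (glue (space M) S L)) < \<eta>"
    using Union.IH[OF \<eta>] by blast
  then obtain S L where SL: "\<And>i. finite (S i)" "\<And>i. S i \<subseteq> A" "\<And>i x. L i x \<in> sets N"
    "\<And>i. prob (sym_diff (D i) (glue (space M) (S i) (L i))) < \<eta>" by metis
  define S' where "S' = (\<Union>i<k. S i)"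
  define L' where "L' x = (\<Union>i<k. L i (x \<inter> S i))" for x
  have restr: "{s\<in>S'. \<omega> \<in> s} \<inter> S i = {s\<in>S i. \<omega> \<in> s}" if "i < k" for i \<omega>
    using that by (auto simp: S'_def)
  have glue': "glue (space M) S' L' = (\<Union>i<k. glue (space M) (S i) (L i))"
    by (auto simp: glue_def L'_def restr)
  have glue_ev: "glue (space M) (S i) (L i) \<in> events" for i
  proof -
    have "S i \<subseteq> events" using SL(2) A by blast
    moreover have "L i x \<in> events" for x using SL(3) sub by blast
    ultimately show ?thesis
      unfolding glue_eq_UN_atom
      by (intro sets.finite_UN sets.Int sets.atom_in_algebra) (use SL(1) in auto)
  qed
  have "prob (sym_diff (\<Union>i. D i) (glue (space M) S' L'))
      \<le> prob (((\<Union>i. D i) - (\<Union>i<k. D i)) \<union> (\<Union>i<k. sym_diff (D i) (glue (space M) (S i) (L i))))"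
    by (rule finite_measure_mono) (use Dev glue_ev in \<open>auto simp: glue'\<close>)
  also have "\<dots> \<le> prob ((\<Union>i. D i) - (\<Union>i<k. D i)) + prob (\<Union>i<k. sym_diff (D i) (glue (space M) (S i) (L i)))"
    by (rule measure_Un_le) (use Dev glue_ev in auto)
  also have "prob (\<Union>i<k. sym_diff (D i) (glue (space M) (S i) (L i)))
      \<le> (\<Sum>i<k. prob (sym_diff (D i) (glue (space M) (S i) (L i))))"
    by (rule measure_UNION_le) (use Dev glue_ev in auto)
  also have "\<dots> \<le> (\<Sum>i<k. \<eta>)" by (intro sum_mono less_imp_le SL)
  also have "\<dots> \<le> \<epsilon> / 2" using Union.prems by (simp add: \<eta>_def field_simps)
  finally have "prob (sym_diff (\<Union>i. D i) (glue (space M) S' L')) < \<epsilon>" using k by simp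
  moreover have "finite S'" "S' \<subseteq> A" "\<forall>x. L' x \<in> sets N"
    using SL by (auto simp: S'_def L'_def)
  ultimately show ?case by blast
qed

text \<open>
  The sets on which both functions have the same integral form a Dynkin system.
\<close>
lemma (in finite_measure) set_integral_eq_on_sigma_sets:
  fixes g h :: "'a \<Rightarrow> real"
  assumes int: "integrable M g" "integrable M h"
    and G: "Int_stable G" "G \<subseteq> sets M"
    and total: "(\<integral>\<omega>. g \<omega> \<partial>M) = (\<integral>\<omega>. h \<omega> \<partial>M)"
    and eq: "\<And>D. D \<in> G \<Longrightarrow> (\<integral>\<omega>\<in>D. g \<omega> \<partial>M) = (\<integral>\<omega>\<in>D. h \<omega> \<partial>M)"
    and D: "D \<in> sigma_sets (space M) G"
  shows "(\<integral>\<omega>\<in>D. g \<omega> \<partial>M) = (\<integral>\<omega>\<in>D. h \<omega> \<partial>M)"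
proof -
  have G_ev: "sigma_sets (space M) G \<subseteq> sets M" by (rule sets.sigma_sets_subset[OF G(2)])
  have "G \<subseteq> Pow (space M)" using G(2) sets.space_closed[of M] by blast
  with G(1) show ?thesis using D
  proof (induction rule: sigma_sets_induct_disjoint)
    case (basic D)
    then show ?case by (rule eq)
  next
    case empty
    show ?case by (simp add: set_lebesgue_integral_def)
  next
    case (compl D)
    have D: "D \<in> sets M" using compl G_ev by auto
    have "(\<integral>\<omega>\<in>space M - D. k \<omega> \<partial>M) = (\<integral>\<omega>. k \<omega> \<partial>M) - (\<integral>\<omega>\<in>D. k \<omega> \<partial>M)"
      if "integrable M k" for k :: "'a \<Rightarrow> real"
    proof -
      have "(\<integral>\<omega>\<in>space M - D. k \<omega> \<partial>M) = (\<integral>\<omega>. k \<omega> - indicator D \<omega> *\<^sub>R k \<omega> \<partial>M)"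
        unfolding set_lebesgue_integral_def
        by (rule Bochner_Integration.integral_cong) (auto simp: indicator_def)
      then show ?thesis
        using that integrable_mult_indicator[OF D that] by (simp add: set_lebesgue_integral_def)
    qed
    then show ?case using int total compl.IH by simp
  next
    case (union D)
    have D: "D i \<in> sets M" for i using union.hyps G_ev by auto
    have "(\<integral>\<omega>\<in>(\<Union>i. D i). k \<omega> \<partial>M) = (\<Sum>i. (\<integral>\<omega>\<in>D i. k \<omega> \<partial>M))" if "integrable M k" for k :: "'a \<Rightarrow> real"
    proof (rule lebesgue_integral_countable_add)
      show "set_integrable M (\<Union>i. D i) k"
        unfolding set_integrable_def using D by (intro integrable_mult_indicator that) auto
    qed (use D union.hyps in \<open>auto simp: disjoint_family_on_def\<close>)
    then show ?case using int union.IH by simp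
  qed
qed

text \<open>
  The case of \<open>approx_by_glue\<close> in which the second \<open>\<sigma>\<close>-algebra is trivial.
\<close>
lemma (in prob_space) approx_by_algebra:
  assumes A: "algebra (space M) A" "A \<subseteq> events"
    and D: "D \<in> sigma_sets (space M) A" and \<epsilon>: "\<epsilon> > 0"
  shows "\<exists>C\<in>A. prob (sym_diff D C) < \<epsilon>"
proof -
  interpret A: algebra "space M" A by (rule A(1))
  let ?N = "sigma (space M) {}"
  have N: "sets ?N = {{}, space M}"
    by (subst sets_measure_of) (auto simp: sigma_sets_empty_eq)
  have "subalgebra M ?N" by (auto simp: subalgebra_def N space_measure_of_conv)
  moreover have "D \<in> sigma_sets (space M) (A \<union> sets ?N)"
    using D sigma_sets_mono'[of A "A \<union> sets ?N"] by blast
  ultimately have "\<exists>S L. finite S \<and> S \<subseteq> A \<and> (\<forall>x. L x \<in> sets ?N) \<and>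
      prob (sym_diff D (glue (space M) S L)) < \<epsilon>"
    by (intro approx_by_glue A(2) \<epsilon>)
  then obtain S L where SL: "finite S" "S \<subseteq> A" "\<And>x. L x \<in> sets ?N"
    "prob (sym_diff D (glue (space M) S L)) < \<epsilon>" by auto
  have "L x \<in> A" for x using SL(3)[of x] unfolding N by auto
  then have "glue (space M) S L \<in> A"
    unfolding glue_eq_UN_atom
    using SL(1) A.atom_in_algebra[OF SL(1,2)] by (intro A.finite_UN) auto
  then show ?thesis using SL(4) by blast
qed

text \<open>
  A function with values in the unit interval is, up to \<open>1/K\<close>, the average of the indicators of its
  upper level sets \<open>{u \<ge> i/K}\<close>, and each of these is close to a set of the algebra.
\<close>
lemma (in prob_space) approx_function_by_algebra:
  fixes u :: "'a \<Rightarrow> real"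
  assumes A: "algebra (space M) A" "A \<subseteq> events"
    and u: "u \<in> borel_measurable (sigma (space M) A)" "AE \<omega> in M. 0 \<le> u \<omega> \<and> u \<omega> \<le> 1"
      "integrable M u" and \<epsilon>: "\<epsilon> > 0"
  shows "\<exists>(K::nat) (C :: nat \<Rightarrow> 'a set). (\<forall>i. C i \<in> A) \<and> K > 0 \<and>
    (\<integral>\<omega>. \<bar>u \<omega> - (\<Sum>i<K. indicator (C i) \<omega>) / real K\<bar> \<partial>M) \<le> \<epsilon>"
proof -
  have spc: "A \<subseteq> Pow (space M)" using A(2) sets.space_closed by blast
  have sA: "sets (sigma (space M) A) = sigma_sets (space M) A" by (rule sets_measure_of[OF spc])
  have sA_ev: "sigma_sets (space M) A \<subseteq> events" by (rule sets.sigma_sets_subset[OF A(2)])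
  obtain K :: nat where K: "K > 0" "1 / K < \<epsilon> / 2"
    using \<epsilon> by (metis half_gt_zero_iff nat_approx_posE of_nat_0_less_iff zero_less_Suc)
  define T where "T i = {\<omega>\<in>space M. real (Suc i) \<le> K * u \<omega>}" for i
  have T: "T i \<in> sigma_sets (space M) A" for i
  proof -
    have "{\<omega>\<in>space (sigma (space M) A). real (Suc i) \<le> K * u \<omega>} \<in> sets (sigma (space M) A)"
      using u(1) by measurable
    then show ?thesis by (simp add: T_def sA space_measure_of_conv)
  qed
  then have T_ev: "T i \<in> events" for i using sA_ev by blast
  have "\<forall>i. \<exists>C\<in>A. prob (sym_diff (T i) C) < \<epsilon> / 2"
    using approx_by_algebra[OF A T] \<epsilon> by (meson half_gt_zero)
  then obtain C where C: "\<And>i. C i \<in> A" "\<And>i. prob (sym_diff (T i) (C i)) < \<epsilon> / 2" by metis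
  have C_ev: "C i \<in> events" for i using C(1) A(2) by blast
  have ind: "integrable M (indicator D :: 'a \<Rightarrow> real)" if "D \<in> events" for D
    by (rule integrable_real_indicator) (use that in \<open>auto simp: less_top[symmetric]\<close>)
  have layer: "\<bar>u \<omega> - (\<Sum>i<K. indicator (T i) \<omega>) / K\<bar> \<le> 1 / K"
    if w: "\<omega> \<in> space M" "0 \<le> u \<omega>" "u \<omega> \<le> 1" for \<omega>
  proof -
    define k where "k = nat \<lfloor>K * u \<omega>\<rfloor>"
    have k: "real k \<le> K * u \<omega>" "K * u \<omega> < real k + 1"
      using w(2) by (auto simp: k_def)
    have "K * u \<omega> \<le> K" using w(3) K(1) by simp
    then have "k \<le> K" using k(1) by linarith
    have "(\<Sum>i<K. indicator (T i) \<omega>) = (\<Sum>i<K. if i < k then 1 else (0::real))"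
      using w(1) k by (intro sum.cong) (auto simp: T_def indicator_def)
    also have "\<dots> = real (card ({..<K} \<inter> {i. i < k}))" by (simp add: sum.If_cases)
    also have "{..<K} \<inter> {i. i < k} = {..<k}" using \<open>k \<le> K\<close> by auto
    finally have "u \<omega> - (\<Sum>i<K. indicator (T i) \<omega>) / K = (K * u \<omega> - k) / K"
      using K(1) by (simp add: field_simps)
    then show ?thesis using k K(1) by (simp add: divide_right_mono)
  qed
  have "(\<integral>\<omega>. \<bar>u \<omega> - (\<Sum>i<K. indicator (C i) \<omega>) / K\<bar> \<partial>M)
      \<le> (\<integral>\<omega>. 1 / K + (\<Sum>i<K. indicator (sym_diff (T i) (C i)) \<omega>) / K \<partial>M)"
  proof (rule integral_mono_AE)
    show "integrable M (\<lambda>\<omega>. \<bar>u \<omega> - (\<Sum>i<K. indicator (C i) \<omega>) / real K\<bar>)"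
      using u(3) C_ev by (intro integrable_abs Bochner_Integration.integrable_diff
          integrable_divide Bochner_Integration.integrable_sum ind) auto
    show "integrable M (\<lambda>\<omega>. 1 / real K + (\<Sum>i<K. indicator (sym_diff (T i) (C i)) \<omega>) / real K)"
      using T_ev C_ev by (intro Bochner_Integration.integrable_add integrable_divide
          Bochner_Integration.integrable_sum ind) auto
    show "AE \<omega> in M. \<bar>u \<omega> - (\<Sum>i<K. indicator (C i) \<omega>) / real K\<bar>
        \<le> 1 / real K + (\<Sum>i<K. indicator (sym_diff (T i) (C i)) \<omega>) / real K"
      using u(2) AE_space
    proof eventually_elim
      case (elim \<omega>)
      then have w: "0 \<le> u \<omega>" "u \<omega> \<le> 1" "\<omega> \<in> space M" by auto
      have "\<bar>(\<Sum>i<K. indicator (T i) \<omega>) - (\<Sum>i<K. indicator (C i) \<omega>)\<bar>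
          \<le> (\<Sum>i<K. \<bar>indicator (T i) \<omega> - indicator (C i) \<omega> :: real\<bar>)"
        by (simp add: sum_subtractf[symmetric])
      also have "\<dots> = (\<Sum>i<K. indicator (sym_diff (T i) (C i)) \<omega>)"
        by (intro sum.cong) (auto simp: indicator_def)
      finally have "\<bar>(\<Sum>i<K. indicator (T i) \<omega>) / K - (\<Sum>i<K. indicator (C i) \<omega>) / K\<bar>
          \<le> (\<Sum>i<K. indicator (sym_diff (T i) (C i)) \<omega>) / K"
        by (simp add: diff_divide_distrib[symmetric] divide_right_mono)
      then show "\<bar>u \<omega> - (\<Sum>i<K. indicator (C i) \<omega>) / real K\<bar>
          \<le> 1 / real K + (\<Sum>i<K. indicator (sym_diff (T i) (C i)) \<omega>) / real K"
        using layer[OF w(3,1,2)] by linarith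
    qed
  qed
  also have "\<dots> = 1 / K + (\<Sum>i<K. prob (sym_diff (T i) (C i))) / K"
  proof -
    have "(\<integral>\<omega>. 1 / K + (\<Sum>i<K. indicator (sym_diff (T i) (C i)) \<omega>) / K \<partial>M)
        = (\<integral>\<omega>. 1 / K \<partial>M) + (\<integral>\<omega>. (\<Sum>i<K. indicator (sym_diff (T i) (C i)) \<omega>) / K \<partial>M)"
      using T_ev C_ev by (intro Bochner_Integration.integral_add integrable_divide
          Bochner_Integration.integrable_sum ind) auto
    also have "(\<integral>\<omega>. (\<Sum>i<K. indicator (sym_diff (T i) (C i)) \<omega>) / K \<partial>M)
        = (\<Sum>i<K. (\<integral>\<omega>. indicator (sym_diff (T i) (C i)) \<omega> \<partial>M)) / K"
      using T_ev C_ev by (subst Bochner_Integration.integral_sum[symmetric])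
        (auto intro!: ind)
    also have "(\<Sum>i<K. (\<integral>\<omega>. indicator (sym_diff (T i) (C i)) \<omega> \<partial>M)) = (\<Sum>i<K. prob (sym_diff (T i) (C i)))"
      using T_ev C_ev by (intro sum.cong) auto
    finally show ?thesis by (simp add: prob_space)
  qed
  also have "\<dots> \<le> 1 / K + (\<Sum>i<K. \<epsilon> / 2) / K"
    by (intro add_left_mono divide_right_mono sum_mono less_imp_le[OF C(2)]) simp
  also have "\<dots> \<le> \<epsilon>" using K by simp
  finally show ?thesis
    by (intro exI[of _ K] exI[of _ C] conjI allI C(1) K(1))
qed

section \<open>Conditionally independent face algebras\<close>

text \<open>
  The axiom \<open>indep\<close> says that a set \<open>a\<close> in \<open>A f\<close> has the same conditional probability \<open>u\<close> given the proper
  subfaces of \<open>f\<close> as given all faces that do not contain \<open>f\<close>. Stating it through one function \<open>u\<close> that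
  is measurable for the small \<open>\<sigma>\<close>-algebra and integrates correctly over the large one avoids
  almost-everywhere equalities between conditional expectations.
\<close>
locale face_algebras = prob_space M for M :: "'a measure" +
  fixes J :: "'j set" and A :: "'j set \<Rightarrow> 'a set set"
  assumes finJ: "finite J"
    and alg: "\<And>e. e \<subseteq> J \<Longrightarrow> algebra (space M) (A e)"
    and A_events: "\<And>e. e \<subseteq> J \<Longrightarrow> A e \<subseteq> events"
    and A_mono: "\<And>f e. f \<subseteq> e \<Longrightarrow> e \<subseteq> J \<Longrightarrow> A f \<subseteq> A e"
    and indep: "\<And>f a. f \<subseteq> J \<Longrightarrow> a \<in> A f \<Longrightarrow>
      \<exists>u. u \<in> borel_measurable (sigma (space M) (\<Union>g\<in>{g. g \<subset> f}. A g)) \<and> integrable M u \<and>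
        (\<forall>Y\<in>sigma_sets (space M) (\<Union>g\<in>{g. g \<subseteq> J \<and> \<not> f \<subseteq> g}. A g).
           prob (a \<inter> Y) = (\<integral>\<omega>. u \<omega> * indicator Y \<omega> \<partial>M))"
begin

definition face_sigma :: "'j set set \<Rightarrow> 'j set \<Rightarrow> 'a measure" where
  "face_sigma F e = sigma (space M) (\<Union>g\<in>{g\<in>F. g \<subseteq> e}. A g)"

lemma generators:
  assumes "e \<subseteq> J" shows "(\<Union>g\<in>{g\<in>F. g \<subseteq> e}. A g) \<subseteq> events"
  using assms A_events by blast

lemma space_face_sigma [simp]: "space (face_sigma F e) = space M"
  by (simp add: face_sigma_def space_measure_of_conv)

lemma sets_face_sigma: "e \<subseteq> J \<Longrightarrow> sets (face_sigma F e) = sigma_sets (space M) (\<Union>g\<in>{g\<in>F. g \<subseteq> e}. A g)"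
  unfolding face_sigma_def by (rule sets_measure_of) (rule subset_trans[OF generators sets.space_closed])

lemma face_sigma_events: "e \<subseteq> J \<Longrightarrow> sets (face_sigma F e) \<subseteq> events"
  unfolding sets_face_sigma by (rule sets.sigma_sets_subset[OF generators])

lemma face_sigma_subalgebra: "e \<subseteq> J \<Longrightarrow> subalgebra M (face_sigma F e)"
  using face_sigma_events by (simp add: subalgebra_def)

lemma face_sigma_mono: "F \<subseteq> F' \<Longrightarrow> e \<subseteq> e' \<Longrightarrow> e' \<subseteq> J \<Longrightarrow> sets (face_sigma F e) \<subseteq> sets (face_sigma F' e')"
  by (subst (1 2) sets_face_sigma) (blast intro!: sigma_sets_mono')+

lemma cond_exp_locale: "e \<subseteq> J \<Longrightarrow> finite_measure_subalgebra M (face_sigma F e)"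
  unfolding finite_measure_subalgebra_def finite_measure_subalgebra_axioms_def
  using face_sigma_subalgebra finite_measure_axioms by blast

lemma integrable_indicator_event: "D \<in> events \<Longrightarrow> integrable M (indicator D :: 'a \<Rightarrow> real)"
  by (rule integrable_real_indicator) (auto simp: less_top[symmetric])

lemma integral_mult_cond_exp:
  assumes e: "e \<subseteq> J" and h: "h \<in> borel_measurable (face_sigma F e)" "\<And>\<omega>. \<bar>h \<omega>\<bar> \<le> 1"
    and k: "integrable M k"
  shows "(\<integral>\<omega>. h \<omega> * real_cond_exp M (face_sigma F e) k \<omega> \<partial>M) = (\<integral>\<omega>. h \<omega> * k \<omega> \<partial>M)"
proof -
  interpret finite_measure_subalgebra M "face_sigma F e" by (rule cond_exp_locale[OF e])
  have "h \<in> borel_measurable M" using h(1) by (rule measurable_from_subalg[OF subalg])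
  then have "integrable M (\<lambda>\<omega>. h \<omega> * k \<omega>)"
    by (intro Bochner_Integration.integrable_bound[OF k])
      (use h(2) k in \<open>auto intro!: mult_left_le_one_le simp: abs_mult\<close>)
  then show ?thesis
    by (rule real_cond_exp_intg(2)[OF _ h(1) borel_measurable_integrable[OF k]])
qed

lemma cond_exp_indicator_bounds:
  assumes e: "e \<subseteq> J" and D: "D \<in> events"
  shows "AE \<omega> in M. 0 \<le> real_cond_exp M (face_sigma F e) (indicator D) \<omega> \<and> real_cond_exp M (face_sigma F e) (indicator D) \<omega> \<le> 1"
proof -
  interpret finite_measure_subalgebra M "face_sigma F e" by (rule cond_exp_locale[OF e])
  have i: "integrable M (indicator D :: _ \<Rightarrow> real)" using D by (rule integrable_indicator_event)
  have "AE \<omega> in M. 0 \<le> real_cond_exp M (face_sigma F e) (indicator D) \<omega>"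
    by (rule real_cond_exp_ge_c[OF i]) auto
  moreover have "AE \<omega> in M. real_cond_exp M (face_sigma F e) (indicator D) \<omega> \<le> 1"
    by (rule real_cond_exp_le_c[OF i]) (auto simp: indicator_def)
  ultimately show ?thesis by eventually_elim auto
qed

text \<open>
  The independence axiom, extended from \<open>A f\<close> to everything that is generated by \<open>A f\<close> and the faces
  of \<open>F\<close> inside \<open>e\<close>: conditioning on the faces inside \<open>e\<close> already gives the probability conditional
  on all faces of \<open>F\<close>. For an intersection of a set from \<open>A f\<close> with a set \<open>L\<close> from the faces inside
  \<open>e\<close> this is the axiom, as the indicator of \<open>L\<close> can be pulled out; the general case follows
  since, with \<open>h\<close> the conditional expectation of the indicator of \<open>Y\<close>, the claim becomes the equality of the
  integrals of \<open>h\<close> and of this indicator over \<open>D\<close>.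
\<close>
lemma cond_exp_global:
  assumes F: "F \<subseteq> Pow J" "\<And>g. g \<subset> f \<Longrightarrow> g \<in> F" "\<And>g. g \<in> F \<Longrightarrow> \<not> f \<subseteq> g"
    and fe: "f \<subseteq> e" and e: "e \<subseteq> J"
    and D: "D \<in> sigma_sets (space M) (A f \<union> sets (face_sigma F e))" and Y: "Y \<in> sets (face_sigma F J)"
  shows "(\<integral>\<omega>. indicator Y \<omega> * real_cond_exp M (face_sigma F e) (indicator D) \<omega> \<partial>M) = prob (D \<inter> Y)"
proof -
  interpret finite_measure_subalgebra M "face_sigma F e" by (rule cond_exp_locale[OF e])
  have fJ: "f \<subseteq> J" using fe e by auto
  interpret Af: algebra "space M" "A f" by (rule alg[OF fJ])
  have [measurable]: "Y \<in> events" using Y face_sigma_events[of J F] by auto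
  define h where "h = real_cond_exp M (face_sigma F e) (indicator Y)"
  have h_meas: "h \<in> borel_measurable (face_sigma F e)" unfolding h_def by simp
  then have [measurable]: "h \<in> borel_measurable M" by (rule measurable_from_subalg[OF subalg])
  have iY: "integrable M (indicator Y :: _ \<Rightarrow> real)" by (rule integrable_indicator_event) simp
  have h_int: "integrable M h" unfolding h_def by (rule real_cond_exp_int(1)[OF iY])
  have h_bounds: "AE \<omega> in M. 0 \<le> h \<omega> \<and> h \<omega> \<le> 1"
    unfolding h_def by (rule cond_exp_indicator_bounds[OF e]) simp
  \<comment> \<open>A truncation of \<open>h\<close> that is bounded everywhere and not just almost everywhere.\<close>
  define h' where "h' \<omega> = max 0 (min 1 (h \<omega>))" for \<omega>
  have h'_meas: "h' \<in> borel_measurable (face_sigma F e)" unfolding h'_def using h_meas by simp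
  then have [measurable]: "h' \<in> borel_measurable M" by (rule measurable_from_subalg[OF subalg])
  have h'_le: "\<bar>h' \<omega>\<bar> \<le> 1" for \<omega> by (auto simp: h'_def)
  have hh': "AE \<omega> in M. h \<omega> = h' \<omega>" using h_bounds by eventually_elim (auto simp: h'_def)
  have gen: "A f \<union> sets (face_sigma F e) \<subseteq> events" using A_events[OF fJ] face_sigma_events[OF e, of F] by auto
  have sig_ev: "sigma_sets (space M) (A f \<union> sets (face_sigma F e)) \<subseteq> events"
    by (rule sets.sigma_sets_subset[OF gen])
  have "A f \<union> sets (face_sigma F e) \<subseteq> Pow (space M)" using gen sets.space_closed[of M] by blast
  then interpret sg: sigma_algebra "space M" "sigma_sets (space M) (A f \<union> sets (face_sigma F e))"
    by (rule sigma_algebra_sigma_sets)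
  have ind_inter: "(\<integral>\<omega>. indicator D \<omega> * indicator Y \<omega> \<partial>M) = prob (D \<inter> Y)" if "D \<in> events" for D
  proof -
    have "D \<inter> Y \<in> events" using that by simp
    then show ?thesis by (simp add: indicator_inter_arith[symmetric])
  qed
  define G where "G = {a \<inter> L | a L. a \<in> A f \<and> L \<in> sets (face_sigma F e)}"
  have G_sig: "sigma_sets (space M) (A f \<union> sets (face_sigma F e)) = sigma_sets (space M) G"
  proof (rule sigma_sets_eqI)
    fix a assume "a \<in> A f \<union> sets (face_sigma F e)"
    then have "a \<in> G"
    proof
      assume "a \<in> A f"
      then have "a = a \<inter> space M" "space M \<in> sets (face_sigma F e)"
        using Af.sets_into_space sets.top[of "face_sigma F e"] by auto
      then show ?thesis using \<open>a \<in> A f\<close> unfolding G_def by blast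
    next
      assume "a \<in> sets (face_sigma F e)"
      then have "a = space M \<inter> a" using sets.sets_into_space[of a "face_sigma F e"] by auto
      then show ?thesis using \<open>a \<in> sets (face_sigma F e)\<close> unfolding G_def by blast
    qed
    then show "a \<in> sigma_sets (space M) G" by blast
  next
    fix b assume "b \<in> G"
    then show "b \<in> sigma_sets (space M) (A f \<union> sets (face_sigma F e))"
      unfolding G_def using sg.Int by blast
  qed
  have "Int_stable G"
  proof (rule Int_stableI)
    fix b c assume "b \<in> G" "c \<in> G"
    then obtain a L a' L' where *: "b = a \<inter> L" "a \<in> A f" "L \<in> sets (face_sigma F e)"
      "c = a' \<inter> L'" "a' \<in> A f" "L' \<in> sets (face_sigma F e)" by (auto simp: G_def)
    then have "b \<inter> c = (a \<inter> a') \<inter> (L \<inter> L')" "a \<inter> a' \<in> A f" "L \<inter> L' \<in> sets (face_sigma F e)" by auto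
    then show "b \<inter> c \<in> G" unfolding G_def by blast
  qed
  moreover have G_ev: "G \<subseteq> events" unfolding G_def using gen by auto
  moreover have "(\<integral>\<omega>. indicator Y \<omega> \<partial>M) = (\<integral>\<omega>. h \<omega> \<partial>M)"
    unfolding h_def by (rule real_cond_exp_int(2)[OF iY, symmetric])
  moreover have "(\<integral>\<omega>\<in>D. indicator Y \<omega> \<partial>M) = (\<integral>\<omega>\<in>D. h \<omega> \<partial>M)" if DG: "D \<in> G" for D
  proof -
    obtain a L where D: "D = a \<inter> L" and a: "a \<in> A f" and L: "L \<in> sets (face_sigma F e)"
      using DG by (auto simp: G_def)
    have [measurable]: "a \<in> events" using a gen by auto
    have [measurable]: "L \<in> events" using L gen by auto
    obtain u where u_meas: "u \<in> borel_measurable (sigma (space M) (\<Union>g\<in>{g. g \<subset> f}. A g))"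
      and u_int: "integrable M u"
      and u: "\<And>Y. Y \<in> sigma_sets (space M) (\<Union>g\<in>{g. g \<subseteq> J \<and> \<not> f \<subseteq> g}. A g) \<Longrightarrow>
        prob (a \<inter> Y) = (\<integral>\<omega>. u \<omega> * indicator Y \<omega> \<partial>M)"
      using indep[OF fJ a] by blast
    have BJ: "sets (face_sigma F J) \<subseteq> sigma_sets (space M) (\<Union>g\<in>{g. g \<subseteq> J \<and> \<not> f \<subseteq> g}. A g)"
      unfolding sets_face_sigma[OF order_refl] by (rule sigma_sets_mono') (use F in auto)
    have u_B: "u \<in> borel_measurable (face_sigma F e)"
    proof (rule measurable_from_subalg[OF _ u_meas], unfold subalgebra_def, intro conjI)
      have "sets (sigma (space M) (\<Union>g\<in>{g. g \<subset> f}. A g)) = sigma_sets (space M) (\<Union>g\<in>{g. g \<subset> f}. A g)"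
        by (rule sets_measure_of[OF subset_trans[OF _ sets.space_closed]]) (use A_events fJ in blast)
      also have "\<dots> \<subseteq> sets (face_sigma F e)"
        unfolding sets_face_sigma[OF e]
      proof (rule sigma_sets_mono', rule UN_mono)
        show "{g. g \<subset> f} \<subseteq> {g \<in> F. g \<subseteq> e}"
          using F(2) fe by blast
      qed simp
      finally show "sets (sigma (space M) (\<Union>g\<in>{g. g \<subset> f}. A g)) \<subseteq> sets (face_sigma F e)" .
    qed (simp add: space_measure_of_conv)
    have Be_BJ: "sets (face_sigma F e) \<subseteq> sets (face_sigma F J)" by (rule face_sigma_mono) (use e in auto)
    have ind_L: "indicator L \<in> borel_measurable (face_sigma F e)" using L by simp
    have cond_a: "AE \<omega> in M. real_cond_exp M (face_sigma F e) (indicator a) \<omega> = u \<omega>"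
    proof (rule real_cond_exp_charact)
      fix Z assume "Z \<in> sets (face_sigma F e)"
      then have "prob (a \<inter> Z) = (\<integral>\<omega>. u \<omega> * indicator Z \<omega> \<partial>M)" "Z \<in> events"
        using u Be_BJ BJ gen by auto
      then show "(\<integral>x\<in>Z. indicat_real a x \<partial>M) = (\<integral>x\<in>Z. u x \<partial>M)"
        by (simp add: set_lebesgue_integral_def mult.commute indicator_inter_arith[symmetric] Int_commute)
    qed (use u_int u_B integrable_indicator_event[OF \<open>a \<in> events\<close>] in simp_all)
    have "L \<inter> Y \<in> sets (face_sigma F J)" using L Y Be_BJ by auto
    then have "prob (D \<inter> Y) = (\<integral>\<omega>. u \<omega> * indicator (L \<inter> Y) \<omega> \<partial>M)"
      unfolding D Int_assoc using BJ by (intro u) auto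
    also have "\<dots> = (\<integral>\<omega>. (indicator L \<omega> * u \<omega>) * indicator Y \<omega> \<partial>M)"
      by (simp add: indicator_inter_arith ac_simps)
    also have "\<dots> = (\<integral>\<omega>. (indicator L \<omega> * u \<omega>) * h \<omega> \<partial>M)"
      unfolding h_def
    proof (rule real_cond_exp_intg(2)[symmetric])
      have "integrable M (\<lambda>\<omega>. indicator (L \<inter> Y) \<omega> * u \<omega>)"
        using integrable_mult_indicator[OF _ u_int, of "L \<inter> Y"] by simp
      then show "integrable M (\<lambda>\<omega>. indicat_real L \<omega> * u \<omega> * indicat_real Y \<omega>)"
        by (simp add: indicator_inter_arith ac_simps)
    qed (use u_B ind_L in \<open>auto intro!: borel_measurable_times\<close>)
    also have "\<dots> = (\<integral>\<omega>. (indicator L \<omega> * h' \<omega>) * real_cond_exp M (face_sigma F e) (indicator a) \<omega> \<partial>M)"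
      by (rule integral_cong_AE) (use cond_a hh' u_int in \<open>auto elim!: eventually_elim2 simp: ac_simps\<close>)
    also have "\<dots> = (\<integral>\<omega>. (indicator L \<omega> * h' \<omega>) * indicator a \<omega> \<partial>M)"
    proof (rule integral_mult_cond_exp[OF e])
      show "\<bar>indicator L \<omega> * h' \<omega>\<bar> \<le> 1" for \<omega>
        using h'_le[of \<omega>] by (simp add: indicator_def)
    qed (use ind_L h'_meas integrable_indicator_event[OF \<open>a \<in> events\<close>] in \<open>auto intro!: borel_measurable_times\<close>)
    also have "\<dots> = (\<integral>\<omega>. indicator D \<omega> * h \<omega> \<partial>M)"
      by (rule integral_cong_AE)
        (use hh' in \<open>auto elim!: eventually_mono simp: D indicator_inter_arith\<close>)
    finally show ?thesis
      using ind_inter[of D] D by (simp add: set_lebesgue_integral_def)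
  qed
  moreover have "D \<in> sigma_sets (space M) G" using D G_sig by simp
  ultimately have "(\<integral>\<omega>\<in>D. indicator Y \<omega> \<partial>M) = (\<integral>\<omega>\<in>D. h \<omega> \<partial>M)"
    by (rule set_integral_eq_on_sigma_sets[OF iY h_int])
  moreover have [measurable]: "D \<in> events" using D sig_ev by auto
  ultimately have main: "prob (D \<inter> Y) = (\<integral>\<omega>. indicator D \<omega> * h \<omega> \<partial>M)"
    using ind_inter[of D] by (simp add: set_lebesgue_integral_def)
  have iD: "integrable M (indicator D :: _ \<Rightarrow> real)" by (rule integrable_indicator_event) simp
  have "(\<integral>\<omega>. indicator Y \<omega> * real_cond_exp M (face_sigma F e) (indicator D) \<omega> \<partial>M)
      = (\<integral>\<omega>. real_cond_exp M (face_sigma F e) (indicator D) \<omega> * indicator Y \<omega> \<partial>M)" by (simp add: mult.commute)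
  also have "\<dots> = (\<integral>\<omega>. real_cond_exp M (face_sigma F e) (indicator D) \<omega> * h \<omega> \<partial>M)"
    unfolding h_def
  proof (rule real_cond_exp_intg(2)[symmetric])
    show "integrable M (\<lambda>\<omega>. real_cond_exp M (face_sigma F e) (indicat_real D) \<omega> * indicat_real Y \<omega>)"
      using integrable_mult_indicator[OF \<open>Y \<in> events\<close> real_cond_exp_int(1)[OF iD]] by (simp add: mult.commute)
  qed auto
  also have "\<dots> = (\<integral>\<omega>. h' \<omega> * real_cond_exp M (face_sigma F e) (indicator D) \<omega> \<partial>M)"
    by (rule integral_cong_AE) (use hh' in \<open>auto elim!: eventually_mono\<close>)
  also have "\<dots> = (\<integral>\<omega>. h' \<omega> * indicator D \<omega> \<partial>M)"
    by (rule integral_mult_cond_exp[OF e h'_meas h'_le iD])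
  also have "\<dots> = (\<integral>\<omega>. indicator D \<omega> * h \<omega> \<partial>M)"
    by (rule integral_cong_AE) (use hh' in \<open>auto elim!: eventually_mono\<close>)
  finally show ?thesis using main by simp
qed

subsection \<open>Eliminating one face\<close>

lemma integrable_indicator_cond_exp:
  assumes "e \<subseteq> J" "D \<in> events" "Y \<in> events"
  shows "integrable M (\<lambda>\<omega>. indicator Y \<omega> * real_cond_exp M (face_sigma F e) (indicator D) \<omega>)"
proof -
  interpret finite_measure_subalgebra M "face_sigma F e" by (rule cond_exp_locale[OF assms(1)])
  show ?thesis
    using integrable_mult_indicator[OF assms(3) real_cond_exp_int(1)[OF integrable_indicator_event[OF assms(2)]]] by simp
qed

text \<open>
  The points at which, conditionally on the faces of \<open>F\<close> inside \<open>e\<close>, all but a proportion \<open>\<eta>\<close> of \<open>a\<close>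
  lies in \<open>E\<close>. The inequality is strict so that \<open>a\<close> has positive conditional probability almost everywhere there.
\<close>
definition mostly_in :: "'j set set \<Rightarrow> 'j set \<Rightarrow> real \<Rightarrow> 'a set \<Rightarrow> 'a set \<Rightarrow> 'a set" where
  "mostly_in F e \<eta> a E = {\<omega>\<in>space M. real_cond_exp M (face_sigma F e) (indicator (a - E)) \<omega>
      < \<eta> * real_cond_exp M (face_sigma F e) (indicator a) \<omega>}"

lemma mostly_in_sets: "mostly_in F e \<eta> a E \<in> sets (face_sigma F e)"
proof -
  have "{\<omega>\<in>space (face_sigma F e). real_cond_exp M (face_sigma F e) (indicator (a - E)) \<omega>
      < \<eta> * real_cond_exp M (face_sigma F e) (indicator a) \<omega>} \<in> sets (face_sigma F e)"
    by measurable
  then show ?thesis by (simp add: mostly_in_def)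
qed

context
  fixes F :: "'j set set" and f e :: "'j set" and \<eta> :: real and a E :: "'a set"
  assumes F: "F \<subseteq> Pow J" "\<And>g. g \<subset> f \<Longrightarrow> g \<in> F" "\<And>g. g \<in> F \<Longrightarrow> \<not> f \<subseteq> g"
    and fe: "f \<subseteq> e" and e: "e \<subseteq> J"
    and a: "a \<in> A f" and E: "E \<in> sigma_sets (space M) (A f \<union> sets (face_sigma F e))" and \<eta>: "\<eta> > 0"
begin

lemma difference_in_generated: "a - E \<in> sigma_sets (space M) (A f \<union> sets (face_sigma F e))"
  "A f \<union> sets (face_sigma F e) \<subseteq> events" "a \<in> events" "a - E \<in> events"
proof -
  have "f \<subseteq> J" using fe e by auto
  then show gen: "A f \<union> sets (face_sigma F e) \<subseteq> events" using A_events[of f] face_sigma_events[OF e, of F] by auto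
  then have "A f \<union> sets (face_sigma F e) \<subseteq> Pow (space M)" using sets.space_closed[of M] by blast
  then interpret sg: sigma_algebra "space M" "sigma_sets (space M) (A f \<union> sets (face_sigma F e))"
    by (rule sigma_algebra_sigma_sets)
  show *: "a - E \<in> sigma_sets (space M) (A f \<union> sets (face_sigma F e))" using a E by auto
  show "a - E \<in> events" using * sets.sigma_sets_subset[OF gen] by blast
  show "a \<in> events" using a gen by blast
qed

text \<open>
  The point of this bound is that \<open>Y\<close> may involve all faces in \<open>F\<close>, not only those inside \<open>e\<close>; this is what
  allows the defects for different \<open>e\<close> to be added up on a common set \<open>Y\<close>.
\<close>
lemma mostly_in_inside:
  assumes Y: "Y \<in> sets (face_sigma F J)" "Y \<subseteq> mostly_in F e \<eta> a E"
  shows "prob ((a - E) \<inter> Y) \<le> \<eta> * prob (a \<inter> Y)"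
proof -
  have Yev: "Y \<in> events" using Y(1) face_sigma_events[of J F] by auto
  have "prob ((a - E) \<inter> Y) = (\<integral>\<omega>. indicator Y \<omega> * real_cond_exp M (face_sigma F e) (indicator (a - E)) \<omega> \<partial>M)"
    by (rule cond_exp_global[OF F fe e difference_in_generated(1) Y(1), symmetric])
  also have "\<dots> \<le> (\<integral>\<omega>. \<eta> * (indicator Y \<omega> * real_cond_exp M (face_sigma F e) (indicator a) \<omega>) \<partial>M)"
    using Y(2) integrable_indicator_cond_exp[OF e _ Yev] difference_in_generated
    by (intro integral_mono) (auto simp: mostly_in_def indicator_def)
  also have "\<dots> = \<eta> * prob (a \<inter> Y)"
    using cond_exp_global[OF F fe e _ Y(1), of a] a by simp
  finally show ?thesis .
qed

lemma mostly_in_outside: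
  assumes Y: "Y \<in> sets (face_sigma F J)" "Y \<inter> mostly_in F e \<eta> a E = {}"
  shows "\<eta> * prob (a \<inter> Y) \<le> prob ((a - E) \<inter> Y)"
proof -
  have Yev: "Y \<in> events" using Y(1) face_sigma_events[of J F] by auto
  have "\<eta> * prob (a \<inter> Y) = (\<integral>\<omega>. \<eta> * (indicator Y \<omega> * real_cond_exp M (face_sigma F e) (indicator a) \<omega>) \<partial>M)"
    using cond_exp_global[OF F fe e _ Y(1), of a] a by simp
  also have "\<dots> \<le> (\<integral>\<omega>. indicator Y \<omega> * real_cond_exp M (face_sigma F e) (indicator (a - E)) \<omega> \<partial>M)"
    using Y(2) integrable_indicator_cond_exp[OF e _ Yev] difference_in_generated
    by (intro integral_mono) (auto simp: mostly_in_def indicator_def not_less)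
  also have "\<dots> = prob ((a - E) \<inter> Y)"
    by (rule cond_exp_global[OF F fe e difference_in_generated(1) Y(1)])
  finally show ?thesis .
qed

text \<open>
  As \<open>a\<close> has positive conditional probability on \<open>Y\<close>, the set \<open>a\<close> cannot miss \<open>Y\<close> unless \<open>Y\<close> is null.
\<close>
lemma mostly_in_null:
  assumes Y: "Y \<in> sets (face_sigma F J)" "Y \<subseteq> mostly_in F e \<eta> a E" and null: "prob (a \<inter> Y) = 0"
  shows "prob Y = 0"
proof -
  have Yev: "Y \<in> events" using Y(1) face_sigma_events[of J F] by auto
  let ?c = "real_cond_exp M (face_sigma F e) (indicator a)"
  have nonneg: "AE \<omega> in M. 0 \<le> ?c \<omega>"
    using cond_exp_indicator_bounds[OF e difference_in_generated(3), of F] by eventually_elim auto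
  have "(\<integral>\<omega>. indicator Y \<omega> * ?c \<omega> \<partial>M) = 0"
    using cond_exp_global[OF F fe e _ Y(1), of a] a null by simp
  then have "AE \<omega> in M. indicator Y \<omega> * ?c \<omega> = 0"
    by (subst (asm) integral_nonneg_eq_0_iff_AE)
      (use nonneg integrable_indicator_cond_exp[OF e difference_in_generated(3) Yev] in \<open>auto elim!: eventually_mono\<close>)
  moreover have "AE \<omega> in M. 0 \<le> real_cond_exp M (face_sigma F e) (indicator (a - E)) \<omega>"
    using cond_exp_indicator_bounds[OF e difference_in_generated(4), of F] by eventually_elim auto
  ultimately have "AE \<omega> in M. \<omega> \<notin> Y"
  proof eventually_elim
    case (elim \<omega>)
    show ?case
    proof
      assume "\<omega> \<in> Y"
      then have "?c \<omega> = 0" "\<omega> \<in> mostly_in F e \<eta> a E" using elim(1) Y(2) by auto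
      then show False using elim(2) by (simp add: mostly_in_def)
    qed
  qed
  then show ?thesis using Yev by (simp add: AE_iff_measurable[OF _ refl] prob_eq_0)
qed

end

text \<open>
  Induction on \<open>F\<close>, removing a maximal face \<open>f\<close>. The sets \<open>E e\<close> with \<open>f \<subseteq> e\<close> are approximated by sets
  glued from sets that do not involve \<open>f\<close>, along the atoms \<open>a x\<close> of one finite subalgebra of \<open>A f\<close>. On
  each atom they are replaced by \<open>mostly_in F' e \<eta> (a x) (E e)\<close>, the induction hypothesis is applied to
  each atom separately, and the resulting sets are glued again. Without any face left, all sets are
  trivial, so that one of them is empty.
\<close>
theorem infinitary_removal:
  assumes "F \<subseteq> Pow J" "\<And>f g. f \<in> F \<Longrightarrow> g \<subseteq> f \<Longrightarrow> g \<in> F" and H: "H \<subseteq> Pow J"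
    and "\<And>e. e \<in> H \<Longrightarrow> E e \<in> sets (face_sigma F e)"
    and "prob {\<omega>\<in>space M. \<forall>e\<in>H. \<omega> \<in> E e} = 0" and "\<epsilon> > 0"
  shows "\<exists>E'. (\<forall>e\<in>H. E' e \<in> A e \<and> prob (E e - E' e) < \<epsilon>) \<and> {\<omega>\<in>space M. \<forall>e\<in>H. \<omega> \<in> E' e} = {}"
proof -
  have "finite F" using assms(1) finJ finite_subset by blast
  then show ?thesis using assms(1,2,4-6)
  proof (induction F arbitrary: E \<epsilon> rule: finite_psubset_induct)
    case (psubset F E \<epsilon>)
    have finH: "finite H" using H finJ finite_subset by blast
    show ?case
    proof (cases "F = {}")
      case True
      have triv: "E e \<in> {{}, space M}" if "e \<in> H" for e
        using psubset.prems(3)[OF that] H that by (subst (asm) sets_face_sigma) (auto simp: True sigma_sets_empty_eq)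
      have "\<exists>e\<in>H. E e = {}"
      proof (rule ccontr)
        assume "\<not> ?thesis"
        then have "{\<omega>\<in>space M. \<forall>e\<in>H. \<omega> \<in> E e} = space M" using triv by auto
        then show False using psubset.prems(4) by (simp add: prob_space)
      qed
      moreover have "E e \<in> A e" if "e \<in> H" for e
      proof -
        interpret algebra "space M" "A e" by (rule alg) (use H that in auto)
        show ?thesis using triv[OF that] by auto
      qed
      ultimately show ?thesis
        using psubset.prems(5) by (intro exI[of _ E]) auto
    next
      case False
      obtain f where f: "f \<in> F" and max: "\<And>g. g \<in> F \<Longrightarrow> f \<subseteq> g \<Longrightarrow> g = f"
        using finite_has_maximal[OF psubset.hyps(1) False] by metis
      define F' where "F' = F - {f}"
      have F': "F' \<subseteq> Pow J" "\<And>g. g \<subset> f \<Longrightarrow> g \<in> F'" "\<And>g. g \<in> F' \<Longrightarrow> \<not> f \<subseteq> g"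
        using psubset.prems(1) psubset.prems(2)[OF f] max unfolding F'_def by blast+
      have down: "g \<in> F'" if "h \<in> F'" "g \<subseteq> h" for h g
        using psubset.prems(2)[of h g] max[of h] that unfolding F'_def by blast
      have fJ: "f \<subseteq> J" using f psubset.prems(1) by auto
      have F'F: "F' \<subset> F" using f by (auto simp: F'_def)
      have IH: "\<exists>E'. (\<forall>e\<in>H. E' e \<in> A e \<and> prob (E2 e - E' e) < \<epsilon>2) \<and>
          {\<omega>\<in>space M. \<forall>e\<in>H. \<omega> \<in> E' e} = {}"
        if "\<And>e. e \<in> H \<Longrightarrow> E2 e \<in> sets (face_sigma F' e)" "prob {\<omega>\<in>space M. \<forall>e\<in>H. \<omega> \<in> E2 e} = 0" "\<epsilon>2 > 0" for E2 \<epsilon>2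
      proof (rule psubset.IH[OF F'F F'(1)])
        show "g \<in> F'" if "h \<in> F'" "g \<subseteq> h" for h g using that by (rule down)
      qed (use that in auto)
      have B_not: "sets (face_sigma F' e) = sets (face_sigma F e)" if "\<not> f \<subseteq> e" for e
      proof -
        have "{g \<in> F'. g \<subseteq> e} = {g \<in> F. g \<subseteq> e}" using that by (auto simp: F'_def)
        then show ?thesis unfolding face_sigma_def by simp
      qed
      define H' where "H' = {e\<in>H. f \<subseteq> e}"
      have finH': "finite H'" using finH by (simp add: H'_def)
      have H'J: "f \<subseteq> e" "e \<subseteq> J" "e \<in> H" if "e \<in> H'" for e using that H by (auto simp: H'_def)
      have E_sig: "E e \<in> sigma_sets (space M) (A f \<union> sets (face_sigma F' e))" if "e \<in> H'" for e
      proof -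
        have "E e \<in> sigma_sets (space M) (\<Union>g\<in>{g\<in>F. g \<subseteq> e}. A g)"
          using psubset.prems(3)[of e] H'J[OF that] sets_face_sigma by auto
        also have "\<dots> \<subseteq> sigma_sets (space M) (A f \<union> sets (face_sigma F' e))"
        proof (rule sigma_sets_mono')
          show "(\<Union>g\<in>{g\<in>F. g \<subseteq> e}. A g) \<subseteq> A f \<union> sets (face_sigma F' e)"
          proof clarify
            fix x g assume g: "x \<in> A g" "g \<in> F" "g \<subseteq> e" "x \<notin> sets (face_sigma F' e)"
            then have "g \<notin> F'" unfolding sets_face_sigma[OF H'J(2)[OF that]] by blast
            then show "x \<in> A f" using g by (simp add: F'_def)
          qed
        qed
        finally show ?thesis .
      qed
      have E_ev: "E e \<in> events" if "e \<in> H" for e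
        using psubset.prems(3)[OF that] face_sigma_events[of e F] H that by blast
      show ?thesis
      proof (cases "H' = {}")
        case True
        show ?thesis
        proof (rule IH)
          show "E e \<in> sets (face_sigma F' e)" if "e \<in> H" for e
            using psubset.prems(3)[OF that] B_not[of e] True that by (auto simp: H'_def)
        qed (use psubset.prems in auto)
      next
        case False
        then obtain e0 where e0: "e0 \<in> H'" by blast
        then have cardH: "card H > 0" using finH H'J(3) by (auto simp: card_gt_0_iff)
        \<comment> \<open>Small enough for the defects of all \<open>e\<close> together to amount to at most half of an atom.\<close>
        define \<eta> where "\<eta> = 1 / (2 * real (card H))"
        have \<eta>: "\<eta> > 0" "\<eta> \<le> 1 / 2" "card H * \<eta> = 1 / 2" using cardH by (auto simp: \<eta>_def field_simps)
        \<comment> \<open>The approximation error enters once as such and once divided by \<open>\<eta>\<close>; the two add up to less than \<open>\<epsilon> / 2\<close>.\<close>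
        define \<epsilon>1 where "\<epsilon>1 = \<epsilon> * \<eta> / 4"
        have \<epsilon>1: "\<epsilon>1 > 0" using \<eta> psubset.prems(5) by (simp add: \<epsilon>1_def)
        have "\<forall>e\<in>H'. \<exists>S L. finite S \<and> S \<subseteq> A f \<and> (\<forall>x. L x \<in> sets (face_sigma F' e)) \<and>
            prob (sym_diff (E e) (glue (space M) S L)) < \<epsilon>1"
          by (intro ballI approx_by_glue A_events[OF fJ] face_sigma_subalgebra E_sig \<epsilon>1 H'J(2))
        then obtain S0 L0 where SL0: "\<And>e. e \<in> H' \<Longrightarrow> finite (S0 e)" "\<And>e. e \<in> H' \<Longrightarrow> S0 e \<subseteq> A f"
          "\<And>e x. e \<in> H' \<Longrightarrow> L0 e x \<in> sets (face_sigma F' e)"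
          "\<And>e. e \<in> H' \<Longrightarrow> prob (sym_diff (E e) (glue (space M) (S0 e) (L0 e))) < \<epsilon>1"
          by metis
        define S where "S = (\<Union>e\<in>H'. S0 e)"
        define L where "L e x = L0 e (x \<inter> S0 e)" for e x
        have finS: "finite S" and SA: "S \<subseteq> A f" using SL0 finH' by (auto simp: S_def)
        have L: "L e x \<in> sets (face_sigma F' e)" if "e \<in> H'" for e x using SL0(3)[OF that] by (simp add: L_def)
        have "{s\<in>S. \<omega> \<in> s} \<inter> S0 e = {s\<in>S0 e. \<omega> \<in> s}" if "e \<in> H'" for e \<omega>
          using that by (auto simp: S_def)
        then have "glue (space M) S (L e) = glue (space M) (S0 e) (L0 e)" if "e \<in> H'" for e
          using that by (simp add: glue_def L_def)
        then have approx: "prob (sym_diff (E e) (glue (space M) S (L e))) < \<epsilon>1" if "e \<in> H'" for e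
          using SL0(4) that by simp
        define a where "a x = atom (space M) S x" for x
        interpret Af: algebra "space M" "A f" by (rule alg[OF fJ])
        have a: "a x \<in> A f" for x unfolding a_def by (rule Af.atom_in_algebra[OF finS SA])
        have a_ev: "a x \<in> events" for x using a A_events[OF fJ] by blast
        define E1 where "E1 x e = (if f \<subseteq> e then mostly_in F' e \<eta> (a x) (E e) else E e)" for x e
        have E1: "E1 x e \<in> sets (face_sigma F' e)" if "e \<in> H" for x e
          using psubset.prems(3)[OF that] B_not by (auto simp: E1_def mostly_in_sets)
        have E1_null: "prob {\<omega>\<in>space M. \<forall>e\<in>H. \<omega> \<in> E1 x e} = 0" for x
        proof -
          define Y where "Y = {\<omega>\<in>space M. \<forall>e\<in>H. \<omega> \<in> E1 x e}"
          have Y_eq: "Y = (\<Inter>e\<in>H. E1 x e)"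
            using E1 sets.sets_into_space e0 H'J(3) by (fastforce simp: Y_def)
          have Y: "Y \<in> sets (face_sigma F' J)" unfolding Y_eq
          proof (rule sets.finite_INT[OF finH])
            show "E1 x e \<in> sets (face_sigma F' J)" if "e \<in> H" for e
              using E1[OF that] face_sigma_mono[OF order_refl, of e J F'] H that by blast
          qed (use e0 H'J(3) in auto)
          have Yev: "Y \<in> events" using Y face_sigma_events[of J F'] by auto
          have sub: "Y \<subseteq> mostly_in F' e \<eta> (a x) (E e)" if "e \<in> H'" for e
            using H'J(1,3)[OF that] by (auto simp: Y_def E1_def)
          define Z where "Z = {\<omega>\<in>space M. \<forall>e\<in>H. \<omega> \<in> E e}"
          have Z_eq: "Z = (\<Inter>e\<in>H. E e)"
            using E_ev sets.sets_into_space e0 H'J(3) by (fastforce simp: Z_def)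
          have Zev: "Z \<in> events"
            unfolding Z_eq by (rule sets.finite_INT[OF finH]) (use E_ev e0 H'J(3) in auto)
          have "prob (a x \<inter> Y) \<le> prob (Z \<union> (\<Union>e\<in>H'. (a x - E e) \<inter> Y))"
          proof (rule finite_measure_mono)
            show "a x \<inter> Y \<subseteq> Z \<union> (\<Union>e\<in>H'. (a x - E e) \<inter> Y)"
              by (auto simp: Z_def Y_def E1_def H'_def split: if_splits)
            show "Z \<union> (\<Union>e\<in>H'. (a x - E e) \<inter> Y) \<in> events"
              using Zev Yev finH' H'J E_ev a_ev by (intro sets.Un sets.finite_UN sets.Int sets.Diff) auto
          qed
          also have "\<dots> \<le> prob Z + prob (\<Union>e\<in>H'. (a x - E e) \<inter> Y)"
            using Zev Yev finH' H'J E_ev a_ev by (intro measure_Un_le sets.finite_UN sets.Int sets.Diff) auto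
          also have "prob (\<Union>e\<in>H'. (a x - E e) \<inter> Y) \<le> (\<Sum>e\<in>H'. prob ((a x - E e) \<inter> Y))"
            using Yev finH' H'J E_ev a_ev by (intro measure_UNION_le sets.Int sets.Diff) auto
          also have "\<dots> \<le> (\<Sum>e\<in>H'. \<eta> * prob (a x \<inter> Y))"
            using H'J by (intro sum_mono mostly_in_inside[OF F' _ _ a E_sig \<eta>(1) Y sub]) auto
          also have "\<dots> \<le> card H * (\<eta> * prob (a x \<inter> Y))"
            using card_mono[OF finH, of H'] \<eta>(1) by (auto simp: H'_def intro!: mult_right_mono)
          also have "prob Z = 0" using psubset.prems(4) by (simp add: Z_def)
          also have "0 + card H * (\<eta> * prob (a x \<inter> Y)) = prob (a x \<inter> Y) / 2"
            using \<eta>(3) by (simp add: mult.assoc[symmetric])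
          finally have "prob (a x \<inter> Y) = 0" using measure_nonneg[of M "a x \<inter> Y"] by simp
          then show ?thesis
            using mostly_in_null[OF F' H'J(1,2)[OF e0] a E_sig[OF e0] \<eta>(1) Y sub[OF e0]] by (simp add: Y_def)
        qed
        define \<epsilon>2 where "\<epsilon>2 = \<epsilon> / (2 * card (Pow S))"
        have cardS: "card (Pow S) > 0" using finS by (simp add: card_Pow)
        have \<epsilon>2: "\<epsilon>2 > 0" "card (Pow S) * \<epsilon>2 = \<epsilon> / 2"
          using cardS psubset.prems(5) by (auto simp: \<epsilon>2_def simp del: card_Pow)
        have "\<forall>x. \<exists>E'. (\<forall>e\<in>H. E' e \<in> A e \<and> prob (E1 x e - E' e) < \<epsilon>2) \<and>
            {\<omega>\<in>space M. \<forall>e\<in>H. \<omega> \<in> E' e} = {}"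
          using IH[OF E1 E1_null \<epsilon>2(1)] by blast
        from choice[OF this] obtain G where "\<forall>x. (\<forall>e\<in>H. G x e \<in> A e \<and> prob (E1 x e - G x e) < \<epsilon>2) \<and>
            {\<omega>\<in>space M. \<forall>e\<in>H. \<omega> \<in> G x e} = {}" ..
        then have G: "\<And>x e. e \<in> H \<Longrightarrow> G x e \<in> A e" "\<And>x e. e \<in> H \<Longrightarrow> prob (E1 x e - G x e) < \<epsilon>2"
          "\<And>x. {\<omega>\<in>space M. \<forall>e\<in>H. \<omega> \<in> G x e} = {}" by simp_all
        have G_ev: "G x e \<in> events" if "e \<in> H" for x e using G(1)[OF that] A_events[of e] H that by blast
        have E1_ev: "E1 x e \<in> events" if "e \<in> H" for x e using E1[OF that] face_sigma_events[of e F'] H that by blast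
        define E' where "E' e = (if f \<subseteq> e then (\<Union>x\<in>Pow S. a x \<inter> G x e) else (\<Inter>x\<in>Pow S. G x e))" for e
        have E'A: "E' e \<in> A e" if "e \<in> H" for e
        proof -
          have eJ: "e \<subseteq> J" using H that by auto
          interpret algebra "space M" "A e" by (rule alg[OF eJ])
          show ?thesis
          proof (cases "f \<subseteq> e")
            case True
            then have "a x \<in> A e" for x using a A_mono[OF True eJ] by blast
            then show ?thesis using True G(1)[OF that] finS by (auto simp: E'_def intro!: finite_UN)
          next
            case False
            then show ?thesis using G(1)[OF that] finS by (auto simp: E'_def intro!: finite_INT)
          qed
        qed
        have E'_ev: "E' e \<in> events" if "e \<in> H" for e using E'A[OF that] A_events[of e] H that by blast
        have E'_empty: "{\<omega>\<in>space M. \<forall>e\<in>H. \<omega> \<in> E' e} = {}"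
        proof (rule ccontr)
          assume "\<not> ?thesis"
          then obtain \<omega> where w: "\<omega> \<in> space M" "\<And>e. e \<in> H \<Longrightarrow> \<omega> \<in> E' e" by auto
          define x where "x = {s\<in>S. \<omega> \<in> s}"
          have "\<omega> \<in> G x e" if "e \<in> H" for e
            using w(2)[OF that] by (auto simp: E'_def a_def atom_def x_def split: if_splits)
          then show False using G(3)[of x] w(1) by blast
        qed
        have tail: "prob (\<Union>x\<in>Pow S. E1 x e - G x e) \<le> \<epsilon> / 2" if "e \<in> H" for e
        proof -
          have "prob (\<Union>x\<in>Pow S. E1 x e - G x e) \<le> (\<Sum>x\<in>Pow S. prob (E1 x e - G x e))"
            using finS E1_ev G_ev that by (intro measure_UNION_le) auto
          also have "\<dots> \<le> (\<Sum>x\<in>Pow S. \<epsilon>2)" using G(2)[OF that] by (intro sum_mono less_imp_le)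
          finally show ?thesis using \<epsilon>2(2) by simp
        qed
        have small: "prob (E e - E' e) < \<epsilon>" if eH: "e \<in> H" for e
        proof (cases "f \<subseteq> e")
          case False
          have "prob (E e - E' e) \<le> prob (\<Union>x\<in>Pow S. E1 x e - G x e)"
          proof (rule finite_measure_mono)
            show "E e - E' e \<subseteq> (\<Union>x\<in>Pow S. E1 x e - G x e)"
              using False by (auto simp: E'_def E1_def)
          qed (use finS E1_ev G_ev eH in auto)
          then show ?thesis using tail[OF eH] psubset.prems(5) by simp
        next
          case True
          then have eH': "e \<in> H'" using eH by (simp add: H'_def)
          note J = H'J(1,2)[OF eH']
          define g where "g = glue (space M) S (L e)"
          have L_ev: "L e x \<in> events" for x using L[OF eH'] face_sigma_events[OF J(2)] by blast
          have g_ev: "g \<in> events" unfolding g_def glue_eq_UN_atom a_def[symmetric]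
            using a_ev L_ev finS by (intro sets.finite_UN) auto
          \<comment> \<open>What the replacement loses of the approximation; there, at least a proportion \<open>\<eta>\<close> of the atom lies outside \<open>E e\<close> and so is an error of the approximation.\<close>
          define Z where "Z x = L e x - mostly_in F' e \<eta> (a x) (E e)" for x
          have ZB: "Z x \<in> sets (face_sigma F' e)" for x unfolding Z_def using L[OF eH'] mostly_in_sets by auto
          then have ZJ: "Z x \<in> sets (face_sigma F' J)" for x using face_sigma_mono[OF order_refl J(2) order_refl] by blast
          have Zev: "Z x \<in> events" for x using ZB face_sigma_events[OF J(2)] by blast
          have "E e - E' e \<subseteq> (E e - g) \<union> ((\<Union>x\<in>Pow S. a x \<inter> Z x) \<union> (\<Union>x\<in>Pow S. E1 x e - G x e))"
          proof
            fix \<omega> assume w: "\<omega> \<in> E e - E' e"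
            then have "\<omega> \<in> space M" using E_ev[OF eH] sets.sets_into_space by blast
            define x where "x = {s\<in>S. \<omega> \<in> s}"
            have x: "x \<in> Pow S" "\<omega> \<in> a x" using \<open>\<omega> \<in> space M\<close> by (auto simp: x_def a_def atom_def)
            have "\<omega> \<notin> G x e" using w x True by (auto simp: E'_def)
            moreover have "\<omega> \<in> L e x" if "\<omega> \<in> g" using that by (simp add: g_def glue_def x_def)
            moreover have "E1 x e = mostly_in F' e \<eta> (a x) (E e)" using True by (simp add: E1_def)
            ultimately show "\<omega> \<in> (E e - g) \<union> ((\<Union>x\<in>Pow S. a x \<inter> Z x) \<union> (\<Union>x\<in>Pow S. E1 x e - G x e))"
              using w x unfolding Z_def by blast
          qed
          then have "prob (E e - E' e) \<le>
              prob ((E e - g) \<union> ((\<Union>x\<in>Pow S. a x \<inter> Z x) \<union> (\<Union>x\<in>Pow S. E1 x e - G x e)))"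
            using finS E_ev[OF eH] g_ev a_ev Zev E1_ev[OF eH] G_ev[OF eH]
            by (intro finite_measure_mono sets.Un sets.finite_UN) auto
          also have "\<dots> \<le> prob (E e - g) + prob ((\<Union>x\<in>Pow S. a x \<inter> Z x) \<union> (\<Union>x\<in>Pow S. E1 x e - G x e))"
            using finS E_ev[OF eH] g_ev a_ev Zev E1_ev[OF eH] G_ev[OF eH]
            by (intro measure_Un_le sets.Un sets.finite_UN) auto
          also have "prob ((\<Union>x\<in>Pow S. a x \<inter> Z x) \<union> (\<Union>x\<in>Pow S. E1 x e - G x e))
              \<le> prob (\<Union>x\<in>Pow S. a x \<inter> Z x) + prob (\<Union>x\<in>Pow S. E1 x e - G x e)"
            using finS a_ev Zev E1_ev[OF eH] G_ev[OF eH]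
            by (intro measure_Un_le sets.finite_UN) auto
          also have "prob (\<Union>x\<in>Pow S. E1 x e - G x e) \<le> \<epsilon> / 2" by (rule tail[OF eH])
          also have "prob (\<Union>x\<in>Pow S. a x \<inter> Z x) \<le> \<epsilon> / 4"
          proof -
            have "prob (\<Union>x\<in>Pow S. a x \<inter> Z x) \<le> (\<Sum>x\<in>Pow S. prob (a x \<inter> Z x))"
              using finS a_ev Zev by (intro measure_UNION_le) auto
            then have "\<eta> * prob (\<Union>x\<in>Pow S. a x \<inter> Z x) \<le> \<eta> * (\<Sum>x\<in>Pow S. prob (a x \<inter> Z x))"
              using \<eta>(1) by (intro mult_left_mono) auto
            also have "\<dots> = (\<Sum>x\<in>Pow S. \<eta> * prob (a x \<inter> Z x))" by (rule sum_distrib_left)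
            also have "\<dots> \<le> (\<Sum>x\<in>Pow S. prob ((a x - E e) \<inter> Z x))"
            proof (rule sum_mono)
              fix x
              show "\<eta> * prob (a x \<inter> Z x) \<le> prob ((a x - E e) \<inter> Z x)"
              proof (rule mostly_in_outside[OF F'(1) _ _ J a E_sig[OF eH'] \<eta>(1) ZJ])
                show "Z x \<inter> mostly_in F' e \<eta> (a x) (E e) = {}" by (auto simp: Z_def)
              qed (use F'(2,3) in blast)+
            qed
            also have "\<dots> = prob (\<Union>x\<in>Pow S. (a x - E e) \<inter> Z x)"
            proof (rule finite_measure_finite_Union[symmetric])
              show "disjoint_family_on (\<lambda>x. (a x - E e) \<inter> Z x) (Pow S)"
                by (auto simp: disjoint_family_on_def a_def atom_def)
            qed (use finS a_ev Zev E_ev[OF eH] in auto)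
            also have "\<dots> \<le> prob (sym_diff (E e) g)"
            proof (rule finite_measure_mono)
              show "(\<Union>x\<in>Pow S. (a x - E e) \<inter> Z x) \<subseteq> sym_diff (E e) g"
                by (auto simp: g_def glue_def Z_def a_def atom_def)
            qed (use E_ev[OF eH] g_ev in auto)
            also have "\<dots> \<le> \<epsilon>1" using approx[OF eH'] by (simp add: g_def)
            finally show ?thesis using \<eta>(1) by (simp add: \<epsilon>1_def field_simps)
          qed
          also have "prob (E e - g) \<le> \<epsilon>1"
          proof -
            have "prob (E e - g) \<le> prob (sym_diff (E e) g)"
              using E_ev[OF eH] g_ev by (intro finite_measure_mono) auto
            then show ?thesis using approx[OF eH'] by (simp add: g_def)
          qed
          also have "\<epsilon>1 \<le> \<epsilon> / 8"
            using \<eta>(2) psubset.prems(5) by (simp add: \<epsilon>1_def)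
          finally show ?thesis using psubset.prems(5) by simp
        qed
        show ?thesis using E'A small E'_empty by blast
      qed
    qed
  qed
qed

end

section \<open>The faces of an ultraproduct of cubes\<close>

definition depends_on :: "('j \<Rightarrow> 'v) set \<Rightarrow> 'j set \<Rightarrow> ('j \<Rightarrow> 'v) set \<Rightarrow> bool" where
  "depends_on X e D \<longleftrightarrow> (\<forall>x\<in>X. \<forall>y\<in>X. (\<forall>j\<in>e. x j = y j) \<longrightarrow> (x \<in> D \<longleftrightarrow> y \<in> D))"

lemma depends_onD:
  "depends_on X e D \<Longrightarrow> x \<in> X \<Longrightarrow> y \<in> X \<Longrightarrow> (\<And>j. j \<in> e \<Longrightarrow> x j = y j) \<Longrightarrow> x \<in> D \<longleftrightarrow> y \<in> D"
  unfolding depends_on_def by blast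

lemma depends_on_mono: "depends_on X f D \<Longrightarrow> f \<subseteq> e \<Longrightarrow> depends_on X e D"
  unfolding depends_on_def by (meson subsetD)

lemma depends_on_Compl: "depends_on X e D \<Longrightarrow> depends_on X e (- D)"
  unfolding depends_on_def by blast

lemma depends_on_Int: "depends_on X e D \<Longrightarrow> depends_on X e D' \<Longrightarrow> depends_on X e (D \<inter> D')"
  unfolding depends_on_def by blast

definition merge :: "'j set \<Rightarrow> ('j \<Rightarrow> 'v) \<Rightarrow> ('j \<Rightarrow> 'v) \<Rightarrow> 'j \<Rightarrow> 'v" where
  "merge f x y = (\<lambda>j. if j \<in> f then x j else y j)"

lemma merge_in_PiE: "x \<in> PiE J V \<Longrightarrow> y \<in> PiE J V \<Longrightarrow> merge f x y \<in> PiE J V"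
  by (auto simp: merge_def PiE_def extensional_def)

text \<open>
  Freezing the coordinates outside \<open>f\<close> turns dependence on \<open>g\<close> into dependence on \<open>g \<inter> f\<close>.
\<close>
lemma depends_on_slice:
  assumes "depends_on (PiE J V) g D" "y \<in> PiE J V"
  shows "depends_on (PiE J V) (g \<inter> f) {x. merge f x y \<in> D}"
  unfolding depends_on_def mem_Collect_eq
  by (intro ballI impI depends_onD[OF assms(1)] merge_in_PiE assms(2)) (auto simp: merge_def)

text \<open>
  Exchanging the coordinates outside \<open>f\<close> is an involution on pairs of points, so a merged pair of
  independent uniform points is uniform.
\<close>
lemma sum_merge:
  fixes \<phi> :: "('j \<Rightarrow> 'v) \<Rightarrow> real"
  shows "(\<Sum>y\<in>PiE J V. \<Sum>x\<in>PiE J V. \<phi> (merge f x y)) = card (PiE J V) * (\<Sum>x\<in>PiE J V. \<phi> x)"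
proof -
  let ?X = "PiE J V"
  have "(\<Sum>y\<in>?X. \<Sum>x\<in>?X. \<phi> (merge f x y)) = (\<Sum>(y,x)\<in>?X \<times> ?X. \<phi> (merge f x y))"
    by (rule sum.cartesian_product)
  also have "\<dots> = (\<Sum>(y,x)\<in>?X \<times> ?X. \<phi> x)"
    by (rule sum.reindex_bij_witness[where i = "\<lambda>(y,x). (merge f y x, merge f x y)"
          and j = "\<lambda>(y,x). (merge f y x, merge f x y)"])
      (auto simp: merge_in_PiE, auto simp: merge_def fun_eq_iff)
  also have "\<dots> = (\<Sum>y\<in>?X. \<Sum>x\<in>?X. \<phi> x)" by (rule sum.cartesian_product[symmetric])
  finally show ?thesis by simp
qed

text \<open>
  The correlation of \<open>h\<close> with \<open>D\<close> is the average, over the choice \<open>y\<close> of the frozen coordinates, of its correlations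
  with the slices of \<open>D\<close>; some slice does at least as well as the average.
\<close>
lemma exists_dominating_slice:
  fixes h :: "('j \<Rightarrow> 'v) \<Rightarrow> real"
  assumes fin: "finite (PiE J V)" and ne: "PiE J V \<noteq> {}"
    and h: "\<And>x y. x \<in> PiE J V \<Longrightarrow> y \<in> PiE J V \<Longrightarrow> (\<And>j. j \<in> f \<Longrightarrow> x j = y j) \<Longrightarrow> h x = h y"
  shows "\<exists>y\<in>PiE J V. \<bar>\<Sum>x\<in>PiE J V. h x * indicator D x\<bar>
      \<le> \<bar>\<Sum>x\<in>PiE J V. h x * indicator {x. merge f x y \<in> D} x\<bar>"
proof (rule ccontr)
  let ?X = "PiE J V"
  let ?s = "\<bar>\<Sum>x\<in>?X. h x * indicator D x\<bar>"
  assume "\<not> ?thesis"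
  then have less: "\<bar>\<Sum>x\<in>?X. h x * indicator {x. merge f x y \<in> D} x\<bar> < ?s" if "y \<in> ?X" for y
    using that by force
  have h_merge: "h x = h (merge f x y)" if "x \<in> ?X" "y \<in> ?X" for x y
    by (rule h[OF that(1) merge_in_PiE[OF that]]) (simp add: merge_def)
  have "card ?X * ?s = \<bar>\<Sum>y\<in>?X. \<Sum>x\<in>?X. h (merge f x y) * indicator D (merge f x y)\<bar>"
    unfolding sum_merge[where \<phi> = "\<lambda>x. h x * indicator D x"] by (simp add: abs_mult)
  also have "\<dots> = \<bar>\<Sum>y\<in>?X. \<Sum>x\<in>?X. h x * indicator {x. merge f x y \<in> D} x\<bar>"
    by (intro arg_cong[where f = abs] sum.cong refl) (auto simp: h_merge[symmetric] indicator_def)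
  also have "\<dots> \<le> (\<Sum>y\<in>?X. \<bar>\<Sum>x\<in>?X. h x * indicator {x. merge f x y \<in> D} x\<bar>)" by (rule sum_abs)
  also have "\<dots> < (\<Sum>y\<in>?X. ?s)" by (rule sum_strict_mono[OF fin ne less])
  finally show False by simp
qed

locale cube_ultraproduct =
  fixes U :: "nat filter" and J :: "'j set" and V :: "nat \<Rightarrow> 'v set"
  assumes U: "ultrafilter U" "U \<le> sequentially"
    and J: "finite J" and V: "\<And>n. finite (V n)" "\<And>n. V n \<noteq> {}"
begin

definition X :: "nat \<Rightarrow> ('j \<Rightarrow> 'v) set" where
  "X n = PiE J (\<lambda>_. V n)"

sublocale ultraproduct U X
  by unfold_locales (use U J V in \<open>auto simp: X_def PiE_eq_empty_iff intro!: finite_PiE\<close>)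

definition Face :: "'j set \<Rightarrow> (nat \<Rightarrow> 'j \<Rightarrow> 'v) set set" where
  "Face e = {internal D | D. \<forall>n. depends_on (X n) e (D n)}"

lemma Face_algebra: "algebra points (Face e)"
  unfolding algebra_iff_Int
proof (intro conjI ballI)
  show "Face e \<subseteq> Pow points" using internal_subset by (auto simp: Face_def)
  show "{} \<in> Face e"
    unfolding Face_def internal_empty[symmetric] by (auto simp: depends_on_def)
  fix a assume "a \<in> Face e"
  then obtain D where D: "a = internal D" "\<And>n. depends_on (X n) e (D n)" by (auto simp: Face_def)
  have "depends_on (X n) e (- D n)" for n by (rule depends_on_Compl[OF D(2)])
  then show "points - a \<in> Face e" unfolding D(1) internal_Compl[symmetric] Face_def by blast
  fix b assume "b \<in> Face e"
  then obtain D' where D': "b = internal D'" "\<And>n. depends_on (X n) e (D' n)" by (auto simp: Face_def)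
  have "depends_on (X n) e (D n \<inter> D' n)" for n
    by (rule depends_on_Int[OF D(2) D'(2)])
  then show "a \<inter> b \<in> Face e" unfolding D(1) D'(1) internal_Int[symmetric] Face_def by blast
qed

lemma Face_mono: "f \<subseteq> e \<Longrightarrow> Face f \<subseteq> Face e"
  using depends_on_mono unfolding Face_def by blast

lemma Face_internal: "Face e \<subseteq> range internal"
  by (auto simp: Face_def)

text \<open>
  Let \<open>u\<close> be the conditional probability of \<open>a\<close> given the proper subfaces of \<open>f\<close>. It has to be shown that
  \<open>indicator a - u\<close> is orthogonal to \<open>Y\<close> when \<open>Y\<close> is an intersection of sets from faces not containing \<open>f\<close>;
  such sets generate the \<open>\<sigma>\<close>-algebra in question. Up to a small error, \<open>u\<close> is the average \<open>v\<close> of finitely many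
  indicators of internal sets from \<open>A f\<close>, so the correlation is a limit of correlations in finite cubes. There
  \<open>exists_dominating_slice\<close> replaces \<open>Y\<close> by an intersection of slices, which come from faces \<open>g \<inter> f\<close> that are properly
  contained in \<open>f\<close>. To those \<open>indicator a - u\<close> is orthogonal by the choice of \<open>u\<close>.
\<close>
lemma Face_independent:
  fixes M :: "(nat \<Rightarrow> 'j \<Rightarrow> 'v) measure"
  assumes M: "prob_space M" and sp: "space M = points"
    and se: "sets M = sigma_sets points (range internal)"
    and me: "\<And>D. measure M (internal D) = dens D"
    and fJ: "f \<subseteq> J" and a: "a \<in> Face f"
  shows "\<exists>u. u \<in> borel_measurable (sigma (space M) (\<Union>g\<in>{g. g \<subset> f}. Face g)) \<and> integrable M u \<and>
        (\<forall>Y\<in>sigma_sets (space M) (\<Union>g\<in>{g. g \<subseteq> J \<and> \<not> f \<subseteq> g}. Face g).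
           measure M (a \<inter> Y) = (\<integral>\<omega>. u \<omega> * indicator Y \<omega> \<partial>M))"
proof -
  interpret prob_space M by (rule M)
  have internal_ev: "internal D \<in> events" for D unfolding se by auto
  have Face_ev: "Face e \<subseteq> events" for e using internal_ev by (auto simp: Face_def)
  have Face_pts: "Face e \<subseteq> Pow points" for e using internal_subset by (auto simp: Face_def)
  have lower_Pow: "(\<Union>g\<in>{g. g \<subset> f}. Face g) \<subseteq> Pow (space M)" using Face_pts sp by auto
  define N where "N = sigma (space M) (\<Union>g\<in>{g. g \<subset> f}. Face g)"
  have sN: "sets N = sigma_sets (space M) (\<Union>g\<in>{g. g \<subset> f}. Face g)"
    unfolding N_def by (rule sets_measure_of[OF lower_Pow])
  have N: "subalgebra M N"
    unfolding subalgebra_def sN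
    by (intro conjI sets.sigma_sets_subset) (use Face_ev in \<open>auto simp: N_def space_measure_of_conv\<close>)
  interpret finite_measure_subalgebra M N
    unfolding finite_measure_subalgebra_def finite_measure_subalgebra_axioms_def
    using N finite_measure_axioms by blast
  have ind: "integrable M (indicator D :: _ \<Rightarrow> real)" if "D \<in> events" for D
    by (rule integrable_real_indicator) (use that in \<open>auto simp: less_top[symmetric]\<close>)
  have a_ev: "a \<in> events" using a Face_ev by blast
  define u where "u = real_cond_exp M N (indicator a)"
  have u_N: "u \<in> borel_measurable N" unfolding u_def by simp
  have u_int: "integrable M u" unfolding u_def by (rule real_cond_exp_int(1)[OF ind[OF a_ev]])
  have u_bounds: "AE \<omega> in M. 0 \<le> u \<omega> \<and> u \<omega> \<le> 1"
  proof -
    have "AE \<omega> in M. 0 \<le> u \<omega>" unfolding u_def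
      by (rule real_cond_exp_ge_c[OF ind[OF a_ev]]) auto
    moreover have "AE \<omega> in M. u \<omega> \<le> 1" unfolding u_def
      by (rule real_cond_exp_le_c[OF ind[OF a_ev]]) (auto simp: indicator_def)
    ultimately show ?thesis by eventually_elim auto
  qed
  have u_lower: "(\<integral>\<omega>\<in>Y. indicat_real a \<omega> \<partial>M) = (\<integral>\<omega>\<in>Y. u \<omega> \<partial>M)" if "Y \<in> sets N" for Y
    unfolding u_def by (rule real_cond_exp_intA[OF ind[OF a_ev] that])
  obtain D where D: "a = internal D" "\<And>n. depends_on (X n) f (D n)" using a by (auto simp: Face_def)
  define GG where "GG = {g. g \<subseteq> J \<and> \<not> f \<subseteq> g}"
  have finGG: "finite GG" using J unfolding GG_def by (rule finite_subset[rotated, OF finite_Pow_iff[THEN iffD2]]) auto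
  define P where "P = {{\<omega>\<in>points. \<forall>g\<in>GG. \<omega> \<in> c g} | c. \<forall>g\<in>GG. c g \<in> Face g}"
  have P_stable: "Int_stable P"
  proof (rule Int_stableI)
    fix a b assume "a \<in> P" "b \<in> P"
    then obtain c d where c: "a = {\<omega>\<in>points. \<forall>g\<in>GG. \<omega> \<in> c g}" "\<forall>g\<in>GG. c g \<in> Face g"
      and d: "b = {\<omega>\<in>points. \<forall>g\<in>GG. \<omega> \<in> d g}" "\<forall>g\<in>GG. d g \<in> Face g" by (auto simp: P_def)
    have "c g \<inter> d g \<in> Face g" if "g \<in> GG" for g
    proof -
      interpret algebra points "Face g" by (rule Face_algebra)
      show ?thesis using c(2) d(2) that by auto
    qed
    moreover have "a \<inter> b = {\<omega>\<in>points. \<forall>g\<in>GG. \<omega> \<in> c g \<inter> d g}" using c(1) d(1) by auto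
    ultimately show "a \<inter> b \<in> P" unfolding P_def
      by (intro CollectI exI[of _ "\<lambda>g. c g \<inter> d g"]) auto
  qed
  have P_ev: "P \<subseteq> events"
  proof
    fix Y assume "Y \<in> P"
    then obtain c where c: "Y = {\<omega>\<in>points. \<forall>g\<in>GG. \<omega> \<in> c g}" "\<forall>g\<in>GG. c g \<in> Face g" by (auto simp: P_def)
    have "{\<omega>\<in>space M. \<omega> \<in> c g} \<in> events" if "g \<in> GG" for g
    proof -
      have "c g \<in> events" using c(2) Face_ev that by blast
      then show ?thesis by simp
    qed
    then show "Y \<in> events" unfolding c(1) sp[symmetric] by (intro sets.sets_Collect_finite_All finGG)
  qed
  have P_gen: "Face g \<subseteq> P" if "g \<in> GG" for g
  proof
    fix Y assume Y: "Y \<in> Face g"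
    have "points \<in> Face g'" for g'
    proof -
      interpret algebra points "Face g'" by (rule Face_algebra)
      show ?thesis by (rule top)
    qed
    moreover have "Y = {\<omega>\<in>points. \<forall>g'\<in>GG. \<omega> \<in> (if g' = g then Y else points)}"
      using Y Face_pts that by auto
    ultimately show "Y \<in> P" using Y unfolding P_def
      by (intro CollectI exI[of _ "\<lambda>g'. if g' = g then Y else points"]) auto
  qed
  have main: "(\<integral>\<omega>\<in>Y. indicat_real a \<omega> \<partial>M) = (\<integral>\<omega>\<in>Y. u \<omega> \<partial>M)" if Y: "Y \<in> P" for Y
  proof -
    obtain c where c: "Y = {\<omega>\<in>points. \<forall>g\<in>GG. \<omega> \<in> c g}" "\<forall>g\<in>GG. c g \<in> Face g"
      using Y by (auto simp: P_def)
    then have "\<forall>g\<in>GG. \<exists>E. c g = internal E \<and> (\<forall>n. depends_on (X n) g (E n))"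
      by (auto simp: Face_def)
    then obtain E where E: "\<And>g. g \<in> GG \<Longrightarrow> c g = internal (E g)"
      "\<And>g n. g \<in> GG \<Longrightarrow> depends_on (X n) g (E g n)" by metis
    define DY where "DY n = {x. \<forall>g\<in>GG. x \<in> E g n}" for n
    have Y_int: "Y = internal DY"
      unfolding DY_def internal_INT[OF finGG] c(1) using E(1) by auto
    have bound: "\<bar>(\<integral>\<omega>\<in>Y. indicator a \<omega> \<partial>M) - (\<integral>\<omega>\<in>Y. u \<omega> \<partial>M)\<bar> \<le> 2 * \<epsilon>" if \<epsilon>: "\<epsilon> > 0" for \<epsilon>
    proof -
      have "u \<in> borel_measurable (sigma (space M) (Face f))"
      proof (rule measurable_from_subalg[OF _ u_N])
        have "sets (sigma (space M) (Face f)) = sigma_sets (space M) (Face f)"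
          by (rule sets_measure_of) (use Face_pts sp in auto)
        moreover have "sets N \<subseteq> sigma_sets (space M) (Face f)"
          unfolding sN
        proof (rule sigma_sets_mono')
          show "(\<Union>g\<in>{g. g \<subset> f}. Face g) \<subseteq> Face f" using Face_mono by blast
        qed
        ultimately show "subalgebra (sigma (space M) (Face f)) N"
          by (simp add: subalgebra_def N_def space_measure_of_conv)
      qed
      moreover have "algebra (space M) (Face f)" unfolding sp by (rule Face_algebra)
      ultimately have "\<exists>(K::nat) (C :: nat \<Rightarrow> (nat \<Rightarrow> 'j \<Rightarrow> 'v) set). (\<forall>i. C i \<in> Face f) \<and> K > 0 \<and>
          (\<integral>\<omega>. \<bar>u \<omega> - (\<Sum>i<K. indicator (C i) \<omega>) / real K\<bar> \<partial>M) \<le> \<epsilon>"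
        by (intro approx_function_by_algebra Face_ev u_bounds u_int \<epsilon>)
      then obtain K :: nat and C :: "nat \<Rightarrow> (nat \<Rightarrow> 'j \<Rightarrow> 'v) set"
        where KC: "(\<forall>i. C i \<in> Face f) \<and> K > 0 \<and>
          (\<integral>\<omega>. \<bar>u \<omega> - (\<Sum>i<K. indicator (C i) \<omega>) / real K\<bar> \<partial>M) \<le> \<epsilon>"
        by (elim exE)
      then have C: "\<And>i. C i \<in> Face f" and K: "K > 0"
        and approx: "(\<integral>\<omega>. \<bar>u \<omega> - (\<Sum>i<K. indicator (C i) \<omega>) / real K\<bar> \<partial>M) \<le> \<epsilon>" by simp_all
      have "\<forall>i. \<exists>E. C i = internal E \<and> (\<forall>n. depends_on (X n) f (E n))" using C by (simp add: Face_def)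
      then obtain CE where CE: "\<And>i. C i = internal (CE i)" "\<And>i n. depends_on (X n) f (CE i n)" by metis
      have C_ev: "C i \<in> events" for i using C Face_ev by blast
      define v where "v \<omega> = (\<Sum>i<K. indicator (C i) \<omega>) / K" for \<omega> :: "nat \<Rightarrow> 'j \<Rightarrow> 'v"
      have v_int: "integrable M v" unfolding v_def
        by (intro integrable_divide Bochner_Integration.integrable_sum ind C_ev)
      \<comment> \<open>\<open>val S\<close> is the finite counterpart of the integral of \<open>indicator a - v\<close> over \<open>internal S\<close>.\<close>
      define h where "h n x = indicator (D n) x - (\<Sum>i<K. indicator (CE i n) x) / K" for n x
      define val where "val S n = (\<Sum>x\<in>X n. h n x * indicator (S n) x) / card (X n)" for S :: "nat \<Rightarrow> ('j \<Rightarrow> 'v) set" and n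
      have val_lim: "(val S \<longlongrightarrow> (\<integral>\<omega>\<in>internal S. indicator a \<omega> \<partial>M) - (\<integral>\<omega>\<in>internal S. v \<omega> \<partial>M)) U" for S
      proof -
        have card_sum: "real (card (A n \<inter> S n \<inter> X n)) = (\<Sum>x\<in>X n. indicator (A n) x * indicator (S n) x)"
          for A :: "nat \<Rightarrow> ('j \<Rightarrow> 'v) set" and n
        proof -
          have "(\<Sum>x\<in>X n. indicator (A n) x * indicator (S n) x :: real) = (\<Sum>x\<in>X n. indicator (A n \<inter> S n) x)"
            by (simp add: indicator_inter_arith)
          also have "\<dots> = card (X n \<inter> (A n \<inter> S n))" using fin[of n] by (simp add: indicator_def Int_def)
          finally show ?thesis by (simp add: Int_commute Int_left_commute Int_assoc)
        qed
        have "val S n = rel_size (\<lambda>n. D n \<inter> S n) n - (\<Sum>i<K. rel_size (\<lambda>n. CE i n \<inter> S n) n) / K" for n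
        proof -
          have "(\<Sum>x\<in>X n. h n x * indicator (S n) x)
            = (\<Sum>x\<in>X n. indicator (D n) x * indicator (S n) x)
              - (\<Sum>x\<in>X n. \<Sum>i<K. indicator (CE i n) x * indicator (S n) x / K)"
            by (simp add: h_def left_diff_distrib sum_subtractf sum_divide_distrib sum_distrib_right)
          also have "(\<Sum>x\<in>X n. \<Sum>i<K. indicator (CE i n) x * indicator (S n) x / K)
            = (\<Sum>i<K. (\<Sum>x\<in>X n. indicator (CE i n) x * indicator (S n) x) / real K)"
            by (subst sum.swap) (simp add: sum_divide_distrib)
          finally show ?thesis
            unfolding val_def rel_size_def card_sum[symmetric]
            by (simp add: diff_divide_distrib sum_divide_distrib divide_divide_eq_left mult.commute)
        qed
        then have "val S = (\<lambda>n. rel_size (\<lambda>n. D n \<inter> S n) n - (\<Sum>i<K. rel_size (\<lambda>n. CE i n \<inter> S n) n) / K)" by auto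
        moreover have "((\<lambda>n. rel_size (\<lambda>n. D n \<inter> S n) n - (\<Sum>i<K. rel_size (\<lambda>n. CE i n \<inter> S n) n) / K)
            \<longlongrightarrow> dens (\<lambda>n. D n \<inter> S n) - (\<Sum>i<K. dens (\<lambda>n. CE i n \<inter> S n)) / K) U"
          using K by (intro tendsto_diff tendsto_divide tendsto_sum rel_size_tendsto tendsto_const) auto
        moreover have "(\<integral>\<omega>\<in>internal S. indicator (internal A) \<omega> \<partial>M) = dens (\<lambda>n. A n \<inter> S n)" for A
        proof -
          have "(\<integral>\<omega>\<in>internal S. indicat_real (internal A) \<omega> \<partial>M) = (\<integral>\<omega>. indicator (internal A \<inter> internal S) \<omega> \<partial>M)"
            by (simp add: set_lebesgue_integral_def indicator_inter_arith mult.commute)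
          then show ?thesis using internal_ev by (simp add: internal_Int[symmetric] me)
        qed
        moreover have "(\<integral>\<omega>\<in>internal S. v \<omega> \<partial>M) = (\<Sum>i<K. (\<integral>\<omega>\<in>internal S. indicator (C i) \<omega> \<partial>M)) / K"
        proof -
          have "(\<integral>\<omega>\<in>internal S. v \<omega> \<partial>M) = (\<integral>\<omega>. (\<Sum>i<K. indicator (internal S) \<omega> * indicator (C i) \<omega>) / K \<partial>M)"
            by (simp add: set_lebesgue_integral_def v_def sum_distrib_left)
          also have "\<dots> = (\<Sum>i<K. (\<integral>\<omega>. indicator (internal S) \<omega> * indicator (C i) \<omega> \<partial>M)) / K"
          proof -
            have "integrable M (\<lambda>\<omega>. indicator (internal S) \<omega> * indicator (C i) \<omega> :: real)" for i
              using integrable_mult_indicator[OF internal_ev[of S] ind[OF C_ev[of i]]] by simp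
            then have "(\<integral>\<omega>. (\<Sum>i<K. indicat_real (internal S) \<omega> * indicator (C i) \<omega>) \<partial>M)
                = (\<Sum>i<K. (\<integral>\<omega>. indicator (internal S) \<omega> * indicator (C i) \<omega> \<partial>M))"
              by (rule Bochner_Integration.integral_sum)
            then show ?thesis by (simp only: integral_divide_zero)
          qed
          finally show ?thesis by (simp add: set_lebesgue_integral_def)
        qed
        ultimately show ?thesis by (simp add: D(1) CE(1))
      qed
      have h_dep: "h n x = h n y" if "x \<in> X n" "y \<in> X n" "\<And>j. j \<in> f \<Longrightarrow> x j = y j" for n x y
      proof -
        have "x \<in> D n \<longleftrightarrow> y \<in> D n" by (rule depends_onD[OF D(2) that])
        moreover have "x \<in> CE i n \<longleftrightarrow> y \<in> CE i n" for i by (rule depends_onD[OF CE(2) that])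
        ultimately show ?thesis by (simp add: h_def indicator_def)
      qed
      have "\<exists>y\<in>X n. \<bar>\<Sum>x\<in>X n. h n x * indicator (DY n) x\<bar>
          \<le> \<bar>\<Sum>x\<in>X n. h n x * indicator {x. merge f x y \<in> DY n} x\<bar>" for n
        using exists_dominating_slice[where V = "\<lambda>_. V n" and J = J and f = f and h = "h n" and D = "DY n",
            folded X_def, OF fin ne h_dep] .
      then have "\<forall>n. \<exists>y. y \<in> X n \<and> \<bar>\<Sum>x\<in>X n. h n x * indicator (DY n) x\<bar>
          \<le> \<bar>\<Sum>x\<in>X n. h n x * indicator {x. merge f x y \<in> DY n} x\<bar>" by (simp add: Bex_def)
      from choice[OF this] obtain y where "\<forall>n. y n \<in> X n \<and> \<bar>\<Sum>x\<in>X n. h n x * indicator (DY n) x\<bar>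
          \<le> \<bar>\<Sum>x\<in>X n. h n x * indicator {x. merge f x (y n) \<in> DY n} x\<bar>" ..
      then have y: "\<And>n. y n \<in> X n" and
        dom: "\<And>n. \<bar>\<Sum>x\<in>X n. h n x * indicator (DY n) x\<bar>
          \<le> \<bar>\<Sum>x\<in>X n. h n x * indicator {x. merge f x (y n) \<in> DY n} x\<bar>" by simp_all
      \<comment> \<open>The worst slices of the sets \<open>DY n\<close>, put together to an internal set \<open>Z\<close> that involves only proper subfaces of \<open>f\<close>.\<close>
      define DZ where "DZ n = {x. merge f x (y n) \<in> DY n}" for n
      define Z where "Z = internal DZ"
      have val_le: "\<bar>val DY n\<bar> \<le> \<bar>val DZ n\<bar>" for n
        using dom[of n] unfolding val_def DZ_def abs_divide by (intro divide_right_mono) auto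
      have le: "\<bar>(\<integral>\<omega>\<in>Y. indicator a \<omega> \<partial>M) - (\<integral>\<omega>\<in>Y. v \<omega> \<partial>M)\<bar>
          \<le> \<bar>(\<integral>\<omega>\<in>Z. indicator a \<omega> \<partial>M) - (\<integral>\<omega>\<in>Z. v \<omega> \<partial>M)\<bar>"
        unfolding Y_int Z_def
        by (rule tendsto_le[OF U_ne tendsto_rabs[OF val_lim] tendsto_rabs[OF val_lim]]) (simp add: val_le)
      have "Z \<in> sets N"
      proof -
        define EZ where "EZ g n = {x. merge f x (y n) \<in> E g n}" for g n
        have "DZ = (\<lambda>n. {x. \<forall>g\<in>GG. x \<in> EZ g n})" by (auto simp: DZ_def DY_def EZ_def)
        then have Z_eq: "Z = {\<omega>\<in>space N. \<forall>g\<in>GG. \<omega> \<in> internal (EZ g)}"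
          unfolding Z_def by (simp add: internal_INT[OF finGG] N_def space_measure_of_conv sp)
        have EZ_N: "internal (EZ g) \<in> sets N" if g: "g \<in> GG" for g
        proof -
          have "depends_on (X n) (g \<inter> f) (EZ g n)" for n
            unfolding EZ_def X_def
            by (rule depends_on_slice) (use E(2)[OF g] y in \<open>auto simp: X_def\<close>)
          then have "internal (EZ g) \<in> Face (g \<inter> f)" by (auto simp: Face_def)
          moreover have "g \<inter> f \<subset> f" using g by (auto simp: GG_def)
          ultimately show ?thesis unfolding sN by blast
        qed
        show ?thesis unfolding Z_eq
        proof (rule sets.sets_Collect_finite_All[OF _ finGG])
          fix g assume "g \<in> GG"
          have "{\<omega> \<in> space N. \<omega> \<in> internal (EZ g)} = internal (EZ g)"
            using sets.sets_into_space[OF EZ_N[OF \<open>g \<in> GG\<close>]] by auto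
          then show "{\<omega> \<in> space N. \<omega> \<in> internal (EZ g)} \<in> sets N" using EZ_N[OF \<open>g \<in> GG\<close>] by simp
        qed
      qed
      have diff: "\<bar>(\<integral>\<omega>\<in>internal S. u \<omega> \<partial>M) - (\<integral>\<omega>\<in>internal S. v \<omega> \<partial>M)\<bar> \<le> \<epsilon>" for S
      proof -
        have i: "integrable M (\<lambda>\<omega>. indicator (internal S) \<omega> *\<^sub>R k \<omega>)" if "integrable M k" for k :: "_ \<Rightarrow> real"
          by (rule integrable_mult_indicator[OF internal_ev that])
        have "(\<integral>\<omega>\<in>internal S. u \<omega> \<partial>M) - (\<integral>\<omega>\<in>internal S. v \<omega> \<partial>M)
            = (\<integral>\<omega>. indicator (internal S) \<omega> *\<^sub>R u \<omega> - indicator (internal S) \<omega> *\<^sub>R v \<omega> \<partial>M)"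
          unfolding set_lebesgue_integral_def by (rule Bochner_Integration.integral_diff[OF i[OF u_int] i[OF v_int], symmetric])
        also have "\<bar>\<dots>\<bar> \<le> (\<integral>\<omega>. \<bar>indicator (internal S) \<omega> *\<^sub>R u \<omega> - indicator (internal S) \<omega> *\<^sub>R v \<omega>\<bar> \<partial>M)"
          by (rule integral_abs_bound)
        also have "\<dots> \<le> (\<integral>\<omega>. \<bar>u \<omega> - v \<omega>\<bar> \<partial>M)"
        proof (rule integral_mono)
          show "integrable M (\<lambda>\<omega>. \<bar>indicator (internal S) \<omega> *\<^sub>R u \<omega> - indicator (internal S) \<omega> *\<^sub>R v \<omega>\<bar>)"
            by (intro integrable_abs Bochner_Integration.integrable_diff i u_int v_int)
          show "integrable M (\<lambda>\<omega>. \<bar>u \<omega> - v \<omega>\<bar>)"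
            by (intro integrable_abs Bochner_Integration.integrable_diff u_int v_int)
        qed (auto simp: indicator_def)
        finally show ?thesis using approx unfolding v_def by linarith
      qed
      have "\<bar>(\<integral>\<omega>\<in>Z. indicator a \<omega> \<partial>M) - (\<integral>\<omega>\<in>Z. v \<omega> \<partial>M)\<bar> \<le> \<epsilon>"
        unfolding u_lower[OF \<open>Z \<in> sets N\<close>] unfolding Z_def by (rule diff)
      then show ?thesis using le diff[of DY] unfolding Y_int[symmetric] by linarith
    qed
    show ?thesis
    proof (rule ccontr)
      assume "\<not> ?thesis"
      then have "\<bar>(\<integral>\<omega>\<in>Y. indicator a \<omega> \<partial>M) - (\<integral>\<omega>\<in>Y. u \<omega> \<partial>M)\<bar> > 0" by simp
      then show False
        using bound[of "\<bar>(\<integral>\<omega>\<in>Y. indicator a \<omega> \<partial>M) - (\<integral>\<omega>\<in>Y. u \<omega> \<partial>M)\<bar> / 4"] by simp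
    qed
  qed
  have "measure M (a \<inter> Y) = (\<integral>\<omega>. u \<omega> * indicator Y \<omega> \<partial>M)"
    if Y: "Y \<in> sigma_sets (space M) (\<Union>g\<in>{g. g \<subseteq> J \<and> \<not> f \<subseteq> g}. Face g)" for Y
  proof -
    have Y': "Y \<in> sigma_sets (space M) P"
      using Y sigma_sets_mono'[of "\<Union>g\<in>{g. g \<subseteq> J \<and> \<not> f \<subseteq> g}. Face g" P] P_gen
      unfolding GG_def by blast
    then have Yev: "Y \<in> events" using sets.sigma_sets_subset[OF P_ev] by blast
    have "(\<integral>\<omega>\<in>Y. indicat_real a \<omega> \<partial>M) = (\<integral>\<omega>\<in>Y. u \<omega> \<partial>M)"
    proof (rule set_integral_eq_on_sigma_sets[OF ind[OF a_ev] u_int P_stable P_ev _ main Y'])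
      show "(\<integral>\<omega>. indicat_real a \<omega> \<partial>M) = (\<integral>\<omega>. u \<omega> \<partial>M)"
        unfolding u_def by (rule real_cond_exp_int(2)[OF ind[OF a_ev], symmetric])
    qed
    moreover have "(\<integral>\<omega>\<in>Y. indicat_real a \<omega> \<partial>M) = (\<integral>\<omega>. indicator (a \<inter> Y) \<omega> \<partial>M)"
      by (simp add: set_lebesgue_integral_def indicator_inter_arith mult.commute)
    ultimately show ?thesis using a_ev Yev by (simp add: set_lebesgue_integral_def mult.commute)
  qed
  then show ?thesis using u_N u_int unfolding N_def by blast
qed

end

section \<open>The hypergraph removal lemma\<close>

lemma (in cube_ultraproduct) Loeb_face_algebras:
  "\<exists>M. face_algebras M J Face \<and> space M = points \<and> (\<forall>D. measure M (internal D) = dens D)"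
proof -
  obtain M where M: "prob_space M" "space M = points" "sets M = sigma_sets points (range internal)"
    "\<And>D. measure M (internal D) = dens D"
    using Loeb_measure_exists by blast
  have "face_algebras M J Face"
  proof (intro face_algebras.intro face_algebras_axioms.intro M(1) J)
    show "algebra (space M) (Face e)" for e unfolding M(2) by (rule Face_algebra)
    show "Face e \<subseteq> sets M" for e unfolding M(3) using Face_internal[of e] by blast
    show "Face f \<subseteq> Face e" if "f \<subseteq> e" for f e using that by (rule Face_mono)
  qed (rule Face_independent[OF M])
  then show ?thesis using M(2,4) by blast
qed

definition partite_system :: "'j set \<Rightarrow> 'j set set \<Rightarrow> 'v set \<Rightarrow> ('j set \<Rightarrow> ('j \<Rightarrow> 'v) set) \<Rightarrow> bool" where
  "partite_system J H V E \<longleftrightarrow> finite V \<and> V \<noteq> {} \<and> (\<forall>e\<in>H. depends_on (J \<rightarrow>\<^sub>E V) e (E e))"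

definition partite_solutions :: "'j set \<Rightarrow> 'j set set \<Rightarrow> 'v set \<Rightarrow> ('j set \<Rightarrow> ('j \<Rightarrow> 'v) set) \<Rightarrow> ('j \<Rightarrow> 'v) set" where
  "partite_solutions J H V E = {x\<in>J \<rightarrow>\<^sub>E V. \<forall>e\<in>H. x \<in> E e}"

text \<open>
  Removal without reference to the size of the faces: the sets removed at \<open>e\<close> are counted inside the full
  cube, of which they are a proportion of at most \<open>\<epsilon>\<close>.
\<close>
definition removable :: "real \<Rightarrow> 'j set \<Rightarrow> 'j set set \<Rightarrow> 'v set \<Rightarrow> ('j set \<Rightarrow> ('j \<Rightarrow> 'v) set) \<Rightarrow> bool" where
  "removable \<epsilon> J H V E \<longleftrightarrow> (\<exists>E'. partite_system J H V E' \<and> partite_solutions J H V E' = {} \<and>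
     (\<forall>e\<in>H. real (card {x\<in>J \<rightarrow>\<^sub>E V. x \<in> E e \<and> x \<notin> E' e}) \<le> \<epsilon> * real (card (J \<rightarrow>\<^sub>E V))))"

text \<open>
  If this failed for every \<open>\<delta>\<close>, counterexamples for \<open>\<delta> = 1 / (n + 1)\<close> would define sets \<open>Einf e\<close> in the faces of an
  ultraproduct with null intersection. The sets given by \<open>infinitary_removal\<close> are internal, and for almost
  all \<open>n\<close> their \<open>n\<close>-th components would show that the \<open>n\<close>-th counterexample is none.
\<close>
theorem partite_hypergraph_removal:
  fixes J :: "'j set" and \<epsilon> :: real
  assumes J: "finite J" and H: "H \<subseteq> Pow J" and \<epsilon>: "\<epsilon> > 0"
  shows "\<exists>\<delta>::real. \<delta> > 0 \<and> (\<forall>(V :: 'v set) E. partite_system J H V E \<longrightarrow>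
     real (card (partite_solutions J H V E)) \<le> \<delta> * real (card (J \<rightarrow>\<^sub>E V)) \<longrightarrow> removable \<epsilon> J H V E)"
proof (rule ccontr)
  assume neg: "\<not> ?thesis"
  have "\<forall>n. \<exists>VE. partite_system J H (fst VE) (snd VE) \<and>
      real (card (partite_solutions J H (fst VE) (snd VE))) \<le> 1 / real (Suc n) * real (card (J \<rightarrow>\<^sub>E fst VE)) \<and>
      \<not> removable \<epsilon> J H (fst VE) (snd VE :: 'j set \<Rightarrow> ('j \<Rightarrow> 'v) set)"
  proof
    fix n
    have "1 / real (Suc n) > 0" by simp
    then obtain V :: "'v set" and E where "partite_system J H V E"
      "real (card (partite_solutions J H V E)) \<le> 1 / real (Suc n) * real (card (J \<rightarrow>\<^sub>E V))"
      "\<not> removable \<epsilon> J H V E" using neg by blast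
    then show "\<exists>VE. partite_system J H (fst VE) (snd VE) \<and>
        real (card (partite_solutions J H (fst VE) (snd VE))) \<le> 1 / real (Suc n) * real (card (J \<rightarrow>\<^sub>E fst VE)) \<and>
        \<not> removable \<epsilon> J H (fst VE) (snd VE :: 'j set \<Rightarrow> ('j \<Rightarrow> 'v) set)"
      by (intro exI[of _ "(V, E)"]) simp
  qed
  from choice[OF this] obtain VE where VE: "\<And>n. partite_system J H (fst (VE n)) (snd (VE n))"
      "\<And>n. real (card (partite_solutions J H (fst (VE n)) (snd (VE n))))
        \<le> 1 / real (Suc n) * real (card (J \<rightarrow>\<^sub>E fst (VE n)))"
      "\<And>n. \<not> removable \<epsilon> J H (fst (VE n)) (snd (VE n) :: 'j set \<Rightarrow> ('j \<Rightarrow> 'v) set)" by auto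
  define V where "V n = fst (VE n)" for n
  define E where "E n = snd (VE n)" for n
  note VE = VE[folded V_def E_def]
  have V: "finite (V n)" "V n \<noteq> {}" and dep: "e \<in> H \<Longrightarrow> depends_on (J \<rightarrow>\<^sub>E V n) e (E n e)" for n e
    using VE(1)[of n] by (simp_all add: partite_system_def)
  obtain U :: "nat filter" where U: "U \<le> sequentially" "ultrafilter U"
    using ultrafilter_exists[of sequentially] by auto
  interpret cube_ultraproduct U J V
    by unfold_locales (use U J V in auto)
  obtain M where M: "face_algebras M J Face" "space M = points"
    and me: "\<And>D. measure M (internal D) = dens D"
    using Loeb_face_algebras by blast
  interpret face_algebras M J Face by (rule M(1))
  have finH: "finite H" using H J by (meson finite_Pow_iff finite_subset)
  define Einf where "Einf e = internal (\<lambda>n. E n e)" for e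
  have Einf_Face: "Einf e \<in> Face e" if "e \<in> H" for e
    unfolding Einf_def Face_def X_def using dep[OF that] by blast
  have "prob {\<omega>\<in>space M. \<forall>e\<in>H. \<omega> \<in> Einf e} = 0"
  proof -
    define D where "D n = {x. \<forall>e\<in>H. x \<in> E n e}" for n
    have "{\<omega>\<in>space M. \<forall>e\<in>H. \<omega> \<in> Einf e} = internal D"
      unfolding D_def internal_INT[OF finH] M(2) Einf_def ..
    moreover have "dens D = 0"
    proof (rule densI, rule tendsto_sandwich[OF _ _ tendsto_const])
      show "\<forall>\<^sub>F n in U. 0 \<le> rel_size D n" by (simp add: rel_size_bounds)
      have "rel_size D n \<le> 1 / real (Suc n)" for n
      proof -
        have "D n \<inter> X n = partite_solutions J H (V n) (E n)" by (auto simp: D_def X_def partite_solutions_def)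
        then have "real (card (D n \<inter> X n)) \<le> 1 / real (Suc n) * card (X n)" using VE(2)[of n] by (simp add: X_def)
        then show ?thesis using card_X[of n] by (simp add: rel_size_def field_simps)
      qed
      then show "\<forall>\<^sub>F n in U. rel_size D n \<le> 1 / real (Suc n)" by simp
      show "((\<lambda>n. 1 / real (Suc n)) \<longlongrightarrow> 0) U"
        using tendsto_mono[OF free LIMSEQ_inverse_real_of_nat] by (simp add: inverse_eq_divide)
    qed
    ultimately show ?thesis by (simp add: me)
  qed
  moreover have "Einf e \<in> sets (face_sigma (Pow J) e)" if "e \<in> H" for e
    using Einf_Face[OF that] H that by (subst sets_face_sigma) auto
  ultimately obtain F where F: "\<And>e. e \<in> H \<Longrightarrow> F e \<in> Face e" "\<And>e. e \<in> H \<Longrightarrow> prob (Einf e - F e) < \<epsilon>"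
    "{\<omega>\<in>space M. \<forall>e\<in>H. \<omega> \<in> F e} = {}"
    using infinitary_removal[OF order_refl _ H, of Einf \<epsilon>] \<epsilon> by blast
  have "\<forall>e\<in>H. \<exists>D. F e = internal D \<and> (\<forall>n. depends_on (X n) e (D n))"
    using F(1) unfolding Face_def by blast
  from bchoice[OF this] obtain D where D: "\<And>e. e \<in> H \<Longrightarrow> F e = internal (D e)"
    "\<And>e n. e \<in> H \<Longrightarrow> depends_on (X n) e (D e n)" by blast
  have "\<forall>\<^sub>F n in U. {x. \<forall>e\<in>H. x \<in> D e n} \<inter> X n = {}"
    unfolding internal_empty_iff[symmetric] internal_INT[OF finH] using F(3) D(1) M(2) by auto
  moreover have "\<forall>\<^sub>F n in U. \<forall>e\<in>H. rel_size (\<lambda>n. E n e - D e n) n < \<epsilon>"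
  proof (rule eventually_ball_finite[OF finH], rule ballI)
    fix e assume e: "e \<in> H"
    have "dens (\<lambda>n. E n e - D e n) < \<epsilon>"
      using F(2)[OF e] unfolding D(1)[OF e] Einf_def internal_diff[symmetric] me .
    then show "\<forall>\<^sub>F n in U. rel_size (\<lambda>n. E n e - D e n) n < \<epsilon>"
      by (rule order_tendstoD(2)[OF rel_size_tendsto])
  qed
  ultimately have "\<forall>\<^sub>F n in U. removable \<epsilon> J H (V n) (E n)"
  proof eventually_elim
    case (elim n)
    have "card {x\<in>X n. x \<in> E n e \<and> x \<notin> D e n} \<le> \<epsilon> * card (X n)" if e: "e \<in> H" for e
    proof -
      have eq: "(E n e - D e n) \<inter> X n = {x\<in>X n. x \<in> E n e \<and> x \<notin> D e n}" by auto
      then have "card {x\<in>X n. x \<in> E n e \<and> x \<notin> D e n} / card (X n) < \<epsilon>"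
        using bspec[OF elim(2) e] by (simp only: rel_size_def eq)
      then show ?thesis using card_X[of n] by (simp add: field_simps)
    qed
    moreover have "{x\<in>X n. \<forall>e\<in>H. x \<in> D e n} = {}" using elim(1) by auto
    ultimately show ?case
      using D(2) V unfolding removable_def partite_system_def partite_solutions_def X_def
      by (intro exI[of _ "\<lambda>e. D e n"]) simp
  qed
  then obtain n where "removable \<epsilon> J H (V n) (E n)"
    using eventually_happens'[OF U_ne] by blast
  then show False using VE(3)[of n] by blast
qed

lemma card_non_injective_le:
  assumes J: "finite J" and V: "finite V"
  shows "card {x\<in>J \<rightarrow>\<^sub>E V. \<not> inj_on x J} \<le> (card J)\<^sup>2 * card V ^ (card J - 1)"
proof -
  define C where "C p = {x\<in>J \<rightarrow>\<^sub>E V. x (fst p) = x (snd p)}" for p :: "'a \<times> 'a"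
  define P where "P = {p\<in>J \<times> J. fst p \<noteq> snd p}"
  have finP: "finite P" using J by (simp add: P_def)
  have fin: "finite (J \<rightarrow>\<^sub>E V)" using J V by (intro finite_PiE) auto
  have C_card: "card (C p) \<le> card V ^ (card J - 1)" if p: "p \<in> P" for p
  proof -
    have pJ: "fst p \<in> J" "snd p \<in> J" "fst p \<noteq> snd p" using p by (auto simp: P_def)
    have "card (C p) \<le> card ((J - {fst p}) \<rightarrow>\<^sub>E V)"
    proof (rule card_inj_on_le)
      show "inj_on (\<lambda>x. restrict x (J - {fst p})) (C p)"
      proof (rule inj_onI)
        fix x y assume xy: "x \<in> C p" "y \<in> C p" "restrict x (J - {fst p}) = restrict y (J - {fst p})"
        have eq: "x j = y j" if "j \<in> J - {fst p}" for j
          using fun_cong[OF xy(3), of j] that by simp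
        have "x j = y j" if "j \<in> J" for j
          using eq[of j] eq[of "snd p"] pJ that xy(1,2) by (cases "j = fst p") (auto simp: C_def)
        then show "x = y" using xy(1,2) by (intro PiE_ext[of x J "\<lambda>_. V" y]) (auto simp: C_def)
      qed
      show "(\<lambda>x. restrict x (J - {fst p})) ` C p \<subseteq> (J - {fst p}) \<rightarrow>\<^sub>E V"
      proof (rule image_subsetI)
        fix x assume "x \<in> C p"
        then have "x \<in> J \<rightarrow>\<^sub>E V" by (simp add: C_def)
        then show "restrict x (J - {fst p}) \<in> (J - {fst p}) \<rightarrow>\<^sub>E V"
          unfolding restrict_PiE_iff by (blast dest: PiE_mem)
      qed
      show "finite ((J - {fst p}) \<rightarrow>\<^sub>E V)" using J V by (intro finite_PiE) auto
    qed
    also have "\<dots> = card V ^ (card J - 1)" using J pJ(1) by (simp add: card_PiE)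
    finally show ?thesis .
  qed
  have "{x\<in>J \<rightarrow>\<^sub>E V. \<not> inj_on x J} \<subseteq> (\<Union>p\<in>P. C p)"
    by (auto simp: inj_on_def C_def P_def)
  then have "card {x\<in>J \<rightarrow>\<^sub>E V. \<not> inj_on x J} \<le> card (\<Union>p\<in>P. C p)"
    using finP fin by (intro card_mono) (auto simp: C_def)
  also have "\<dots> \<le> (\<Sum>p\<in>P. card (C p))" by (rule card_UN_le[OF finP])
  also have "\<dots> \<le> (\<Sum>p\<in>P. card V ^ (card J - 1))" by (rule sum_mono[OF C_card])
  also have "\<dots> = card P * card V ^ (card J - 1)" by simp
  also have "card P \<le> card (J \<times> J)" using J by (intro card_mono) (auto simp: P_def)
  then have "card P * card V ^ (card J - 1) \<le> (card J)\<^sup>2 * card V ^ (card J - 1)"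
    by (intro mult_right_mono) (simp_all add: power2_eq_square card_cartesian_product)
  finally show ?thesis .
qed

text \<open>
  A set that depends only on \<open>c\<close> is a union of full fibres of the restriction to \<open>c\<close>, so densities in the cube
  over \<open>J\<close> and in the cube over \<open>c\<close> agree; passing from maps on \<open>c\<close> to their images only identifies more.
\<close>
lemma card_projection_le:
  assumes J: "finite J" and V: "finite V" "V \<noteq> {}" and cJ: "c \<subseteq> J"
    and dep: "depends_on (J \<rightarrow>\<^sub>E V) c D"
    and small: "real (card {x\<in>J \<rightarrow>\<^sub>E V. x \<in> D}) \<le> \<epsilon> * real (card (J \<rightarrow>\<^sub>E V))"
  shows "real (card ((\<lambda>x. x ` c) ` {x\<in>J \<rightarrow>\<^sub>E V. x \<in> D})) \<le> \<epsilon> * real (card V) ^ card c"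
proof -
  define T where "T = {x\<in>J \<rightarrow>\<^sub>E V. x \<in> D}"
  define R where "R = (\<lambda>x. x ` c) ` T"
  have fin: "finite (J \<rightarrow>\<^sub>E V)" using J V by (intro finite_PiE) auto
  have finT: "finite T" unfolding T_def using fin by simp
  have "\<forall>d\<in>R. \<exists>x. x \<in> T \<and> x ` c = d" by (auto simp: R_def)
  from bchoice[OF this] obtain x0 where "\<forall>d\<in>R. x0 d \<in> T \<and> x0 d ` c = d" ..
  then have x0: "\<And>d. d \<in> R \<Longrightarrow> x0 d \<in> T" "\<And>d. d \<in> R \<Longrightarrow> x0 d ` c = d" by simp_all
  have merge_PiE: "merge c (x0 d) z \<in> J \<rightarrow>\<^sub>E V" if "d \<in> R" "z \<in> (J - c) \<rightarrow>\<^sub>E V" for d z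
    using x0(1)[OF that(1)] that(2) cJ by (auto simp: merge_def T_def PiE_def extensional_def Pi_def)
  have "card (R \<times> ((J - c) \<rightarrow>\<^sub>E V)) \<le> card T"
  proof (rule card_inj_on_le[where f = "\<lambda>(d, z). merge c (x0 d) z"])
    show "inj_on (\<lambda>(d, z). merge c (x0 d) z) (R \<times> ((J - c) \<rightarrow>\<^sub>E V))"
    proof (rule inj_onI, clarify)
      fix d z d' z' assume d: "d \<in> R" "d' \<in> R" and z: "z \<in> (J - c) \<rightarrow>\<^sub>E V" "z' \<in> (J - c) \<rightarrow>\<^sub>E V"
        and eq: "merge c (x0 d) z = merge c (x0 d') z'"
      have "x0 d j = x0 d' j" if "j \<in> c" for j using fun_cong[OF eq, of j] that by (simp add: merge_def)
      then have "x0 d ` c = x0 d' ` c" by (intro image_cong) auto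
      moreover have "z j = z' j" if "j \<in> J - c" for j
        using fun_cong[OF eq, of j] that by (simp add: merge_def)
      then have "z = z'" using z by (intro PiE_ext[of z "J - c" "\<lambda>_. V" z']) auto
      ultimately show "d = d' \<and> z = z'" using x0(2) d by simp
    qed
    show "(\<lambda>(d, z). merge c (x0 d) z) ` (R \<times> ((J - c) \<rightarrow>\<^sub>E V)) \<subseteq> T"
    proof clarify
      fix d z assume dz: "d \<in> R" "z \<in> (J - c) \<rightarrow>\<^sub>E V"
      have "merge c (x0 d) z \<in> D \<longleftrightarrow> x0 d \<in> D"
        by (rule depends_onD[OF dep merge_PiE[OF dz]]) (use x0(1)[OF dz(1)] in \<open>auto simp: T_def merge_def\<close>)
      then show "merge c (x0 d) z \<in> T" using x0(1)[OF dz(1)] merge_PiE[OF dz] by (simp add: T_def)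
    qed
  qed (rule finT)
  then have "real (card R) * real (card V) ^ (card J - card c) \<le> real (card T)"
    using J cJ by (simp add: card_cartesian_product card_PiE card_Diff_subset finite_subset flip: of_nat_power of_nat_mult)
  also have "\<dots> \<le> \<epsilon> * real (card V) ^ card J"
    using small J by (simp add: T_def card_PiE)
  also have "card J = card c + (card J - card c)" using card_mono[OF J cJ] by simp
  then have "\<epsilon> * real (card V) ^ card J = \<epsilon> * real (card V) ^ card c * real (card V) ^ (card J - card c)"
    by (metis power_add mult.assoc)
  finally have "real (card R) \<le> \<epsilon> * real (card V) ^ card c"
    using V by (simp add: card_gt_0_iff)
  then show ?thesis by (simp add: R_def T_def)
qed

definition edge_copies :: "'w set \<Rightarrow> 'v set \<Rightarrow> 'i set \<Rightarrow> ('i \<Rightarrow> 'w set) \<Rightarrow> ('i \<Rightarrow> 'v set set) \<Rightarrow> ('w \<Rightarrow> 'v) set" where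
  "edge_copies W V I e \<E> = {f \<in> W \<rightarrow>\<^sub>E V. inj_on f W \<and> (\<forall>i\<in>I. f ` e i \<in> \<E> i)}"

text \<open>
  Removal for copies of \<open>(W, e)\<close> in a hypergraph on \<open>V\<close> with edge sets \<open>\<E> i\<close>, with \<open>\<delta>\<close> uniform over all patterns on at
  most \<open>N\<close> vertices: up to renaming of vertices there are finitely many of them. The partite lemma
  counts all homomorphisms, while copies are injective. If \<open>V\<close> is large, the non-injective maps form a
  negligible proportion; if \<open>V\<close> is small, the bound on the number of copies forces it to be zero.
\<close>
theorem hypergraph_removal:
  fixes \<epsilon> :: real and N :: nat
  assumes \<epsilon>: "\<epsilon> > 0"
  shows "\<exists>\<delta>::real. \<delta> > 0 \<and> (\<forall>(W :: 'w set) (V :: 'v set) (I :: 'i set) e \<E>.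
     finite W \<longrightarrow> card W \<le> N \<longrightarrow> finite V \<longrightarrow> (\<forall>i\<in>I. e i \<subseteq> W) \<longrightarrow>
     real (card (edge_copies W V I e \<E>)) < \<delta> * real (card V) ^ card W \<longrightarrow>
     (\<exists>R. (\<forall>i\<in>I. R i \<subseteq> \<E> i \<and> real (card (R i)) \<le> \<epsilon> * real (card V) ^ card (e i)) \<and>
          (\<forall>f\<in>edge_copies W V I e \<E>. \<exists>i\<in>I. f ` e i \<in> R i)))"
proof -
  define ix where "ix = (SIGMA h:{..N}. Pow (Pow {..<h}))"
  have ix: "finite ix" "ix \<noteq> {}" by (auto simp: ix_def)
  have "\<forall>p\<in>ix. \<exists>\<delta>::real. \<delta> > 0 \<and> (\<forall>(V :: 'v set) E. partite_system {..<fst p} (snd p) V E \<longrightarrow>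
     real (card (partite_solutions {..<fst p} (snd p) V E)) \<le> \<delta> * real (card ({..<fst p} \<rightarrow>\<^sub>E V)) \<longrightarrow>
     removable \<epsilon> {..<fst p} (snd p) V E)"
  proof (intro ballI partite_hypergraph_removal \<epsilon>)
    fix p assume "p \<in> ix"
    then show "snd p \<subseteq> Pow {..<fst p}" unfolding ix_def by (cases p) simp
  qed simp
  from bchoice[OF this] obtain d where "\<forall>p\<in>ix. d p > (0::real) \<and>
     (\<forall>(V :: 'v set) E. partite_system {..<fst p} (snd p) V E \<longrightarrow>
       real (card (partite_solutions {..<fst p} (snd p) V E)) \<le> d p * real (card ({..<fst p} \<rightarrow>\<^sub>E V)) \<longrightarrow>
       removable \<epsilon> {..<fst p} (snd p) V E)" ..
  then have d: "\<And>p. p \<in> ix \<Longrightarrow> d p > (0::real)"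
    "\<And>p (V :: 'v set) E. p \<in> ix \<Longrightarrow> partite_system {..<fst p} (snd p) V E \<Longrightarrow>
     real (card (partite_solutions {..<fst p} (snd p) V E)) \<le> d p * real (card ({..<fst p} \<rightarrow>\<^sub>E V)) \<Longrightarrow>
     removable \<epsilon> {..<fst p} (snd p) V E" by simp_all
  define \<delta>1 where "\<delta>1 = Min (d ` ix)"
  have \<delta>1: "\<delta>1 > 0" "\<And>p. p \<in> ix \<Longrightarrow> \<delta>1 \<le> d p" using ix d(1) by (auto simp: \<delta>1_def)
  \<comment> \<open>From this size of \<open>V\<close> on, the non-injective maps use up at most half of the number of homomorphisms permitted by \<open>\<delta>1\<close>.\<close>
  define T where "T = 2 * real N ^ 2 / \<delta>1 + 1"
  have T: "T \<ge> 1" using \<delta>1 by (simp add: T_def)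
  define \<delta> where "\<delta> = min (\<delta>1 / 2) (1 / T ^ N)"
  have \<delta>: "\<delta> > 0" "\<delta> \<le> \<delta>1 / 2" "\<delta> \<le> 1 / T ^ N" using \<delta>1 T by (auto simp: \<delta>_def)
  show ?thesis
  proof (intro exI[of _ \<delta>] conjI \<delta>(1) allI impI)
    fix W :: "'w set" and V :: "'v set" and I :: "'i set" and e \<E>
    assume W: "finite W" "card W \<le> N" and V: "finite V" and eW: "\<forall>i\<in>I. e i \<subseteq> W"
      and few: "real (card (edge_copies W V I e \<E>)) < \<delta> * real (card V) ^ card W"
    have fin_copies: "finite (edge_copies W V I e \<E>)"
      by (rule finite_subset[of _ "W \<rightarrow>\<^sub>E V"]) (use W V in \<open>auto simp: edge_copies_def intro!: finite_PiE\<close>)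
    show "\<exists>R. (\<forall>i\<in>I. R i \<subseteq> \<E> i \<and> real (card (R i)) \<le> \<epsilon> * real (card V) ^ card (e i)) \<and>
          (\<forall>f\<in>edge_copies W V I e \<E>. \<exists>i\<in>I. f ` e i \<in> R i)"
    proof (cases "real (card V) < T")
      case True
      have "real (card V) ^ card W \<le> T ^ card W" using True by (intro power_mono) auto
      also have "\<dots> \<le> T ^ N" using T W(2) by (intro power_increasing) auto
      finally have "\<delta> * real (card V) ^ card W \<le> (1 / T ^ N) * T ^ N"
        using \<delta> T by (intro mult_mono) auto
      also have "\<dots> = 1" using T by simp
      finally have "card (edge_copies W V I e \<E>) = 0" using few by simp
      then have "edge_copies W V I e \<E> = {}" using fin_copies by simp
      then show ?thesis using \<epsilon> by (intro exI[of _ "\<lambda>_. {}"]) simp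
    next
      case False
      then have "card V > 0" using T by linarith
      then have V_ne: "V \<noteq> {}" by auto
      define h where "h = card W"
      define J where "J = {..<h}"
      have J: "finite J" "card J = h" by (auto simp: J_def)
      obtain b where b: "bij_betw b J W"
        using ex_bij_betw_nat_finite[OF W(1)] by (auto simp: J_def h_def atLeast0LessThan)
      define b' where "b' = the_inv_into J b"
      have b': "bij_betw b' W J" unfolding b'_def by (rule bij_betw_the_inv_into[OF b])
      have bb': "b (b' w) = w" if "w \<in> W" for w
        using f_the_inv_into_f_bij_betw[OF b] that by (simp add: b'_def)
      have b'b: "b' (b j) = j" if "j \<in> J" for j
        using the_inv_into_f_f[OF bij_betw_imp_inj_on[OF b] that] by (simp add: b'_def)
      \<comment> \<open>The edges of the pattern, transported to the standard vertex set \<open>J\<close>.\<close>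
      define c where "c i = b' ` e i" for i
      have cJ: "c i \<subseteq> J" if "i \<in> I" for i
        using eW that bij_betw_imp_surj_on[OF b'] unfolding c_def by blast
      have bc: "b ` c i = e i" if "i \<in> I" for i
      proof -
        have "b ` c i = (\<lambda>w. b (b' w)) ` e i" by (simp add: c_def image_image)
        also have "\<dots> = (\<lambda>w. w) ` e i" by (rule image_cong) (use eW that bb' in auto)
        finally show ?thesis by simp
      qed
      have card_c: "card (c i) = card (e i)" if "i \<in> I" for i
        unfolding c_def by (rule card_image)
          (rule inj_on_subset[OF bij_betw_imp_inj_on[OF b']], use eW that in auto)
      define E where "E g = {x. \<forall>i\<in>I. c i = g \<longrightarrow> x ` g \<in> \<E> i}" for g
      have sys: "partite_system J (c ` I) V E"
        unfolding partite_system_def depends_on_def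
      proof (intro conjI V V_ne ballI impI)
        fix g :: "nat set" and x y :: "nat \<Rightarrow> 'v" assume "\<forall>j\<in>g. x j = y j"
        then have "x ` g = y ` g" by (intro image_cong) auto
        then show "x \<in> E g \<longleftrightarrow> y \<in> E g" by (simp add: E_def)
      qed
      have sol: "x \<in> partite_solutions J (c ` I) V E \<longleftrightarrow> x \<in> J \<rightarrow>\<^sub>E V \<and> (\<forall>i\<in>I. x ` c i \<in> \<E> i)" for x
        by (auto simp: partite_solutions_def E_def)
      have fin_PiE: "finite (J \<rightarrow>\<^sub>E V)" using J V by (intro finite_PiE) auto
      have "card {x\<in>partite_solutions J (c ` I) V E. inj_on x J} \<le> card (edge_copies W V I e \<E>)"
      proof (rule card_inj_on_le[OF _ _ fin_copies])
        let ?\<psi> = "\<lambda>x. restrict (x \<circ> b') W"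
        show "inj_on ?\<psi> {x\<in>partite_solutions J (c ` I) V E. inj_on x J}"
        proof (rule inj_onI, clarify)
          fix x y assume xy: "x \<in> partite_solutions J (c ` I) V E" "y \<in> partite_solutions J (c ` I) V E"
            and eq: "?\<psi> x = ?\<psi> y"
          have "x j = y j" if "j \<in> J" for j
            using fun_cong[OF eq, of "b j"] b'b[OF that] bij_betwE[OF b] that by simp
          then show "x = y" using xy by (intro PiE_ext[of x J "\<lambda>_. V" y]) (auto simp: sol)
        qed
        show "?\<psi> ` {x\<in>partite_solutions J (c ` I) V E. inj_on x J} \<subseteq> edge_copies W V I e \<E>"
        proof clarify
          fix x assume x: "x \<in> partite_solutions J (c ` I) V E" "inj_on x J"
          have "inj_on (x \<circ> b') W"
            using x(2) b' by (intro comp_inj_on) (auto simp: bij_betw_def)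
          then have "inj_on (?\<psi> x) W" by (simp add: inj_on_def)
          moreover have "?\<psi> x \<in> W \<rightarrow>\<^sub>E V"
            using x(1) bij_betwE[OF b'] by (auto simp: sol)
          moreover have "?\<psi> x ` e i \<in> \<E> i" if "i \<in> I" for i
          proof -
            have "?\<psi> x ` e i = (x \<circ> b') ` e i" by (rule image_cong) (use eW that in auto)
            also have "\<dots> = x ` c i" unfolding c_def by (rule image_comp[symmetric])
            also have "\<dots> \<in> \<E> i" using x(1) that unfolding sol by blast
            finally show ?thesis .
          qed
          ultimately show "?\<psi> x \<in> edge_copies W V I e \<E>" by (simp add: edge_copies_def)
        qed
      qed
      then have inj_le: "real (card {x\<in>partite_solutions J (c ` I) V E. inj_on x J}) \<le> \<delta>1 / 2 * real (card V) ^ h"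
      proof -
        have "real (card (edge_copies W V I e \<E>)) \<le> \<delta> * real (card V) ^ h" using few by (simp add: h_def)
        also have "\<dots> \<le> \<delta>1 / 2 * real (card V) ^ h" using \<delta>(2) by (intro mult_right_mono) auto
        finally show ?thesis
          using \<open>card {x\<in>partite_solutions J (c ` I) V E. inj_on x J} \<le> card (edge_copies W V I e \<E>)\<close> by linarith
      qed
      have noninj_le: "real (card {x\<in>J \<rightarrow>\<^sub>E V. \<not> inj_on x J}) \<le> \<delta>1 / 2 * real (card V) ^ h"
      proof (cases "h = 0")
        case True
        then show ?thesis using \<delta>1(1) by (simp add: J_def)
      next
        case False
        have "real (card {x\<in>J \<rightarrow>\<^sub>E V. \<not> inj_on x J}) \<le> real (h\<^sup>2 * card V ^ (h - 1))"
          using card_non_injective_le[OF J(1) V] unfolding J(2) of_nat_le_iff .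
        also have "\<dots> = (real h)\<^sup>2 * real (card V) ^ (h - 1)" by simp
        also have "\<dots> \<le> (\<delta>1 / 2 * real (card V)) * real (card V) ^ (h - 1)"
        proof (rule mult_right_mono)
          have "(real h)\<^sup>2 \<le> (real N)\<^sup>2" using W(2) by (intro power_mono) (auto simp: h_def)
          also have "\<dots> \<le> \<delta>1 / 2 * (T - 1)" using \<delta>1(1) by (simp add: T_def)
          also have "\<dots> \<le> \<delta>1 / 2 * real (card V)"
            using \<open>\<not> real (card V) < T\<close> \<delta>1(1) by (intro mult_left_mono) auto
          finally show "(real h)\<^sup>2 \<le> \<delta>1 / 2 * real (card V)" .
        qed simp
        also have "\<dots> = \<delta>1 / 2 * real (card V) ^ h" using False by (simp add: power_eq_if)
        finally show ?thesis .
      qed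
      have "card (partite_solutions J (c ` I) V E) \<le>
          card ({x\<in>partite_solutions J (c ` I) V E. inj_on x J} \<union> {x\<in>J \<rightarrow>\<^sub>E V. \<not> inj_on x J})"
        using fin_PiE by (intro card_mono) (auto simp: partite_solutions_def)
      also have "\<dots> \<le> card {x\<in>partite_solutions J (c ` I) V E. inj_on x J} + card {x\<in>J \<rightarrow>\<^sub>E V. \<not> inj_on x J}"
        by (rule card_Un_le)
      finally have "real (card (partite_solutions J (c ` I) V E)) \<le> \<delta>1 * real (card V) ^ h"
        using inj_le noninj_le by linarith
      moreover have p: "(h, c ` I) \<in> ix" using W(2) cJ by (auto simp: ix_def h_def J_def)
      then have "\<delta>1 * real (card V) ^ h \<le> d (h, c ` I) * real (card V) ^ h"
        using \<delta>1(2) by (intro mult_right_mono) auto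
      ultimately have "removable \<epsilon> J (c ` I) V E"
        using d(2)[OF p] sys by (simp add: J_def card_PiE)
      then obtain E' where E': "partite_system J (c ` I) V E'" "partite_solutions J (c ` I) V E' = {}"
        "\<And>i. i \<in> I \<Longrightarrow> real (card {x\<in>J \<rightarrow>\<^sub>E V. x \<in> E (c i) \<and> x \<notin> E' (c i)}) \<le> \<epsilon> * real (card (J \<rightarrow>\<^sub>E V))"
        unfolding removable_def by blast
      define R where "R i = (\<lambda>x. x ` c i) ` {x\<in>J \<rightarrow>\<^sub>E V. x \<in> E (c i) - E' (c i)}" for i
      show ?thesis
      proof (intro exI[of _ R] conjI ballI)
        fix i assume i: "i \<in> I"
        show "R i \<subseteq> \<E> i" using i by (auto simp: R_def E_def)
        have "depends_on (J \<rightarrow>\<^sub>E V) (c i) (E (c i) \<inter> - E' (c i))"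
          using sys E'(1) i unfolding partite_system_def by (intro depends_on_Int depends_on_Compl) auto
        then have "real (card (R i)) \<le> \<epsilon> * real (card V) ^ card (c i)"
          unfolding R_def using E'(3)[OF i]
          by (intro card_projection_le J V V_ne cJ i) (simp_all add: Diff_eq)
        then show "real (card (R i)) \<le> \<epsilon> * real (card V) ^ card (e i)" using card_c[OF i] by simp
      next
        fix f assume f: "f \<in> edge_copies W V I e \<E>"
        define x where "x = restrict (f \<circ> b) J"
        have xJ: "x \<in> J \<rightarrow>\<^sub>E V" using f bij_betwE[OF b] by (auto simp: x_def edge_copies_def)
        have im: "x ` c i = f ` e i" if "i \<in> I" for i
        proof -
          have "x ` c i = (f \<circ> b) ` c i" by (rule image_cong) (use cJ[OF that] in \<open>auto simp: x_def\<close>)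
          also have "\<dots> = f ` (b ` c i)" by (rule image_comp[symmetric])
          finally show ?thesis by (simp only: bc[OF that])
        qed
        have "x \<in> partite_solutions J (c ` I) V E" using f xJ im by (simp add: sol edge_copies_def)
        moreover have "x \<notin> partite_solutions J (c ` I) V E'" using E'(2) by simp
        ultimately obtain i where i: "i \<in> I" "x \<in> E (c i)" "x \<notin> E' (c i)"
          by (auto simp: partite_solutions_def)
        then have "x ` c i \<in> R i" unfolding R_def using xJ by (intro imageI) simp
        then show "\<exists>i\<in>I. f ` e i \<in> R i" using i(1) im by auto
      qed
    qed
  qed
qed

section \<open>Removal for representable systems\<close>

lemma fibres_partition_copies:
  assumes S: "r ` C = S \<times> Q" and C: "finite C" and T: "T \<subseteq> S"
    and fib: "\<And>x q. x \<in> S \<Longrightarrow> q \<in> Q \<Longrightarrow> real (card {f\<in>C. r f = (x, q)}) = c"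
  shows "real (card {f\<in>C. fst (r f) \<in> T}) = real (card T) * real (card Q) * c"
proof -
  have fin: "finite (S \<times> Q)" using S C by (metis finite_imageI)
  have eq: "{f\<in>C. fst (r f) \<in> T} = (\<Union>p\<in>T \<times> Q. {f\<in>C. r f = p})"
  proof (intro set_eqI iffI)
    fix f assume f: "f \<in> {f\<in>C. fst (r f) \<in> T}"
    then have "r f \<in> S \<times> Q" using S by blast
    then have "r f \<in> T \<times> Q" using f by (auto simp: mem_Times_iff)
    then show "f \<in> (\<Union>p\<in>T \<times> Q. {f\<in>C. r f = p})" using f by blast
  qed auto
  have "finite (T \<times> Q)" using T by (intro finite_subset[OF _ fin]) auto
  then have "card {f\<in>C. fst (r f) \<in> T} = (\<Sum>p\<in>T \<times> Q. card {f\<in>C. r f = p})"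
    unfolding eq using C by (intro card_UN_disjoint) auto
  then have "real (card {f\<in>C. fst (r f) \<in> T}) = (\<Sum>p\<in>T \<times> Q. real (card {f\<in>C. r f = p}))" by simp
  also have "\<dots> = (\<Sum>p\<in>T \<times> Q. c)"
    using T by (intro sum.cong refl) (auto intro!: fib)
  finally show ?thesis by (simp add: card_cartesian_product)
qed

text \<open>
  The passage from edges to labels. The assumption \<open>removal\<close> is the conclusion of \<open>hypergraph_removal\<close> for the
  pair \<open>(H, K)\<close>. The factor \<open>\<chi>\<^sub>2 / (2 * m)\<close> pays for the lower bound on \<open>c\<close> in RP2, for the threshold
  \<open>\<kappa> * \<gamma> j / m\<close> in the definition of \<open>X'\<close>, and for the strictness of the final bound.
\<close>
lemma representable_system_removal:
  fixes A :: "(nat \<Rightarrow> 'g) \<Rightarrow> bool" and G :: "'g set" and \<gamma> :: "nat \<Rightarrow> real"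
    and K H :: "nat coloured_hypergraph" and Q :: "nat set"
  assumes m: "m > 0" and G: "finite G" and \<gamma>: "\<And>j. j \<in> {1..m} \<Longrightarrow> \<gamma> j > 0"
    and \<epsilon>: "\<epsilon> > 0" and \<chi>\<^sub>2: "\<chi>\<^sub>2 > 0"
    and RP1: "RP1 m G \<chi>\<^sub>1 s K H e l"
    and RP2: "RP2 m A G \<gamma> \<chi>\<^sub>2 s K H e l p Q r"
    and RP3: "RP3 m A G \<gamma> K H p Q r"
    and removal: "\<And>\<E> :: nat \<Rightarrow> nat set set.
      real (card (edge_copies (verts H) (verts K) {1..m} e \<E>)) < \<delta> * real (card (verts K)) ^ card (verts H) \<Longrightarrow>
      \<exists>R. (\<forall>j\<in>{1..m}. R j \<subseteq> \<E> j \<and> real (card (R j)) \<le> (\<epsilon> * \<chi>\<^sub>2 / (2 * m)) * real (card (verts K)) ^ card (e j)) \<and>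
          (\<forall>f\<in>edge_copies (verts H) (verts K) {1..m} e \<E>. \<exists>j\<in>{1..m}. f ` e j \<in> R j)"
    and X: "\<And>j. j \<in> {1..m} \<Longrightarrow> X j \<subseteq> G"
    and \<delta>: "\<delta> > 0"
    and few: "real (card (solutions_in m A G (Pi\<^sub>E {1..m} X))) < \<delta> * real (card (solutions m A G))"
  shows "\<exists>X'. (\<forall>j\<in>{1..m}. X' j \<subseteq> X j \<and> real (card (X' j)) < \<epsilon> * real (card G) / \<gamma> j) \<and>
          solutions_in m A G (\<Pi>\<^sub>E j\<in>{1..m}. X j - X' j) = {}"
proof -
  define S where "S = solutions m A G"
  have K: "finite (verts K)" "\<And>d. d \<in> edges K \<Longrightarrow> d \<subseteq> verts K \<and> card d = s"
    and H: "finite (verts H)" "\<And>d. d \<in> edges H \<Longrightarrow> d \<subseteq> verts H \<and> card d = s"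
    and e: "bij_betw e {1..m} (edges H)" "\<And>j. j \<in> {1..m} \<Longrightarrow> colour H (e j) = j"
    using RP1 by (auto simp: RP1_def uniform_coloured_hypergraph_def)
  have e_edge: "e j \<in> edges H" if "j \<in> {1..m}" for j using bij_betwE[OF e(1)] that by blast
  have p: "p > 0" and Q: "Q \<noteq> {}" and r: "r ` copies H K = S \<times> Q"
    and r_lab: "\<And>f. f \<in> copies H K \<Longrightarrow> fst (r f) = (\<lambda>j\<in>{1..m}. l (f ` e j))"
    using RP2 unfolding RP2_def S_def by blast+
  obtain c where c: "c \<ge> \<chi>\<^sub>2" and fib: "\<And>x q. x \<in> S \<Longrightarrow> q \<in> Q \<Longrightarrow> real (card (fibre H K r x q)) =
          real p * (c * real (card (verts K)) ^ s / real (card G)) * (\<Prod>j=1..m. \<gamma> j)"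
    using RP2 unfolding RP2_def S_def by blast
  define \<kappa> where "\<kappa> = c * real (card (verts K)) ^ s / real (card G)"
  define \<Gamma> where "\<Gamma> = (\<Prod>j=1..m. \<gamma> j)"
  have fib: "real (card (fibre H K r x q)) = real p * \<kappa> * \<Gamma>" if "x \<in> S" "q \<in> Q" for x q
    using fib[OF that] by (simp add: \<kappa>_def \<Gamma>_def)
  have \<Gamma>: "\<Gamma> > 0" unfolding \<Gamma>_def by (intro prod_pos) (use \<gamma> in auto)
  have "S \<noteq> {}" using few \<delta> unfolding S_def by (metis card.empty mult_zero_right not_less of_nat_0 of_nat_0_le_iff)
  then obtain x0 where x0: "x0 \<in> S" by blast
  have "G \<noteq> {}"
    using x0 m by (auto simp: S_def solutions_def PiE_def Pi_def)
  then have cardG: "real (card G) > 0" using G by (simp add: card_gt_0_iff)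
  have fin_copies: "finite (copies H K)"
    by (rule finite_subset[of _ "verts H \<rightarrow>\<^sub>E verts K"]) (use H(1) K(1) in \<open>auto simp: copies_def intro!: finite_PiE\<close>)
  have finSQ: "finite (S \<times> Q)" using r fin_copies by (metis finite_imageI)
  have finQ: "finite Q" using finSQ x0 by (auto dest: finite_cartesian_productD2)
  have "copies H K \<noteq> {}" using r x0 Q by auto
  then obtain f0 where f0: "f0 \<in> copies H K" by blast
  have "verts H \<noteq> {}" using RP1 by (auto simp: RP1_def)
  then have "verts K \<noteq> {}" using f0 by (auto simp: copies_def PiE_def Pi_def)
  then have cardK: "real (card (verts K)) > 0" using K(1) by (simp add: card_gt_0_iff)
  have \<kappa>: "\<kappa> > 0" using c \<chi>\<^sub>2 cardK cardG by (simp add: \<kappa>_def)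
  have pl\<Gamma>: "real p * \<kappa> * \<Gamma> > 0" using p \<kappa> \<Gamma> by simp
  \<comment> \<open>The edges that may be used by copies whose solution lies in the product of the sets \<open>X j\<close>.\<close>
  define \<E> where "\<E> j = {d\<in>edges K. colour K d = j \<and> l d \<in> X j}" for j
  have copies_in: "f \<in> edge_copies (verts H) (verts K) {1..m} e \<E> \<longleftrightarrow>
      f \<in> copies H K \<and> (\<forall>j\<in>{1..m}. l (f ` e j) \<in> X j)" for f
  proof -
    have "edges H = e ` {1..m}" using e(1) by (simp add: bij_betw_def)
    then show ?thesis using e(2) by (auto simp: edge_copies_def copies_def \<E>_def)
  qed
  define SX where "SX = solutions_in m A G (Pi\<^sub>E {1..m} X)"
  have SX: "SX \<subseteq> S" by (auto simp: SX_def solutions_in_def S_def)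
  have copies_eq: "edge_copies (verts H) (verts K) {1..m} e \<E> = {f\<in>copies H K. fst (r f) \<in> SX}"
  proof (intro set_eqI)
    fix f
    have "fst (r f) \<in> SX \<longleftrightarrow> (\<forall>j\<in>{1..m}. l (f ` e j) \<in> X j)" if f: "f \<in> copies H K"
    proof -
      have "fst (r f) \<in> S" using f r by (metis image_eqI mem_Times_iff)
      then show ?thesis
        unfolding SX_def solutions_in_def S_def[symmetric] r_lab[OF f] by (auto simp: restrict_PiE_iff)
    qed
    then show "f \<in> edge_copies (verts H) (verts K) {1..m} e \<E> \<longleftrightarrow> f \<in> {f\<in>copies H K. fst (r f) \<in> SX}"
      unfolding copies_in by auto
  qed
  note count = fibres_partition_copies[OF r fin_copies _ fib[unfolded fibre_def]]
  have "real (card (edge_copies (verts H) (verts K) {1..m} e \<E>)) = real (card SX) * (real (card Q) * (real p * \<kappa> * \<Gamma>))"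
    unfolding copies_eq by (simp add: count[OF SX])
  also have "\<dots> < (\<delta> * real (card S)) * (real (card Q) * (real p * \<kappa> * \<Gamma>))"
  proof (rule mult_strict_right_mono)
    show "real (card SX) < \<delta> * real (card S)" using few by (simp add: SX_def S_def)
    have "card Q > 0" using Q finQ by (simp add: card_gt_0_iff)
    then show "0 < real (card Q) * (real p * \<kappa> * \<Gamma>)" by (intro mult_pos_pos[OF _ pl\<Gamma>]) simp
  qed
  also have "\<dots> = \<delta> * real (card {f\<in>copies H K. fst (r f) \<in> S})" by (simp add: count[OF order_refl])
  also have "\<dots> \<le> \<delta> * real (card (verts K)) ^ card (verts H)"
  proof -
    have "card {f\<in>copies H K. fst (r f) \<in> S} \<le> card (verts H \<rightarrow>\<^sub>E verts K)"
      using H(1) K(1) by (intro card_mono finite_PiE) (auto simp: copies_def)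
    also have "\<dots> = card (verts K) ^ card (verts H)" using H(1) by (simp add: card_PiE)
    finally have "real (card {f\<in>copies H K. fst (r f) \<in> S}) \<le> real (card (verts K)) ^ card (verts H)"
      unfolding of_nat_power[symmetric] of_nat_le_iff .
    then show ?thesis using \<delta> by (intro mult_left_mono) auto
  qed
  finally have "real (card (edge_copies (verts H) (verts K) {1..m} e \<E>)) < \<delta> * real (card (verts K)) ^ card (verts H)" .
  from removal[OF this] obtain R where R: "\<And>j. j \<in> {1..m} \<Longrightarrow> R j \<subseteq> \<E> j"
    "\<And>j. j \<in> {1..m} \<Longrightarrow> real (card (R j)) \<le> (\<epsilon> * \<chi>\<^sub>2 / (2 * m)) * real (card (verts K)) ^ card (e j)"
    "\<And>f. f \<in> edge_copies (verts H) (verts K) {1..m} e \<E> \<Longrightarrow> \<exists>j\<in>{1..m}. f ` e j \<in> R j"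
    by blast
  have finR: "finite (R j)" if "j \<in> {1..m}" for j
    by (rule finite_subset[of _ "Pow (verts K)"]) (use R(1)[OF that] K in \<open>auto simp: \<E>_def\<close>)
  define X' where "X' j = {g\<in>X j. \<kappa> * \<gamma> j / m \<le> real (card {d\<in>R j. l d = g})}" for j
  show ?thesis
  proof (intro exI[of _ X'] conjI ballI)
    fix j assume j: "j \<in> {1..m}"
    show "X' j \<subseteq> X j" by (auto simp: X'_def)
    have finX': "finite (X' j)" using X[OF j] G by (auto simp: X'_def intro: finite_subset)
    have "real (card (X' j)) * (\<kappa> * \<gamma> j / m) = (\<Sum>g\<in>X' j. \<kappa> * \<gamma> j / m)" by simp
    also have "\<dots> \<le> (\<Sum>g\<in>X' j. real (card {d\<in>R j. l d = g}))"
      by (rule sum_mono) (simp add: X'_def)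
    also have "\<dots> = real (card (\<Union>g\<in>X' j. {d\<in>R j. l d = g}))"
      using finX' finR[OF j] by (subst card_UN_disjoint) auto
    also have "\<dots> \<le> real (card (R j))" using finR[OF j] by (intro of_nat_mono card_mono) auto
    also have "\<dots> \<le> (\<epsilon> * \<chi>\<^sub>2 / (2 * m)) * real (card (verts K)) ^ s"
      using R(2)[OF j] H(2)[OF e_edge[OF j]] by simp
    also have "\<dots> < (\<epsilon> * c / m) * real (card (verts K)) ^ s"
    proof (rule mult_strict_right_mono)
      have "\<epsilon> * \<chi>\<^sub>2 < \<epsilon> * c * 2" using c \<chi>\<^sub>2 \<epsilon> by (simp add: mult.assoc)
      then show "\<epsilon> * \<chi>\<^sub>2 / (2 * m) < \<epsilon> * c / m" using m by (simp add: field_simps)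
    qed (use cardK in simp)
    also have "\<dots> = (\<epsilon> * real (card G) / \<gamma> j) * (\<kappa> * \<gamma> j / m)"
      using cardG \<gamma>[OF j] m by (simp add: \<kappa>_def field_simps)
    finally have "real (card (X' j)) * (\<kappa> * \<gamma> j / m) < (\<epsilon> * real (card G) / \<gamma> j) * (\<kappa> * \<gamma> j / m)" .
    then show "real (card (X' j)) < \<epsilon> * real (card G) / \<gamma> j"
      by (rule mult_right_less_imp_less) (use \<kappa> \<gamma>[OF j] in simp)
  next
    show "solutions_in m A G (\<Pi>\<^sub>E j\<in>{1..m}. X j - X' j) = {}"
    proof (rule ccontr)
      assume "\<not> ?thesis"
      then obtain x where xS: "x \<in> S" and xX: "\<And>j. j \<in> {1..m} \<Longrightarrow> x j \<in> X j - X' j"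
        by (fastforce simp: solutions_in_def S_def)
      obtain q where q: "q \<in> Q" using Q by blast
      define F where "F = fibre H K r x q"
      have F_copies: "f \<in> copies H K" and F_lab: "\<And>j. j \<in> {1..m} \<Longrightarrow> l (f ` e j) = x j" if "f \<in> F" for f
      proof -
        show f: "f \<in> copies H K" using that by (simp add: F_def fibre_def)
        have "fst (r f) = x" using that by (simp add: F_def fibre_def)
        then show "l (f ` e j) = x j" if "j \<in> {1..m}" for j using r_lab[OF f] that by auto
      qed
      have finF: "finite F" using fin_copies F_copies by (auto intro: finite_subset)
      \<comment> \<open>All copies in one fibre carry the labels \<open>x j\<close>, so only removed edges with these labels can meet them.\<close>
      define Rx where "Rx j = {d\<in>R j. l d = x j}" for j
      have finRx: "finite (Rx j)" if "j \<in> {1..m}" for j using finR[OF that] by (simp add: Rx_def)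
      define N where "N j d = {f\<in>F. d \<in> copy_edges H f}" for j :: nat and d
      have cover: "F \<subseteq> (\<Union>j\<in>{1..m}. \<Union>d\<in>Rx j. N j d)"
      proof
        fix f assume f: "f \<in> F"
        have "f \<in> edge_copies (verts H) (verts K) {1..m} e \<E>"
          unfolding copies_in using F_copies[OF f] F_lab[OF f] xX by auto
        then obtain j where j: "j \<in> {1..m}" "f ` e j \<in> R j" using R(3) by blast
        have "f ` e j \<in> Rx j" using j F_lab[OF f j(1)] by (simp add: Rx_def)
        moreover have "f \<in> N j (f ` e j)" using f e_edge[OF j(1)] by (auto simp: N_def copy_edges_def)
        ultimately show "f \<in> (\<Union>j\<in>{1..m}. \<Union>d\<in>Rx j. N j d)" using j(1) by blast
      qed
      have N_card: "real (card (N j d)) \<le> real p * (\<Gamma> / \<gamma> j)" if j: "j \<in> {1..m}" and d: "d \<in> Rx j" for j d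
      proof (cases "N j d = {}")
        case True
        then show ?thesis using p \<Gamma> \<gamma>[OF j] by simp
      next
        case False
        then obtain f where f: "f \<in> F" "d \<in> copy_edges H f" by (auto simp: N_def)
        have "colour K d = j" using d R(1)[OF j] by (auto simp: Rx_def \<E>_def)
        then show ?thesis
          using RP3 xS q f j unfolding RP3_def S_def[symmetric] F_def N_def \<Gamma>_def by fastforce
      qed
      have "real p * \<kappa> * \<Gamma> = real (card F)" unfolding F_def by (rule fib[OF xS q, symmetric])
      also have "\<dots> \<le> real (card (\<Union>j\<in>{1..m}. \<Union>d\<in>Rx j. N j d))"
        using finRx finF by (intro of_nat_mono card_mono cover) (auto simp: N_def)
      also have "\<dots> \<le> (\<Sum>j\<in>{1..m}. real (card (\<Union>d\<in>Rx j. N j d)))"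
        unfolding of_nat_sum[symmetric] of_nat_le_iff by (rule card_UN_le) simp
      also have "\<dots> < (\<Sum>j\<in>{1..m}. real p * \<kappa> * \<Gamma> / m)"
      proof (rule sum_strict_mono)
        fix j assume j: "j \<in> {1..m}"
        have "real (card (\<Union>d\<in>Rx j. N j d)) \<le> (\<Sum>d\<in>Rx j. real (card (N j d)))"
          unfolding of_nat_sum[symmetric] of_nat_le_iff by (rule card_UN_le[OF finRx[OF j]])
        also have "\<dots> \<le> (\<Sum>d\<in>Rx j. real p * (\<Gamma> / \<gamma> j))" by (rule sum_mono) (rule N_card[OF j])
        also have "\<dots> = real (card (Rx j)) * (real p * (\<Gamma> / \<gamma> j))" by simp
        also have "\<dots> < (\<kappa> * \<gamma> j / m) * (real p * (\<Gamma> / \<gamma> j))"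
        proof (rule mult_strict_right_mono)
          show "real (card (Rx j)) < \<kappa> * \<gamma> j / m" using xX[OF j] by (simp add: X'_def Rx_def not_le)
        qed (use p \<Gamma> \<gamma>[OF j] in simp)
        also have "\<dots> = real p * \<kappa> * \<Gamma> / m" using \<gamma>[OF j] by simp
        finally show "real (card (\<Union>d\<in>Rx j. N j d)) < real p * \<kappa> * \<Gamma> / m" .
      qed (use m in auto)
      also have "\<dots> = real p * \<kappa> * \<Gamma>" using m by simp
      finally show False by simp
    qed
  qed
qed

theorem theorem1:
  fixes m :: nat
    and I :: "'i set"
    and A :: "'i \<Rightarrow> (nat \<Rightarrow> 'g) \<Rightarrow> bool"
    and G :: "'i \<Rightarrow> 'g set"
    and \<gamma> :: "'i \<Rightarrow> nat \<Rightarrow> real"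
  assumes "m > 0"
    and "system_family m I A G \<gamma>"
    and "representable m I A G \<gamma>"
  shows "\<forall>\<epsilon>::real. \<epsilon> > 0 \<longrightarrow> (\<exists>\<delta>::real. \<delta> > 0 \<and>
    (\<forall>i\<in>I. \<forall>X :: nat \<Rightarrow> 'g set.
       (\<forall>j\<in>{1..m}. X j \<subseteq> G i) \<longrightarrow>
       real (card (solutions_in m (A i) (G i) (Pi\<^sub>E {1..m} X)))
         < \<delta> * real (card (solutions m (A i) (G i))) \<longrightarrow>
       (\<exists>X' :: nat \<Rightarrow> 'g set.
          (\<forall>j\<in>{1..m}. X' j \<subseteq> X j \<and>
             real (card (X' j)) < \<epsilon> * real (card (G i)) / \<gamma> i j) \<and>
          solutions_in m (A i) (G i) (\<Pi>\<^sub>E j\<in>{1..m}. X j - X' j) = {})))"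
proof (intro allI impI)
  fix \<epsilon> :: real assume \<epsilon>: "\<epsilon> > 0"
  obtain \<chi>\<^sub>1 \<chi>\<^sub>2 where \<chi>\<^sub>2: "\<chi>\<^sub>2 > 0" and rep: "\<forall>i\<in>I.
        \<exists>s. \<exists>(K :: nat coloured_hypergraph) (H :: nat coloured_hypergraph) e l.
          RP1 m (G i) \<chi>\<^sub>1 s K H e l \<and>
          (\<exists>p (Q :: nat set) r.
             RP2 m (A i) (G i) (\<gamma> i) \<chi>\<^sub>2 s K H e l p Q r \<and>
             RP3 m (A i) (G i) (\<gamma> i) K H p Q r)"
    using assms(3) unfolding representable_def by blast
  have "\<epsilon> * \<chi>\<^sub>2 / (2 * m) > 0" using \<epsilon> \<chi>\<^sub>2 assms(1) by simp
  from hypergraph_removal[OF this, of "nat \<lfloor>\<chi>\<^sub>1\<rfloor>"] obtain \<delta> :: real where \<delta>_removal: "\<delta> > 0 \<and>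
    (\<forall>(W :: nat set) (V :: nat set) (I :: nat set) e \<E>.
     finite W \<longrightarrow> card W \<le> nat \<lfloor>\<chi>\<^sub>1\<rfloor> \<longrightarrow> finite V \<longrightarrow> (\<forall>i\<in>I. e i \<subseteq> W) \<longrightarrow>
     real (card (edge_copies W V I e \<E>)) < \<delta> * real (card V) ^ card W \<longrightarrow>
     (\<exists>R. (\<forall>i\<in>I. R i \<subseteq> \<E> i \<and> real (card (R i)) \<le> (\<epsilon> * \<chi>\<^sub>2 / (2 * m)) * real (card V) ^ card (e i)) \<and>
          (\<forall>f\<in>edge_copies W V I e \<E>. \<exists>i\<in>I. f ` e i \<in> R i)))" ..
  note \<delta> = conjunct1[OF \<delta>_removal]
  note removal = conjunct2[OF \<delta>_removal, THEN spec, THEN spec, THEN spec, THEN spec, THEN spec,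
    THEN mp, THEN mp, THEN mp, THEN mp, THEN mp]
  show "\<exists>\<delta>::real. \<delta> > 0 \<and>
    (\<forall>i\<in>I. \<forall>X :: nat \<Rightarrow> 'g set.
       (\<forall>j\<in>{1..m}. X j \<subseteq> G i) \<longrightarrow>
       real (card (solutions_in m (A i) (G i) (Pi\<^sub>E {1..m} X)))
         < \<delta> * real (card (solutions m (A i) (G i))) \<longrightarrow>
       (\<exists>X' :: nat \<Rightarrow> 'g set.
          (\<forall>j\<in>{1..m}. X' j \<subseteq> X j \<and>
             real (card (X' j)) < \<epsilon> * real (card (G i)) / \<gamma> i j) \<and>
          solutions_in m (A i) (G i) (\<Pi>\<^sub>E j\<in>{1..m}. X j - X' j) = {}))"
  proof (intro exI[of _ \<delta>] conjI \<delta> ballI allI impI)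
    fix i X assume i: "i \<in> I" and X: "\<forall>j\<in>{1..m}. X j \<subseteq> G i"
      and few: "real (card (solutions_in m (A i) (G i) (Pi\<^sub>E {1..m} X)))
         < \<delta> * real (card (solutions m (A i) (G i)))"
    obtain s and K H :: "nat coloured_hypergraph" and e l p and Q :: "nat set" and r
      where RP: "RP1 m (G i) \<chi>\<^sub>1 s K H e l" "RP2 m (A i) (G i) (\<gamma> i) \<chi>\<^sub>2 s K H e l p Q r"
        "RP3 m (A i) (G i) (\<gamma> i) K H p Q r"
      using rep i by blast
    have H: "finite (verts H)" "card (verts H) \<le> nat \<lfloor>\<chi>\<^sub>1\<rfloor>" and K: "finite (verts K)"
      using RP(1) by (auto simp: RP1_def uniform_coloured_hypergraph_def le_nat_floor)
    have "e j \<in> edges H" if "j \<in> {1..m}" for j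
      using RP(1) bij_betwE that unfolding RP1_def by blast
    then have eH: "\<forall>j\<in>{1..m}. e j \<subseteq> verts H"
      using RP(1) unfolding RP1_def uniform_coloured_hypergraph_def by blast
    show "\<exists>X'. (\<forall>j\<in>{1..m}. X' j \<subseteq> X j \<and> real (card (X' j)) < \<epsilon> * real (card (G i)) / \<gamma> i j) \<and>
          solutions_in m (A i) (G i) (\<Pi>\<^sub>E j\<in>{1..m}. X j - X' j) = {}"
      using assms(2) i X
      by (intro representable_system_removal[OF assms(1) _ _ \<epsilon> \<chi>\<^sub>2 RP removal[OF H(1,2) K eH] _ \<delta> few])
        (auto simp: system_family_def)
  qed
qed

end
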